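(* Let $\omega$ be a near-symplectic form on an oriented smooth $2n$-manifold $M$, with singular locus $Z_\omega$ (a codimension 3 submanifold of $M$). Then $\omega$ induces a Hamiltonian structure on $Z_\omega$: the restriction $\omega_Z=i^*\omega$ to $Z_\omega$, where $i\colon Z_\omega\to M$ is the inclusion, is a closed 2-form on the $(2n-3)$-manifold $Z_\omega$ with $\omega_Z^{\,n-2}\neq0$ everywhere.
   Context: Near-symplectic forms. Let $M$ be an oriented smooth $2n$-manifold and $\omega\in\Omega^2(M)$ a closed 2-form with $\omega^n\ge 0$ everywhere. At a point $p$ let $K=K_p=\{v\in T_pM\mid \omega_p(v,\cdot)=0\}$. If $\dim K=4$, define $D_K\colon K\to\Lambda^2K^*$ by $D_K(v)=(\nabla_v\omega)_p|_{K\times K}$, the intrinsic gradient of $\omega$ at $p$ in the direction $v$, followed by restriction of 2-forms to $K$ (independent of the connection or local coordinates used to differentiate). The form $\omega$ is near-symplectic if it is closed, $\omega^n\ge0$, and at every point $p$ where $\omega^n_p=0$ the kernel $K$ is 4-dimensional and $\mathrm{Im}(D_K)$ has dimension 3. The singular locus is $Z_\omega=\{p\in M\mid\omega_p^{n-1}=0\}$ (equivalently, where $\omega_p^n=0$). Hamiltonian structures. A Hamiltonian structure on an oriented $(2m-1)$-dimensional manifold $N$ is a closed 2-form $\Omega$ on $N$ such that $\Omega^{m-1}\ne0$ everywhere. *)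

theory Defs
  imports "HOL-Analysis.Analysis" "HOL-Library.Function_Algebras"
begin

section \<open>Smooth maps between Euclidean spaces\<close>

(* Used for open S only.  In finite dimensions, continuity of all directional derivatives
   up to order k, for a function differentiable at each stage, is the usual class C^k. *)

primrec Ck_on :: "nat \<Rightarrow> 'v::real_normed_vector set \<Rightarrow> ('v \<Rightarrow> 'w::real_normed_vector) \<Rightarrow> bool" where
  "Ck_on 0 S f \<longleftrightarrow> continuous_on S f"
| "Ck_on (Suc k) S f \<longleftrightarrow>
     (\<forall>x\<in>S. f differentiable (at x)) \<and> (\<forall>v. Ck_on k S (\<lambda>x. frechet_derivative f (at x) v))"

definition smooth_on :: "'v::real_normed_vector set \<Rightarrow> ('v \<Rightarrow> 'w::real_normed_vector) \<Rightarrow> bool" where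
  "smooth_on S f \<longleftrightarrow> (\<forall>k. Ck_on k S f)"


section \<open>Smooth manifolds\<close>

(* A chart is a pair of its domain and its coordinate map; the value of the coordinate map
   outside the domain is irrelevant.  The dimension of a manifold is CARD('k). *)

type_synonym ('a, 'k) chart = "'a set \<times> ('a \<Rightarrow> real ^ 'k)"

definition chart_on :: "'a topology \<Rightarrow> ('a, 'k::finite) chart \<Rightarrow> bool" where
  "chart_on X c \<longleftrightarrow>
     openin X (fst c) \<and> open (snd c ` fst c) \<and>
     homeomorphic_map (subtopology X (fst c)) (top_of_set (snd c ` fst c)) (snd c)"

definition chart_inv :: "('a, 'k::finite) chart \<Rightarrow> real ^ 'k \<Rightarrow> 'a" where
  "chart_inv c = inv_into (fst c) (snd c)"

definition charts_at :: "('a, 'k::finite) chart set \<Rightarrow> 'a \<Rightarrow> ('a, 'k) chart set" where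
  "charts_at A p = {c \<in> A. p \<in> fst c}"

definition local_rep ::
  "('a, 'k::finite) chart \<Rightarrow> ('b, 'l::finite) chart \<Rightarrow> ('a \<Rightarrow> 'b) \<Rightarrow> real ^ 'k \<Rightarrow> real ^ 'l" where
  "local_rep c d f = (\<lambda>x. snd d (f (chart_inv c x)))"

abbreviation transition ::
  "('a, 'k::finite) chart \<Rightarrow> ('a, 'l::finite) chart \<Rightarrow> real ^ 'k \<Rightarrow> real ^ 'l" where
  "transition c d \<equiv> local_rep c d (\<lambda>p. p)"

definition smooth_manifold :: "'a topology \<Rightarrow> ('a, 'k::finite) chart set \<Rightarrow> bool" where
  "smooth_manifold X A \<longleftrightarrow>
     Hausdorff_space X \<and> second_countable X \<and>
     (\<forall>c\<in>A. chart_on X c) \<and> (\<Union>c\<in>A. fst c) = topspace X \<and>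
     (\<forall>c\<in>A. \<forall>d\<in>A. smooth_on (snd c ` (fst c \<inter> fst d)) (transition c d))"

(* An orientation is given by the choice of an atlas whose transition maps have positive
   Jacobian determinant; its charts are the positively oriented ones. *)

definition oriented_manifold :: "'a topology \<Rightarrow> ('a, 'k::finite) chart set \<Rightarrow> bool" where
  "oriented_manifold X A \<longleftrightarrow>
     smooth_manifold X A \<and>
     (\<forall>c\<in>A. \<forall>d\<in>A. \<forall>p \<in> fst c \<inter> fst d.
        det (matrix (frechet_derivative (transition c d) (at (snd c p)))) > 0)"

definition smooth_map ::
  "'a topology \<Rightarrow> ('a, 'k::finite) chart set \<Rightarrow> 'b topology \<Rightarrow> ('b, 'l::finite) chart set
     \<Rightarrow> ('a \<Rightarrow> 'b) \<Rightarrow> bool" where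
  "smooth_map X A Y B f \<longleftrightarrow>
     continuous_map X Y f \<and>
     (\<forall>c\<in>A. \<forall>d\<in>B. smooth_on (snd c ` (fst c \<inter> f -` fst d)) (local_rep c d f))"


section \<open>Tangent spaces\<close>

(* A tangent vector at p is the family of its coordinate vectors in all charts around p, related
   by the derivatives of the transition maps (and 0 at charts not around p).  The vector space
   operations are pointwise. *)

type_synonym ('a, 'k) tvec = "('a, 'k) chart \<Rightarrow> real ^ 'k"

definition tangent_space :: "('a, 'k::finite) chart set \<Rightarrow> 'a \<Rightarrow> ('a, 'k) tvec set" where
  "tangent_space A p =
     {v. (\<forall>c. c \<notin> charts_at A p \<longrightarrow> v c = 0) \<and>
         (\<forall>c\<in>charts_at A p. \<forall>d\<in>charts_at A p.
            v d = frechet_derivative (transition c d) (at (snd c p)) (v c))}"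

text \<open>The tangent vector at \<open>p\<close> with coordinates \<open>e\<close> in the chart \<open>c\<close>.\<close>

definition coord_vector ::
  "('a, 'k::finite) chart set \<Rightarrow> ('a, 'k) chart \<Rightarrow> 'a \<Rightarrow> real ^ 'k \<Rightarrow> ('a, 'k) tvec" where
  "coord_vector A c p e =
     (\<lambda>d. if d \<in> charts_at A p
          then frechet_derivative (transition c d) (at (snd c p)) e else 0)"

(* The choice of the source chart c is irrelevant for a smooth f and a tangent vector v at p. *)

definition differential ::
  "('a, 'k::finite) chart set \<Rightarrow> ('b, 'l::finite) chart set \<Rightarrow> ('a \<Rightarrow> 'b) \<Rightarrow> 'a
     \<Rightarrow> ('a, 'k) tvec \<Rightarrow> ('b, 'l) tvec" where
  "differential A B f p v =
     (let c = (SOME c. c \<in> charts_at A p) in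
      (\<lambda>d. if d \<in> charts_at B (f p)
           then frechet_derivative (local_rep c d f) (at (snd c p)) (v c) else 0))"

(* Embedded submanifold: Z carries the subspace topology and a smooth structure for which the
   inclusion is a smooth immersion. *)

definition embedded_submanifold ::
  "'a topology \<Rightarrow> ('a, 'k::finite) chart set \<Rightarrow> 'a set \<Rightarrow> ('a, 'l::finite) chart set \<Rightarrow> bool" where
  "embedded_submanifold X A Z B \<longleftrightarrow>
     Z \<subseteq> topspace X \<and>
     smooth_manifold (subtopology X Z) B \<and>
     smooth_map (subtopology X Z) B X A (\<lambda>p. p) \<and>
     (\<forall>p\<in>Z. inj_on (differential B A (\<lambda>p. p) p) (tangent_space B p))"

(* v 0, v 1, ... is a positively oriented frame; 'k is enumerated in increasing order. *)

definition oriented_frame ::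
  "('a, 'k::{finite,linorder}) chart set \<Rightarrow> 'a \<Rightarrow> (nat \<Rightarrow> ('a, 'k) tvec) \<Rightarrow> bool" where
  "oriented_frame A p v \<longleftrightarrow>
     (\<forall>i. v i \<in> tangent_space A p) \<and>
     (\<forall>c\<in>charts_at A p. det (\<chi> i j. v (card {k. k < j}) c $ i) > 0)"


section \<open>Exterior powers of an alternating bilinear form\<close>

(* An alternating p-form on 'v is a function of sequences of vectors depending only on the
   entries with index below p. *)

definition wedge ::
  "nat \<Rightarrow> nat \<Rightarrow> ((nat \<Rightarrow> 'v) \<Rightarrow> real) \<Rightarrow> ((nat \<Rightarrow> 'v) \<Rightarrow> real) \<Rightarrow> (nat \<Rightarrow> 'v) \<Rightarrow> real" where
  "wedge p q \<alpha> \<beta> v =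
     (\<Sum>\<sigma> | \<sigma> permutes {..<p + q}.
        of_int (sign \<sigma>) * \<alpha> (\<lambda>i. v (\<sigma> i)) * \<beta> (\<lambda>i. v (\<sigma> (p + i)))) / (fact p * fact q)"

primrec wedge_power :: "('v \<Rightarrow> 'v \<Rightarrow> real) \<Rightarrow> nat \<Rightarrow> (nat \<Rightarrow> 'v) \<Rightarrow> real" where
  "wedge_power \<eta> 0 = (\<lambda>v. 1)"
| "wedge_power \<eta> (Suc m) = wedge (2 * m) 2 (wedge_power \<eta> m) (\<lambda>v. \<eta> (v 0) (v 1))"


section \<open>Differential 2-forms\<close>

type_synonym ('a, 'k) form2 = "'a \<Rightarrow> ('a, 'k) tvec \<Rightarrow> ('a, 'k) tvec \<Rightarrow> real"

text \<open>The local representation of a form in the chart \<open>c\<close>, at the coordinate point \<open>x\<close>.\<close>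

definition form_rep ::
  "('a, 'k::finite) chart set \<Rightarrow> ('a, 'k) form2 \<Rightarrow> ('a, 'k) chart
     \<Rightarrow> real ^ 'k \<Rightarrow> real ^ 'k \<Rightarrow> real ^ 'k \<Rightarrow> real" where
  "form_rep A \<omega> c x u w =
     \<omega> (chart_inv c x) (coord_vector A c (chart_inv c x) u) (coord_vector A c (chart_inv c x) w)"

definition smooth_form2 :: "'a topology \<Rightarrow> ('a, 'k::finite) chart set \<Rightarrow> ('a, 'k) form2 \<Rightarrow> bool" where
  "smooth_form2 X A \<omega> \<longleftrightarrow>
     (\<forall>p\<in>topspace X. \<forall>u\<in>tangent_space A p. \<forall>v\<in>tangent_space A p. \<forall>w\<in>tangent_space A p. \<forall>a b.
        \<omega> p (\<lambda>c. a *\<^sub>R u c + b *\<^sub>R v c) w = a * \<omega> p u w + b * \<omega> p v w \<and>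
        \<omega> p u v = - \<omega> p v u) \<and>
     (\<forall>c\<in>A. \<forall>u w. smooth_on (snd c ` fst c) (\<lambda>x. form_rep A \<omega> c x u w))"

definition ext_deriv ::
  "('a, 'k::finite) chart set \<Rightarrow> ('a, 'k) form2 \<Rightarrow> ('a, 'k) chart
     \<Rightarrow> real ^ 'k \<Rightarrow> real ^ 'k \<Rightarrow> real ^ 'k \<Rightarrow> real ^ 'k \<Rightarrow> real" where
  "ext_deriv A \<omega> c x u v w =
     frechet_derivative (\<lambda>y. form_rep A \<omega> c y v w) (at x) u
     - frechet_derivative (\<lambda>y. form_rep A \<omega> c y u w) (at x) v
     + frechet_derivative (\<lambda>y. form_rep A \<omega> c y u v) (at x) w"

definition closed_form2 :: "'a topology \<Rightarrow> ('a, 'k::finite) chart set \<Rightarrow> ('a, 'k) form2 \<Rightarrow> bool" where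
  "closed_form2 X A \<omega> \<longleftrightarrow>
     smooth_form2 X A \<omega> \<and>
     (\<forall>c\<in>A. \<forall>x \<in> snd c ` fst c. \<forall>u v w. ext_deriv A \<omega> c x u v w = 0)"

definition pullback ::
  "('a, 'k::finite) chart set \<Rightarrow> ('b, 'l::finite) chart set \<Rightarrow> ('a \<Rightarrow> 'b)
     \<Rightarrow> ('b, 'l) form2 \<Rightarrow> ('a, 'k) form2" where
  "pullback A B f \<omega> p u w = \<omega> (f p) (differential A B f p u) (differential A B f p w)"

text \<open>\<open>\<omega>\<^sup>m = 0\<close> at the point \<open>p\<close>, as a form on the tangent space.\<close>

definition power_vanishes_at ::
  "('a, 'k::finite) chart set \<Rightarrow> ('a, 'k) form2 \<Rightarrow> nat \<Rightarrow> 'a \<Rightarrow> bool" where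
  "power_vanishes_at A \<omega> m p \<longleftrightarrow>
     (\<forall>v. (\<forall>i. v i \<in> tangent_space A p) \<longrightarrow> wedge_power (\<omega> p) m v = 0)"


section \<open>Near-symplectic forms and Hamiltonian structures\<close>

(* Tangent vectors and real functions of two tangent vectors are functions, with the pointwise
   additive structure of Function_Algebras and the following pointwise scalings. *)

abbreviation tvec_scale :: "real \<Rightarrow> ('a, 'k::finite) tvec \<Rightarrow> ('a, 'k) tvec" where
  "tvec_scale a v \<equiv> (\<lambda>c. a *\<^sub>R v c)"

abbreviation bifun_scale :: "real \<Rightarrow> ('v \<Rightarrow> 'v \<Rightarrow> real) \<Rightarrow> 'v \<Rightarrow> 'v \<Rightarrow> real" where
  "bifun_scale a \<eta> \<equiv> (\<lambda>u w. a * \<eta> u w)"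

lemma vector_space_tvec_scale:
  "vector_space (tvec_scale :: real \<Rightarrow> ('a, 'k::finite) tvec \<Rightarrow> ('a, 'k) tvec)"
  by unfold_locales (simp_all add: fun_eq_iff algebra_simps)

lemma vector_space_bifun_scale:
  "vector_space (bifun_scale :: real \<Rightarrow> ('v \<Rightarrow> 'v \<Rightarrow> real) \<Rightarrow> 'v \<Rightarrow> 'v \<Rightarrow> real)"
  by unfold_locales (simp_all add: fun_eq_iff algebra_simps)

definition form_kernel :: "('a, 'k::finite) chart set \<Rightarrow> ('a, 'k) form2 \<Rightarrow> 'a \<Rightarrow> ('a, 'k) tvec set" where
  "form_kernel A \<omega> p = {v \<in> tangent_space A p. \<forall>w\<in>tangent_space A p. \<omega> p v w = 0}"

(* D_K computed with the flat connection of the chart c; on the kernel it does not depend on c.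
   A form on K is represented by its extension by 0 outside K x K. *)

definition kernel_gradient ::
  "('a, 'k::finite) chart set \<Rightarrow> ('a, 'k) form2 \<Rightarrow> 'a \<Rightarrow> ('a, 'k) chart
     \<Rightarrow> ('a, 'k) tvec \<Rightarrow> ('a, 'k) tvec \<Rightarrow> ('a, 'k) tvec \<Rightarrow> real" where
  "kernel_gradient A \<omega> p c v =
     (\<lambda>u w. if u \<in> form_kernel A \<omega> p \<and> w \<in> form_kernel A \<omega> p
            then frechet_derivative (\<lambda>x. form_rep A \<omega> c x (u c) (w c)) (at (snd c p)) (v c)
            else 0)"

(* n is half the dimension of the manifold. *)

definition near_symplectic ::
  "'a topology \<Rightarrow> ('a, 'k::{finite,linorder}) chart set \<Rightarrow> nat \<Rightarrow> ('a, 'k) form2 \<Rightarrow> bool" where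
  "near_symplectic X A n \<omega> \<longleftrightarrow>
     closed_form2 X A \<omega> \<and>
     (\<forall>p\<in>topspace X. \<forall>v. oriented_frame A p v \<longrightarrow> wedge_power (\<omega> p) n v \<ge> 0) \<and>
     (\<forall>p\<in>topspace X. power_vanishes_at A \<omega> n p \<longrightarrow>
        vector_space.dim tvec_scale (form_kernel A \<omega> p) = 4 \<and>
        (\<forall>c\<in>charts_at A p.
           vector_space.dim bifun_scale (kernel_gradient A \<omega> p c ` form_kernel A \<omega> p) = 3))"

definition singular_locus ::
  "'a topology \<Rightarrow> ('a, 'k::finite) chart set \<Rightarrow> nat \<Rightarrow> ('a, 'k) form2 \<Rightarrow> 'a set" where
  "singular_locus X A n \<omega> = {p \<in> topspace X. power_vanishes_at A \<omega> (n - 1) p}"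

definition hamiltonian_structure ::
  "'a topology \<Rightarrow> ('a, 'l::finite) chart set \<Rightarrow> nat \<Rightarrow> ('a, 'l) form2 \<Rightarrow> bool" where
  "hamiltonian_structure Y B m \<Omega> \<longleftrightarrow>
     oriented_manifold Y B \<and> CARD('l) = 2 * m - 1 \<and>
     closed_form2 Y B \<Omega> \<and>
     (\<forall>q\<in>topspace Y. \<not> power_vanishes_at B \<Omega> (m - 1) q)"

end

theory Submission
  imports Defs
begin

text \<open>
  At a point of the singular locus the kernel \<open>K\<close> of \<open>\<omega>\<close> is four-dimensional, and
  \<open>\<omega>\<close> is nondegenerate on a complement.  A frame that consists at the
  point of a basis of \<open>K\<close> and of a Darboux basis of the complement is, near the point, made orthogonal
  to one Darboux pair after the other with respect to \<open>\<omega>\<close>.  The form then splits into a nondegenerate block and a skew \<open>4 \<times> 4\<close>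
  matrix \<open>S\<close>, and \<open>\<omega>\<^sup>n\<close> is a positive multiple of the Pfaffian of \<open>S\<close>; so this
  Pfaffian is nonnegative.  The Pfaffian is a quadratic form of signature \<open>(3,3)\<close> on skew
  matrices, positive definite on the self-dual and negative definite on the anti-self-dual ones.  Hence
  \<open>S\<close> vanishes as soon as its self-dual part \<open>f\<close> does.  At a singular point, the same
  argument applied to the derivative of \<open>S\<close>, which is \<open>D\<^sub>K\<close>, shows that the self-dual
  part is injective on the three-dimensional image of \<open>D\<^sub>K\<close>.  So \<open>f\<close> is a local
  equation of the singular locus \<open>Z\<close>, with values in \<open>\<real>\<^sup>3\<close>, whose derivative is onto
  already on \<open>K\<close> (\<open>local_equation\<close>).  The inverse function theorem gives submanifold charts
  of \<open>Z\<close> (\<open>adapted_exists\<close>, \<open>embedded\<close>).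

  Since \<open>Df\<close> maps \<open>K\<close> onto \<open>\<real>\<^sup>3\<close>, the line \<open>K \<inter> T Z\<close> is left in
  \<open>K\<close>, and \<open>T M = K + T Z\<close>.  A vector of \<open>T Z\<close> orthogonal to \<open>T Z\<close> is therefore orthogonal
  to \<open>T M\<close> and lies on this line.  So the restriction has rank at least
  \<open>(2n - 3) - 1 = 2(n - 2)\<close>, and its power \<open>n - 2\<close> does not vanish
  (\<open>restriction_nondegenerate\<close>).  It is closed because the exterior derivative commutes with
  the pullback (\<open>closed_restriction\<close>).

  What takes more work is that \<open>Z\<close> is oriented.  The charts are chosen so that \<open>f\<close>,
  followed by the coordinates on \<open>Z\<close>, is positively oriented in \<open>M\<close>; then the coordinates on
  \<open>Z\<close> are consistently oriented if the maps \<open>Df\<close> orient the normal bundle consistently.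
  The kernel \<open>K\<close> is oriented by \<open>M\<close> and the Darboux frame of the complement, whatever this
  frame is (\<open>pos_frame_change\<close>).  A change of the frame of \<open>K\<close> by a matrix \<open>g\<close> acts on
  two-forms and moves the self-dual projection; on a three-dimensional space on which the Pfaffian is
  nonnegative, the projection remains injective all along a path of such \<open>g\<close>, so its orientation
  does not change when \<open>det g > 0\<close> (\<open>sd_mat_congr_sign\<close>, \<open>normal_orientation\<close>).
  The Pfaffian may be degenerate on the image of \<open>D\<^sub>K\<close>, so the image itself need not be a
  definite subspace; injectivity of the projection is what survives.
\<close>

section \<open>Calculus of smooth maps\<close>

lemma has_derivative_cong_open:
  assumes "open S" "x \<in> S" "\<And>y. y \<in> S \<Longrightarrow> f y = g y"
  shows "(f has_derivative D) (at x) \<longleftrightarrow> (g has_derivative D) (at x)"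
  using assms has_derivative_transform_within_open by metis

lemma frechet_derivative_cong_open:
  assumes "open S" "x \<in> S" "\<And>y. y \<in> S \<Longrightarrow> f y = g y"
  shows "frechet_derivative f (at x) = frechet_derivative g (at x)"
  using has_derivative_cong_open[OF assms] by (simp add: frechet_derivative_def)

lemma Ck_on_cong:
  assumes "open S" "\<And>x. x \<in> S \<Longrightarrow> f x = g x"
  shows "Ck_on k S f \<longleftrightarrow> Ck_on k S g"
  using assms(2)
proof (induction k arbitrary: f g)
  case 0
  then show ?case by (simp cong: continuous_on_cong)
next
  case (Suc k)
  have "f differentiable (at x) \<longleftrightarrow> g differentiable (at x)" if "x \<in> S" for x
    using has_derivative_cong_open[OF assms(1) that, of f g] Suc.prems by (simp add: differentiable_def)
  moreover have "Ck_on k S (\<lambda>x. frechet_derivative f (at x) v)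
      \<longleftrightarrow> Ck_on k S (\<lambda>x. frechet_derivative g (at x) v)" for v
    by (rule Suc.IH) (simp add: frechet_derivative_cong_open[OF assms(1) _ Suc.prems])
  ultimately show ?case by simp
qed

lemma Ck_on_SucI:
  assumes "open S" "\<And>x. x \<in> S \<Longrightarrow> (f has_derivative f' x) (at x)"
    "\<And>v. Ck_on k S (\<lambda>x. f' x v)"
  shows "Ck_on (Suc k) S f"
proof -
  have "Ck_on k S (\<lambda>x. frechet_derivative f (at x) v)" for v
    using assms(3)[of v] Ck_on_cong[OF assms(1), of "\<lambda>x. frechet_derivative f (at x) v" "\<lambda>x. f' x v"]
    by (simp add: frechet_derivative_at[OF assms(2), symmetric])
  with assms(2) show ?thesis by (auto simp: differentiable_def)
qed

lemma Ck_on_Suc_has_derivative: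
  "Ck_on (Suc k) S f \<Longrightarrow> x \<in> S \<Longrightarrow> (f has_derivative frechet_derivative f (at x)) (at x)"
  by (simp add: frechet_derivative_works[symmetric])

lemma Ck_on_subset: "Ck_on k S f \<Longrightarrow> T \<subseteq> S \<Longrightarrow> Ck_on k T f"
  by (induction k arbitrary: f) (auto intro: continuous_on_subset)

lemma Ck_on_Suc_imp: "Ck_on (Suc k) S f \<Longrightarrow> Ck_on k S f"
proof (induction k arbitrary: f)
  case 0
  then show ?case
    by (simp add: differentiable_imp_continuous_on differentiable_at_imp_differentiable_on)
qed auto

lemma Ck_on_imp_continuous_on: "Ck_on k S f \<Longrightarrow> continuous_on S f"
  by (induction k) (simp, blast dest: Ck_on_Suc_imp)

lemma Ck_on_const: "open S \<Longrightarrow> Ck_on k S (\<lambda>x. c)"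
proof (induction k arbitrary: c)
  case (Suc k)
  then show ?case by (intro Ck_on_SucI[where f' = "\<lambda>x v. 0"]) auto
qed auto

lemma Ck_on_bounded_linear: 
  assumes "bounded_linear f" "open S"
  shows "Ck_on k S f"
proof (cases k)
  case 0 then show ?thesis using assms by (simp add: linear_continuous_on)
next
  case (Suc m)
  show ?thesis unfolding Suc
    by (rule Ck_on_SucI[where f' = "\<lambda>x. f"])
      (use assms in \<open>auto intro: Ck_on_const bounded_linear_imp_has_derivative\<close>)
qed

lemma Ck_on_compose_linear:
  assumes "bounded_linear h" "open S" "Ck_on k S f"
  shows "Ck_on k S (\<lambda>x. h (f x))"
  using assms(3)
proof (induction k arbitrary: f)
  case 0
  then show ?case by (simp add: bounded_linear.continuous_on[OF assms(1)])
next
  case (Suc k)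
  show ?case
  proof (rule Ck_on_SucI[OF assms(2), where f' = "\<lambda>x v. h (frechet_derivative f (at x) v)"])
    show "((\<lambda>x. h (f x)) has_derivative (\<lambda>v. h (frechet_derivative f (at x) v))) (at x)" if "x \<in> S" for x
      by (rule bounded_linear.has_derivative[OF assms(1) Ck_on_Suc_has_derivative[OF Suc.prems that]])
    show "Ck_on k S (\<lambda>x. h (frechet_derivative f (at x) v))" for v
      by (rule Suc.IH) (use Suc.prems in simp)
  qed
qed

lemma Ck_on_add:
  assumes "open S" "Ck_on k S f" "Ck_on k S g"
  shows "Ck_on k S (\<lambda>x. f x + g x)"
  using assms(2,3)
proof (induction k arbitrary: f g)
  case 0
  then show ?case by (simp add: continuous_on_add)
next
  case (Suc k)
  show ?case
  proof (rule Ck_on_SucI[OF assms(1), where f' = "\<lambda>x v. frechet_derivative f (at x) v + frechet_derivative g (at x) v"])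
    show "((\<lambda>x. f x + g x) has_derivative (\<lambda>v. frechet_derivative f (at x) v + frechet_derivative g (at x) v)) (at x)"
      if "x \<in> S" for x
      by (intro has_derivative_add Ck_on_Suc_has_derivative[OF Suc.prems(1) that] Ck_on_Suc_has_derivative[OF Suc.prems(2) that])
    show "Ck_on k S (\<lambda>x. frechet_derivative f (at x) v + frechet_derivative g (at x) v)" for v
      by (rule Suc.IH) (use Suc.prems in simp_all)
  qed
qed

lemma Ck_on_bilinear:
  assumes "bounded_bilinear P" "open S" "Ck_on k S f" "Ck_on k S g"
  shows "Ck_on k S (\<lambda>x. P (f x) (g x))"
  using assms(3,4)
proof (induction k arbitrary: f g)
  case 0
  then show ?case using assms(1) by (auto intro: bounded_bilinear.continuous_on)
next
  case (Suc k)
  show ?case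
  proof (rule Ck_on_SucI[OF assms(2), where f' = "\<lambda>x v. P (f x) (frechet_derivative g (at x) v)
        + P (frechet_derivative f (at x) v) (g x)"])
    show "((\<lambda>x. P (f x) (g x)) has_derivative
        (\<lambda>v. P (f x) (frechet_derivative g (at x) v) + P (frechet_derivative f (at x) v) (g x))) (at x)"
      if "x \<in> S" for x
      by (rule bounded_bilinear.FDERIV[OF assms(1)]) (use Suc.prems that Ck_on_Suc_has_derivative in blast)+
    show "Ck_on k S (\<lambda>x. P (f x) (frechet_derivative g (at x) v)
        + P (frechet_derivative f (at x) v) (g x))" for v
      using Suc.prems Suc.prems[THEN Ck_on_Suc_imp]
      by (intro Ck_on_add[OF assms(2)] Suc.IH) auto
  qed
qed

lemma Ck_on_sum:
  assumes "open S" "\<And>i. i \<in> I \<Longrightarrow> Ck_on k S (f i)"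
  shows "Ck_on k S (\<lambda>x. \<Sum>i\<in>I. f i x)"
  using assms(2) by (induction I rule: infinite_finite_induct) (simp_all add: Ck_on_const Ck_on_add assms(1))

lemma has_derivative_euclidean_sum:
  fixes g :: "'v::euclidean_space \<Rightarrow> 'w::real_normed_vector"
  assumes "(g has_derivative g') (at y)"
  shows "g' w = (\<Sum>b\<in>Basis. (w \<bullet> b) *\<^sub>R g' b)"
proof -
  interpret linear g' using assms has_derivative_linear by blast
  have "g' w = g' (\<Sum>b\<in>Basis. (w \<bullet> b) *\<^sub>R b)" by (simp add: euclidean_representation)
  also have "\<dots> = (\<Sum>b\<in>Basis. (w \<bullet> b) *\<^sub>R g' b)" by (simp add: sum scaleR)
  finally show ?thesis .
qed

text \<open>The directional derivatives of \<open>g \<circ> f\<close> are finite sums of products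
  \<open>(Df v \<bullet> b) (D\<^sub>b g \<circ> f)\<close> over a basis, to which the induction hypothesis applies.\<close>

lemma Ck_on_compose:
  fixes g :: "'v::euclidean_space \<Rightarrow> 'w::real_normed_vector"
  assumes "open S" "open T" "Ck_on k S f" "Ck_on k T g" "f ` S \<subseteq> T"
  shows "Ck_on k S (\<lambda>x. g (f x))"
  using assms(3,4)
proof (induction k arbitrary: g)
  case 0
  then show ?case using assms(5) by (auto intro: continuous_on_compose2)
next
  case (Suc k)
  note f = Ck_on_Suc_has_derivative[OF Suc.prems(1)] and g = Ck_on_Suc_has_derivative[OF Suc.prems(2)]
  show ?case
  proof (rule Ck_on_SucI[OF assms(1), where f' = "\<lambda>x v. frechet_derivative g (at (f x)) (frechet_derivative f (at x) v)"])
    show "((\<lambda>x. g (f x)) has_derivative (\<lambda>v. frechet_derivative g (at (f x)) (frechet_derivative f (at x) v))) (at x)"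
      if "x \<in> S" for x
      by (rule has_derivative_compose[OF f[OF that] g]) (use that assms(5) in auto)
    fix v
    have eq: "frechet_derivative g (at (f x)) (frechet_derivative f (at x) v)
        = (\<Sum>b\<in>Basis. (frechet_derivative f (at x) v \<bullet> b) *\<^sub>R frechet_derivative g (at (f x)) b)" if "x \<in> S" for x
      by (rule has_derivative_euclidean_sum[OF g]) (use that assms(5) in auto)
    have "Ck_on k S (\<lambda>x. \<Sum>b\<in>Basis. (frechet_derivative f (at x) v \<bullet> b) *\<^sub>R frechet_derivative g (at (f x)) b)"
    proof (intro Ck_on_sum[OF assms(1)] Ck_on_bilinear[OF bounded_bilinear_scaleR assms(1)])
      fix b :: 'v
      show "Ck_on k S (\<lambda>x. frechet_derivative f (at x) v \<bullet> b)"
        by (rule Ck_on_compose_linear[OF bounded_linear_inner_left assms(1)]) (use Suc.prems in auto)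
      show "Ck_on k S (\<lambda>x. frechet_derivative g (at (f x)) b)"
        by (rule Suc.IH) (use Suc.prems Suc.prems(1)[THEN Ck_on_Suc_imp] in auto)
    qed
    then show "Ck_on k S (\<lambda>x. frechet_derivative g (at (f x)) (frechet_derivative f (at x) v))"
      by (subst Ck_on_cong[OF assms(1) eq])
  qed
qed

text \<open>The induction runs because the derivative of \<open>1 / f\<close> is, up to sign, a product of \<open>Df\<close> and two copies of \<open>1 / f\<close>.\<close>

lemma Ck_on_inverse:
  fixes f :: "_ \<Rightarrow> real"
  assumes "open S" "Ck_on k S f" "\<And>x. x \<in> S \<Longrightarrow> f x \<noteq> 0"
  shows "Ck_on k S (\<lambda>x. inverse (f x))"
  using assms(2)
proof (induction k)
  case 0
  then show ?case using assms(3) by (simp add: continuous_on_inverse)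
next
  case (Suc k)
  have IH: "Ck_on k S (\<lambda>x. inverse (f x))" using Suc Ck_on_Suc_imp by blast
  show ?case
  proof (rule Ck_on_SucI[OF assms(1), where f' = "\<lambda>x v. (inverse (f x) * inverse (f x)) * (- frechet_derivative f (at x) v)"])
    show "((\<lambda>x. inverse (f x)) has_derivative (\<lambda>v. (inverse (f x) * inverse (f x)) * (- frechet_derivative f (at x) v))) (at x)"
      if "x \<in> S" for x
      using Deriv.has_derivative_inverse[OF assms(3)[OF that] Ck_on_Suc_has_derivative[OF Suc.prems that]]
      by (simp add: algebra_simps)
    show "Ck_on k S (\<lambda>x. (inverse (f x) * inverse (f x)) * (- frechet_derivative f (at x) v))" for v
      by (intro Ck_on_bilinear[OF bounded_bilinear_mult assms(1)] IH
          Ck_on_compose_linear[OF bounded_linear_minus[OF bounded_linear_ident] assms(1)])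
        (use Suc.prems in auto)
  qed
qed

lemma smooth_on_cong: "open S \<Longrightarrow> (\<And>x. x \<in> S \<Longrightarrow> f x = g x) \<Longrightarrow> smooth_on S f \<longleftrightarrow> smooth_on S g"
  unfolding smooth_on_def using Ck_on_cong[of S f g] by simp

lemma smooth_on_subset: "smooth_on S f \<Longrightarrow> T \<subseteq> S \<Longrightarrow> smooth_on T f"
  by (auto simp: smooth_on_def elim: Ck_on_subset)

lemma smooth_on_const: "open S \<Longrightarrow> smooth_on S (\<lambda>x. c)"
  by (simp add: smooth_on_def Ck_on_const)

lemma smooth_on_bounded_linear: "bounded_linear f \<Longrightarrow> open S \<Longrightarrow> smooth_on S f"
  by (simp add: smooth_on_def Ck_on_bounded_linear)

lemma smooth_on_compose_linear:
  "bounded_linear h \<Longrightarrow> open S \<Longrightarrow> smooth_on S f \<Longrightarrow> smooth_on S (\<lambda>x. h (f x))"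
  by (simp add: smooth_on_def Ck_on_compose_linear)

lemma smooth_on_add: "open S \<Longrightarrow> smooth_on S f \<Longrightarrow> smooth_on S g \<Longrightarrow> smooth_on S (\<lambda>x. f x + g x)"
  by (simp add: smooth_on_def Ck_on_add)

lemma smooth_on_bilinear:
  "bounded_bilinear P \<Longrightarrow> open S \<Longrightarrow> smooth_on S f \<Longrightarrow> smooth_on S g \<Longrightarrow> smooth_on S (\<lambda>x. P (f x) (g x))"
  by (simp add: smooth_on_def Ck_on_bilinear)

lemmas smooth_on_mult = smooth_on_bilinear[OF bounded_bilinear_mult]
lemmas smooth_on_scaleR = smooth_on_bilinear[OF bounded_bilinear_scaleR]

lemma smooth_on_minus: "open S \<Longrightarrow> smooth_on S f \<Longrightarrow> smooth_on S (\<lambda>x. - f x)"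
  by (rule smooth_on_compose_linear[OF bounded_linear_minus[OF bounded_linear_ident]])

lemma smooth_on_diff: "open S \<Longrightarrow> smooth_on S f \<Longrightarrow> smooth_on S g \<Longrightarrow> smooth_on S (\<lambda>x. f x - g x)"
  using smooth_on_add[of S f "\<lambda>x. - g x"] smooth_on_minus by auto

lemma smooth_on_sum:
  "open S \<Longrightarrow> (\<And>i. i \<in> I \<Longrightarrow> smooth_on S (f i)) \<Longrightarrow> smooth_on S (\<lambda>x. \<Sum>i\<in>I. f i x)"
  by (simp add: smooth_on_def Ck_on_sum)

lemma smooth_on_prod:
  fixes f :: "_ \<Rightarrow> _ \<Rightarrow> real"
  assumes "open S" "\<And>i. i \<in> I \<Longrightarrow> smooth_on S (f i)"
  shows "smooth_on S (\<lambda>x. \<Prod>i\<in>I. f i x)"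
  using assms(2) by (induction I rule: infinite_finite_induct) (simp_all add: smooth_on_const smooth_on_mult assms(1))

lemma smooth_on_compose:
  fixes g :: "'v::euclidean_space \<Rightarrow> 'w::real_normed_vector"
  shows "open S \<Longrightarrow> open T \<Longrightarrow> smooth_on S f \<Longrightarrow> smooth_on T g \<Longrightarrow> f ` S \<subseteq> T \<Longrightarrow> smooth_on S (\<lambda>x. g (f x))"
  by (simp add: smooth_on_def Ck_on_compose)

lemma smooth_on_inverse:
  fixes f :: "_ \<Rightarrow> real"
  shows "open S \<Longrightarrow> smooth_on S f \<Longrightarrow> (\<And>x. x \<in> S \<Longrightarrow> f x \<noteq> 0) \<Longrightarrow> smooth_on S (\<lambda>x. inverse (f x))"
  by (simp add: smooth_on_def Ck_on_inverse)

lemma smooth_on_imp_continuous_on: "smooth_on S f \<Longrightarrow> continuous_on S f"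
  unfolding smooth_on_def by (rule Ck_on_imp_continuous_on[of 0]) simp

lemma smooth_on_has_derivative:
  "smooth_on S f \<Longrightarrow> x \<in> S \<Longrightarrow> (f has_derivative frechet_derivative f (at x)) (at x)"
  unfolding smooth_on_def by (rule Ck_on_Suc_has_derivative[of 0 S]) auto

lemma smooth_on_derivative:
  assumes "smooth_on S f"
  shows "smooth_on S (\<lambda>x. frechet_derivative f (at x) v)"
  unfolding smooth_on_def
proof
  fix k
  have "Ck_on (Suc k) S f" using assms by (simp only: smooth_on_def)
  then show "Ck_on k S (\<lambda>x. frechet_derivative f (at x) v)" by simp
qed

lemma linear_frechet_derivative_smooth: "smooth_on S f \<Longrightarrow> x \<in> S \<Longrightarrow> linear (frechet_derivative f (at x))"
  using smooth_on_has_derivative has_derivative_linear by blast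

lemma smooth_on_vec_iff:
  fixes f :: "'v::real_normed_vector \<Rightarrow> real ^ 'n"
  assumes "open S"
  shows "smooth_on S f \<longleftrightarrow> (\<forall>i. smooth_on S (\<lambda>x. f x $ i))"
proof
  assume "smooth_on S f" then show "\<forall>i. smooth_on S (\<lambda>x. f x $ i)"
    using smooth_on_compose_linear[OF bounded_linear_vec_nth assms] by blast
next
  assume *: "\<forall>i. smooth_on S (\<lambda>x. f x $ i)"
  have "smooth_on S (\<lambda>x. \<Sum>i\<in>UNIV. (f x $ i) *\<^sub>R axis i (1::real))"
    by (intro smooth_on_sum smooth_on_scaleR assms smooth_on_const) (use * in blast)
  moreover have "(\<Sum>i\<in>UNIV. (y $ i) *\<^sub>R axis i (1::real)) = y" for y :: "real ^ 'n"
    using basis_expansion[of y] by (simp add: scalar_mult_eq_scaleR)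
  ultimately show "smooth_on S f" by simp
qed

lemma smooth_on_det:
  assumes "open S" "\<And>i j. smooth_on S (\<lambda>x. A x $ i $ j)"
  shows "smooth_on S (\<lambda>x. det (A x :: real ^ 'n ^ 'n))"
  unfolding det_def by (intro smooth_on_sum smooth_on_mult smooth_on_prod smooth_on_const assms)

text \<open>Cramer's rule makes the inverse of a smooth family of matrices smooth.\<close>

lemma smooth_on_matrix_solve:
  assumes "open S" "\<And>i j. smooth_on S (\<lambda>x. A x $ i $ j)" "\<And>x. x \<in> S \<Longrightarrow> det (A x) \<noteq> 0"
    and "\<And>x. x \<in> S \<Longrightarrow> A x *v w x = (b :: real ^ 'n)"
  shows "smooth_on S w"
proof -
  have eq: "w x $ k = det (\<chi> i j. if j = k then b $ i else A x $ i $ j) * inverse (det (A x))"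
    if "x \<in> S" for x k
    using cramer[OF assms(3)[OF that], of "w x" b] assms(4)[OF that] by (simp add: divide_inverse)
  have "smooth_on S (\<lambda>x. det (\<chi> i j. if j = k then b $ i else A x $ i $ j) * inverse (det (A x)))" for k
  proof (intro smooth_on_mult smooth_on_inverse smooth_on_det assms(1-3))
    show "smooth_on S (\<lambda>x. (\<chi> i j. if j = k then b $ i else A x $ i $ j) $ i $ j)" for i j
      using assms(1,2) by (cases "j = k") (auto intro: smooth_on_const)
  qed
  then show ?thesis
    using eq by (auto simp: smooth_on_vec_iff[OF assms(1)] cong: smooth_on_cong[OF assms(1)])
qed

lemma frechet_derivative_compose_smooth:
  assumes "smooth_on S f" "smooth_on T g" "x \<in> S" "f x \<in> T"
  shows "frechet_derivative (\<lambda>x. g (f x)) (at x) v = frechet_derivative g (at (f x)) (frechet_derivative f (at x) v)"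
  by (simp add: frechet_derivative_at[OF has_derivative_compose[OF smooth_on_has_derivative[OF assms(1,3)]
      smooth_on_has_derivative[OF assms(2,4)]], symmetric])

lemma matrix_frechet_derivative_mult:
  fixes f :: "real ^ 'n \<Rightarrow> real ^ 'm"
  assumes "smooth_on S f" "x \<in> S"
  shows "matrix (frechet_derivative f (at x)) *v v = frechet_derivative f (at x) v"
  using matrix_vector_mul(2)[OF linear_frechet_derivative_smooth[OF assms]] by (rule fun_cong)

text \<open>The inverse function \<open>g\<close> inherits smoothness from \<open>Dg(y) = (DG(g y))\<^sup>-\<^sup>1\<close> by bootstrapping:
  if \<open>g\<close> is of class \<open>C\<^sup>k\<close>, then so is this expression, hence \<open>g\<close> is of class \<open>C\<^sup>k\<^sup>+\<^sup>1\<close>.\<close>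

lemma smooth_on_inverse_function:
  fixes G :: "real ^ 'n \<Rightarrow> real ^ 'n"
  assumes "open U" "smooth_on U G" "open V" "homeomorphism U V G g"
    and der: "\<And>y. y \<in> V \<Longrightarrow> (g has_derivative g' y) (at y)"
    and inv: "\<And>y v. y \<in> V \<Longrightarrow> frechet_derivative G (at (g y)) (g' y v) = v"
    and det: "\<And>x. x \<in> U \<Longrightarrow> det (matrix (frechet_derivative G (at x))) \<noteq> 0"
  shows "smooth_on V g"
proof -
  have gU: "g y \<in> U" if "y \<in> V" for y using assms(4) that by (auto simp: homeomorphism_def)
  have inj: "u = w" if "x \<in> U" "frechet_derivative G (at x) u = frechet_derivative G (at x) w" for x u w
  proof -
    have "matrix (frechet_derivative G (at x)) *v u = matrix (frechet_derivative G (at x)) *v w"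
      using that by (simp add: matrix_frechet_derivative_mult[OF assms(2)])
    moreover have "inj ((*v) (matrix (frechet_derivative G (at x))))"
      using det[OF that(1)] by (simp add: inj_matrix_vector_mult invertible_det_nz)
    ultimately show ?thesis by (simp add: inj_eq)
  qed
  define N where "N x v = g' (G x) v" for x v
  have N: "frechet_derivative G (at x) (N x v) = v" if "x \<in> U" for x v
  proof -
    have "G x \<in> V" "g (G x) = x" using assms(4) that by (auto simp: homeomorphism_def)
    then show ?thesis using inv[of "G x" v] by (simp add: N_def)
  qed
  have N_smooth: "smooth_on U (\<lambda>x. N x v)" for v
  proof (rule smooth_on_matrix_solve[OF assms(1)])
    show "smooth_on U (\<lambda>x. matrix (frechet_derivative G (at x)) $ i $ j)" for i j
      using smooth_on_derivative[OF assms(2)] by (auto simp: matrix_def smooth_on_vec_iff[OF assms(1)])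
    show "matrix (frechet_derivative G (at x)) *v N x v = v" if "x \<in> U" for x
      using that N by (simp add: matrix_frechet_derivative_mult[OF assms(2)])
  qed (rule det)
  have gN: "g' y v = N (g y) v" if "y \<in> V" for y v
    using assms(4) that by (simp add: N_def homeomorphism_def)
  have "Ck_on k V g" for k
  proof (induction k)
    case 0
    then show ?case using assms(4) by (simp add: homeomorphism_def)
  next
    case (Suc k)
    show ?case
    proof (rule Ck_on_SucI[OF assms(3) der])
      fix v
      have "Ck_on k V (\<lambda>y. N (g y) v)"
        by (rule Ck_on_compose[OF assms(3) assms(1) Suc]) (use N_smooth gU in \<open>auto simp: smooth_on_def\<close>)
      then show "Ck_on k V (\<lambda>y. g' y v)" using Ck_on_cong[OF assms(3) gN] by simp
    qed
  qed
  then show ?thesis by (simp add: smooth_on_def)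
qed

text \<open>The inverse function theorem for \<open>C\<^sup>1\<close> maps, applied on the open set where the Jacobian
  determinant is positive, gives an inverse that is differentiable; the bootstrap makes it smooth.\<close>

theorem smooth_inverse_function_theorem:
  fixes G :: "real ^ 'n \<Rightarrow> real ^ 'n"
  assumes "open U" "smooth_on U G" "p \<in> U" "det (matrix (frechet_derivative G (at p))) > 0"
  obtains V g where "open V" "V \<subseteq> U" "p \<in> V" "open (G ` V)" "\<And>x. x \<in> V \<Longrightarrow> g (G x) = x"
    "smooth_on (G ` V) g" "\<And>x. x \<in> V \<Longrightarrow> det (matrix (frechet_derivative G (at x))) > 0"
proof -
  let ?d = "\<lambda>x. det (matrix (frechet_derivative G (at x)))"
  have d: "smooth_on U ?d"
    by (rule smooth_on_det[OF assms(1)])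
      (use smooth_on_derivative[OF assms(2)] in \<open>auto simp: matrix_def smooth_on_vec_iff[OF assms(1)]\<close>)
  define U1 where "U1 = {x \<in> U. ?d x > 0}"
  have U1: "open U1" "U1 \<subseteq> U" "p \<in> U1"
  proof -
    have "U1 = U \<inter> ?d -` {0<..}" by (auto simp: U1_def)
    then show "open U1"
      using continuous_open_preimage[OF smooth_on_imp_continuous_on[OF d] assms(1) open_greaterThan] by simp
  qed (use assms in \<open>auto simp: U1_def\<close>)
  define G' where "G' x = Blinfun (frechet_derivative G (at x))" for x
  have bl: "bounded_linear (frechet_derivative G (at x))" if "x \<in> U" for x
    using linear_frechet_derivative_smooth[OF assms(2) that] linear_conv_bounded_linear by blast
  have G': "blinfun_apply (G' x) = frechet_derivative G (at x)" if "x \<in> U" for x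
    using bl[OF that] by (simp add: G'_def bounded_linear_Blinfun_apply)
  have cont: "continuous_on U1 G'"
  proof (rule continuous_on_blinfun_componentwise)
    fix i :: "real ^ 'n"
    have "continuous_on U1 (\<lambda>x. frechet_derivative G (at x) i)"
      by (rule smooth_on_imp_continuous_on[OF smooth_on_derivative[OF smooth_on_subset[OF assms(2) U1(2)]]])
    then show "continuous_on U1 (\<lambda>x. blinfun_apply (G' x) i)"
      using G' U1 by (subst continuous_on_cong[where g = "\<lambda>x. frechet_derivative G (at x) i"]) auto
  qed
  let ?M = "matrix (frechet_derivative G (at p))"
  obtain N where N: "N ** ?M = mat 1"
    using assms(4) by (metis invertible_def invertible_det_nz less_irrefl)
  have inv: "Blinfun ((*v) N) o\<^sub>L G' p = id_blinfun"
  proof (rule blinfun_eqI)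
    fix v
    have "N *v (?M *v v) = v" by (simp add: matrix_vector_mul_assoc N)
    then show "blinfun_apply (Blinfun ((*v) N) o\<^sub>L G' p) v = blinfun_apply id_blinfun v"
      using matrix_frechet_derivative_mult[OF assms(2,3)]
      by (simp add: bounded_linear_Blinfun_apply matrix_vector_mul_bounded_linear G'[OF assms(3)])
  qed
  show ?thesis
  proof (rule inverse_function_theorem[OF U1(1) _ cont U1(3) inv])
    show "(G has_derivative blinfun_apply (G' x)) (at x)" if "x \<in> U1" for x
      using smooth_on_has_derivative[OF assms(2)] G' that U1 by auto
    fix V W g g'
    assume *: "open V" "V \<subseteq> U1" "p \<in> V" "open W" "G p \<in> W" "homeomorphism V W G g"
      "\<And>y. y \<in> W \<Longrightarrow> (g has_derivative g' y) (at y)"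
      "\<And>y. y \<in> W \<Longrightarrow> g' y = inv (blinfun_apply (G' (g y)))"
      "\<And>y. y \<in> W \<Longrightarrow> bij (blinfun_apply (G' (g y)))"
    have im: "G ` V = W" and gG: "\<And>x. x \<in> V \<Longrightarrow> g (G x) = x" and gV: "\<And>y. y \<in> W \<Longrightarrow> g y \<in> V"
      using *(6) by (auto simp: homeomorphism_def)
    have "smooth_on W g"
    proof (rule smooth_on_inverse_function[OF *(1) _ *(4,6,7)])
      show "smooth_on V G" by (rule smooth_on_subset[OF assms(2) order_trans[OF *(2) U1(2)]])
      show "frechet_derivative G (at (g y)) (g' y v) = v" if "y \<in> W" for y v
      proof -
        have "g y \<in> U" using gV[OF that] *(2) U1 by auto
        then have "frechet_derivative G (at (g y)) = blinfun_apply (G' (g y))" using G' by simp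
        then show ?thesis using *(8,9)[OF that] by (simp add: bij_is_surj surj_f_inv_f)
      qed
      show "det (matrix (frechet_derivative G (at x))) \<noteq> 0" if "x \<in> V" for x
        using that *(2) by (auto simp: U1_def)
    qed
    with *(1-4) im gG show thesis
      by (intro that[of V g]) (auto simp: U1_def)
  qed
qed

text \<open>Both mixed second derivatives are limits of the same second difference quotient, which
  the mean value theorem turns into their values at nearby points.\<close>

lemma second_difference_mean_value:
  fixes f :: "'v::real_normed_vector \<Rightarrow> real"
  assumes "smooth_on S f" "t > 0" "\<And>a b. \<lbrakk>0 \<le> a; a \<le> t; 0 \<le> b; b \<le> t\<rbrakk> \<Longrightarrow> x + a *\<^sub>R u + b *\<^sub>R v \<in> S"
  obtains a b where "0 \<le> a" "a \<le> t" "0 \<le> b" "b \<le> t"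
    "f (x + t *\<^sub>R u + t *\<^sub>R v) - f (x + t *\<^sub>R u) - f (x + t *\<^sub>R v) + f x
      = t * t * frechet_derivative (\<lambda>y. frechet_derivative f (at y) u) (at (x + a *\<^sub>R u + b *\<^sub>R v)) v"
proof -
  let ?Du = "\<lambda>y. frechet_derivative f (at y) u"
  let ?\<phi> = "\<lambda>s. f (x + s *\<^sub>R u + t *\<^sub>R v) - f (x + s *\<^sub>R u)"
  have d\<phi>: "(?\<phi> has_derivative (\<lambda>h. h * (?Du (x + s *\<^sub>R u + t *\<^sub>R v) - ?Du (x + s *\<^sub>R u)))) (at s)"
    if "0 \<le> s" "s \<le> t" for s
  proof -
    have in1: "x + s *\<^sub>R u + t *\<^sub>R v \<in> S" and in2: "x + s *\<^sub>R u \<in> S"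
      using assms(3)[of s t] assms(3)[of s 0] that assms(2) by auto
    have l1: "((\<lambda>s. x + s *\<^sub>R u + t *\<^sub>R v) has_derivative (\<lambda>h. h *\<^sub>R u)) (at s)"
      and l2: "((\<lambda>s. x + s *\<^sub>R u) has_derivative (\<lambda>h. h *\<^sub>R u)) (at s)"
      by (auto intro!: derivative_eq_intros)
    have "(?\<phi> has_derivative (\<lambda>h. frechet_derivative f (at (x + s *\<^sub>R u + t *\<^sub>R v)) (h *\<^sub>R u)
        - frechet_derivative f (at (x + s *\<^sub>R u)) (h *\<^sub>R u))) (at s)"
      by (intro has_derivative_diff has_derivative_compose[OF l1] has_derivative_compose[OF l2]
          smooth_on_has_derivative[OF assms(1)] in1 in2)
    moreover have "frechet_derivative f (at y) (h *\<^sub>R u) = h * ?Du y" if "y \<in> S" for y h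
      using linear_scale[OF linear_frechet_derivative_smooth[OF assms(1) that]] by simp
    ultimately show ?thesis using in1 in2 by (simp add: algebra_simps)
  qed
  have "\<exists>a\<in>{0<..<t}. ?\<phi> t - ?\<phi> 0 = (t - 0) * (?Du (x + a *\<^sub>R u + t *\<^sub>R v) - ?Du (x + a *\<^sub>R u))"
    by (rule mvt_simple[OF assms(2) has_derivative_at_withinI[OF d\<phi>]])
  then obtain a where a: "0 < a" "a < t"
    "?\<phi> t - ?\<phi> 0 = (t - 0) * (?Du (x + a *\<^sub>R u + t *\<^sub>R v) - ?Du (x + a *\<^sub>R u))"
    by (meson greaterThanLessThan_iff)
  let ?\<psi> = "\<lambda>r. ?Du (x + a *\<^sub>R u + r *\<^sub>R v)"
  note sm = smooth_on_derivative[OF assms(1), of u]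
  have d\<psi>: "(?\<psi> has_derivative (\<lambda>h. h * frechet_derivative ?Du (at (x + a *\<^sub>R u + r *\<^sub>R v)) v)) (at r)"
    if "0 \<le> r" "r \<le> t" for r
  proof -
    have in1: "x + a *\<^sub>R u + r *\<^sub>R v \<in> S" using assms(3) a that by auto
    have l1: "((\<lambda>r. x + a *\<^sub>R u + r *\<^sub>R v) has_derivative (\<lambda>h. h *\<^sub>R v)) (at r)"
      by (auto intro!: derivative_eq_intros)
    have "(?\<psi> has_derivative (\<lambda>h. frechet_derivative ?Du (at (x + a *\<^sub>R u + r *\<^sub>R v)) (h *\<^sub>R v))) (at r)"
      by (rule has_derivative_compose[OF l1 smooth_on_has_derivative[OF sm in1]])
    then show ?thesis
      using linear_scale[OF linear_frechet_derivative_smooth[OF sm in1]] by simp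
  qed
  have "\<exists>b\<in>{0<..<t}. ?\<psi> t - ?\<psi> 0 = (t - 0) * frechet_derivative ?Du (at (x + a *\<^sub>R u + b *\<^sub>R v)) v"
    by (rule mvt_simple[OF assms(2) has_derivative_at_withinI[OF d\<psi>]])
  then obtain b where b: "0 < b" "b < t"
    "?\<psi> t - ?\<psi> 0 = (t - 0) * frechet_derivative ?Du (at (x + a *\<^sub>R u + b *\<^sub>R v)) v"
    by (meson greaterThanLessThan_iff)
  have "f (x + t *\<^sub>R u + t *\<^sub>R v) - f (x + t *\<^sub>R u) - f (x + t *\<^sub>R v) + f x = t * (?\<psi> t - ?\<psi> 0)"
    using a(3) by simp
  also have "\<dots> = t * t * frechet_derivative ?Du (at (x + a *\<^sub>R u + b *\<^sub>R v)) v"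
    using b(3) by simp
  finally show thesis
    using a(1,2) b(1,2) by (intro that[of a b]) simp_all
qed

lemma mixed_derivatives_commute_real:
  fixes f :: "'v::real_normed_vector \<Rightarrow> real"
  assumes "open S" "smooth_on S f" "x \<in> S"
  shows "frechet_derivative (\<lambda>y. frechet_derivative f (at y) u) (at x) v
       = frechet_derivative (\<lambda>y. frechet_derivative f (at y) v) (at x) u" (is "?A x = ?B x")
proof (rule ccontr)
  assume ne: "?A x \<noteq> ?B x"
  define e where "e = \<bar>?A x - ?B x\<bar> / 2"
  have "e > 0" using ne by (simp add: e_def)
  have "continuous_on S ?A" "continuous_on S ?B"
    by (rule smooth_on_imp_continuous_on[OF smooth_on_derivative[OF smooth_on_derivative[OF assms(2)]]])+
  then have "isCont ?A x" "isCont ?B x"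
    using assms by (simp_all add: continuous_on_eq_continuous_at)
  then have "\<exists>d>0. \<forall>y. dist y x < d \<longrightarrow> dist (?A y) (?A x) < e" "\<exists>d>0. \<forall>y. dist y x < d \<longrightarrow> dist (?B y) (?B x) < e"
    using \<open>e > 0\<close> unfolding continuous_at_eps_delta by simp_all
  then obtain d1 d2 where d: "d1 > 0" "d2 > 0" "\<forall>y. dist y x < d1 \<longrightarrow> dist (?A y) (?A x) < e"
    "\<forall>y. dist y x < d2 \<longrightarrow> dist (?B y) (?B x) < e"
    by (elim exE conjE)
  obtain d3 where d3: "d3 > 0" "ball x d3 \<subseteq> S" using assms open_contains_ball by blast
  define d where "d = min (min d1 d2) d3"
  have "d > 0" using d d3 by (simp add: d_def)
  define t where "t = d / (2 * (norm u + norm v + 1))"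
  have pos: "norm u + norm v + 1 > 0" by (intro add_nonneg_pos add_nonneg_nonneg) simp_all
  have t: "t > 0" using \<open>d > 0\<close> pos by (simp add: t_def)
  have near: "dist (x + a *\<^sub>R p + b *\<^sub>R q) x < d" if "0 \<le> a" "a \<le> t" "0 \<le> b" "b \<le> t"
    "norm p + norm q = norm u + norm v" for a b p q
  proof -
    have "norm (a *\<^sub>R p + b *\<^sub>R q) \<le> a * norm p + b * norm q"
      by (rule order_trans[OF norm_triangle_ineq]) (use that in auto)
    also have "\<dots> \<le> t * norm p + t * norm q" using that by (intro add_mono mult_right_mono) auto
    also have "\<dots> = t * (norm u + norm v)" using that(5) by (simp flip: distrib_left)
    also have "\<dots> < t * (2 * (norm u + norm v + 1))"
    proof (rule mult_strict_left_mono[OF _ t])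
      show "norm u + norm v < 2 * (norm u + norm v + 1)"
        using norm_ge_zero[of u] norm_ge_zero[of v] unfolding distrib_left by linarith
    qed
    also have "\<dots> = d" using pos by (simp add: t_def)
    finally show ?thesis by (simp add: dist_norm add.assoc)
  qed
  have inS: "x + a *\<^sub>R p + b *\<^sub>R q \<in> S" if "0 \<le> a" "a \<le> t" "0 \<le> b" "b \<le> t"
    "norm p + norm q = norm u + norm v" for a b p q
  proof -
    have "x + a *\<^sub>R p + b *\<^sub>R q \<in> ball x d3"
      using near[OF that] by (simp add: d_def dist_commute)
    with d3(2) show ?thesis by blast
  qed
  obtain a b where A: "0 \<le> a" "a \<le> t" "0 \<le> b" "b \<le> t"
    "f (x + t *\<^sub>R u + t *\<^sub>R v) - f (x + t *\<^sub>R u) - f (x + t *\<^sub>R v) + f x = t * t * ?A (x + a *\<^sub>R u + b *\<^sub>R v)"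
    by (rule second_difference_mean_value[OF assms(2) t inS[OF _ _ _ _ refl]])
  obtain a' b' where B: "0 \<le> a'" "a' \<le> t" "0 \<le> b'" "b' \<le> t"
    "f (x + t *\<^sub>R v + t *\<^sub>R u) - f (x + t *\<^sub>R v) - f (x + t *\<^sub>R u) + f x = t * t * ?B (x + a' *\<^sub>R v + b' *\<^sub>R u)"
    by (rule second_difference_mean_value[OF assms(2) t inS[OF _ _ _ _ add.commute]])
  have "t * t * ?A (x + a *\<^sub>R u + b *\<^sub>R v) = t * t * ?B (x + a' *\<^sub>R v + b' *\<^sub>R u)"
    unfolding A(5)[symmetric] B(5)[symmetric] by (simp add: algebra_simps)
  then have "?A (x + a *\<^sub>R u + b *\<^sub>R v) = ?B (x + a' *\<^sub>R v + b' *\<^sub>R u)" using t by simp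
  moreover have "dist (?A (x + a *\<^sub>R u + b *\<^sub>R v)) (?A x) < e"
    using near[OF A(1-4) refl] by (intro d(3)[rule_format]) (simp add: d_def)
  moreover have "dist (?B (x + a' *\<^sub>R v + b' *\<^sub>R u)) (?B x) < e"
    using near[OF B(1-4) add.commute] by (intro d(4)[rule_format]) (simp add: d_def)
  ultimately have "\<bar>?A x - ?B x\<bar> < e + e" unfolding dist_real_def by linarith
  then show False by (simp add: e_def)
qed

lemma frechet_derivative_vec_nth:
  fixes f :: "'v::real_normed_vector \<Rightarrow> real ^ 'n"
  assumes "smooth_on S f" "x \<in> S"
  shows "frechet_derivative (\<lambda>y. f y $ i) (at x) v = frechet_derivative f (at x) v $ i"
  by (simp add: frechet_derivative_at[OF bounded_linear.has_derivative[OF bounded_linear_vec_nth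
        smooth_on_has_derivative[OF assms]], symmetric])

lemma mixed_derivatives_commute:
  fixes f :: "'v::real_normed_vector \<Rightarrow> real ^ 'n"
  assumes "open S" "smooth_on S f" "x \<in> S"
  shows "frechet_derivative (\<lambda>y. frechet_derivative f (at y) u) (at x) v
       = frechet_derivative (\<lambda>y. frechet_derivative f (at y) v) (at x) u"
proof -
  have "frechet_derivative (\<lambda>y. frechet_derivative f (at y) u) (at x) v $ i
      = frechet_derivative (\<lambda>y. frechet_derivative (\<lambda>y. f y $ i) (at y) u) (at x) v" for u v i
  proof -
    have "frechet_derivative (\<lambda>y. frechet_derivative f (at y) u $ i) (at x)
        = frechet_derivative (\<lambda>y. frechet_derivative (\<lambda>y. f y $ i) (at y) u) (at x)"
      by (rule frechet_derivative_cong_open[OF assms(1,3)])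
        (simp add: frechet_derivative_vec_nth[OF assms(2)])
    then show ?thesis by (simp add: frechet_derivative_vec_nth[OF smooth_on_derivative[OF assms(2)] assms(3), symmetric])
  qed
  moreover have "smooth_on S (\<lambda>y. f y $ i)" for i using assms(1,2) smooth_on_vec_iff by blast
  ultimately show ?thesis
    using mixed_derivatives_commute_real[OF assms(1) _ assms(3)] by (simp add: vec_eq_iff)
qed

section \<open>Powers of an alternating form as Pfaffians\<close>

text \<open>The terms whose sum over all permutations is, up to the factor \<open>2\<^sup>m\<close>, the power \<open>\<eta>\<^sup>m\<close>.\<close>

definition pf_term :: "('v \<Rightarrow> 'v \<Rightarrow> real) \<Rightarrow> nat \<Rightarrow> (nat \<Rightarrow> 'v) \<Rightarrow> (nat \<Rightarrow> nat) \<Rightarrow> real" where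
  "pf_term \<eta> m v \<sigma> = of_int (sign \<sigma>) * (\<Prod>i<m. \<eta> (v (\<sigma> (2 * i))) (v (\<sigma> (2 * i + 1))))"

lemma permutes_permutation: "\<sigma> permutes {..<k::nat} \<Longrightarrow> permutation \<sigma>"
  using permutation_permutes finite_lessThan by blast

lemma permutes_lessThan_iff: "\<sigma> permutes {..<k::nat} \<Longrightarrow> \<sigma> i < k \<longleftrightarrow> i < k"
  using permutes_in_image[of \<sigma> "{..<k}" i] by simp

text \<open>Unfolding the recursion, each factor is averaged over the permutations of the earlier slots;
  these are absorbed into the outer permutation, which cancels the factorials.\<close>

lemma wedge_power_eq_pf_sum:
  "wedge_power \<eta> m v = (\<Sum>\<sigma> | \<sigma> permutes {..<2 * m}. pf_term \<eta> m v \<sigma>) / 2 ^ m"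
proof (induction m arbitrary: v)
  case 0
  then show ?case by (simp add: pf_term_def)
next
  case (Suc m)
  let ?S = "{\<sigma>. \<sigma> permutes {..<2 * m + 2}}" and ?T = "{\<tau>. \<tau> permutes {..<2 * m}}"
  have perm: "of_int (sign \<sigma>) * pf_term \<eta> m (\<lambda>i. v (\<sigma> i)) \<tau> * \<eta> (v (\<sigma> (2 * m))) (v (\<sigma> (2 * m + 1)))
      = pf_term \<eta> (Suc m) v (\<sigma> \<circ> \<tau>)" if \<sigma>: "\<sigma> \<in> ?S" and \<tau>: "\<tau> \<in> ?T" for \<sigma> \<tau>
  proof -
    have "\<tau> (2 * m) = 2 * m" "\<tau> (2 * m + 1) = 2 * m + 1"
      using \<tau> by (auto intro: permutes_not_in)
    moreover have "sign (\<sigma> \<circ> \<tau>) = sign \<sigma> * sign \<tau>"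
      using \<sigma> \<tau> by (auto intro!: sign_compose permutes_permutation)
    ultimately show ?thesis by (simp add: pf_term_def)
  qed
  have reindex: "(\<Sum>\<sigma>\<in>?S. pf_term \<eta> (Suc m) v (\<sigma> \<circ> \<tau>)) = (\<Sum>\<sigma>\<in>?S. pf_term \<eta> (Suc m) v \<sigma>)"
    if "\<tau> \<in> ?T" for \<tau>
  proof -
    have "\<tau> permutes {..<2 * m + 2}" by (rule permutes_subset[of _ "{..<2*m}"]) (use that in auto)
    from sum_permutations_compose_right[OF this, of "pf_term \<eta> (Suc m) v"] show ?thesis by simp
  qed
  have "wedge_power \<eta> (Suc m) v
      = (\<Sum>\<sigma>\<in>?S. of_int (sign \<sigma>) * ((\<Sum>\<tau>\<in>?T. pf_term \<eta> m (\<lambda>i. v (\<sigma> i)) \<tau>) / 2 ^ m)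
          * \<eta> (v (\<sigma> (2 * m))) (v (\<sigma> (2 * m + 1)))) / (fact (2 * m) * 2)"
    by (simp add: wedge_def Suc.IH)
  also have "\<dots> = (\<Sum>\<sigma>\<in>?S. \<Sum>\<tau>\<in>?T. of_int (sign \<sigma>) * pf_term \<eta> m (\<lambda>i. v (\<sigma> i)) \<tau>
          * \<eta> (v (\<sigma> (2 * m))) (v (\<sigma> (2 * m + 1)))) / (fact (2 * m) * 2 ^ Suc m)"
    by (simp add: sum_distrib_left sum_distrib_right sum_divide_distrib mult_ac)
  also have "(\<Sum>\<sigma>\<in>?S. \<Sum>\<tau>\<in>?T. of_int (sign \<sigma>) * pf_term \<eta> m (\<lambda>i. v (\<sigma> i)) \<tau>
          * \<eta> (v (\<sigma> (2 * m))) (v (\<sigma> (2 * m + 1)))) = (\<Sum>\<sigma>\<in>?S. \<Sum>\<tau>\<in>?T. pf_term \<eta> (Suc m) v (\<sigma> \<circ> \<tau>))"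
    by (intro sum.cong refl perm)
  also have "\<dots> = (\<Sum>\<tau>\<in>?T. \<Sum>\<sigma>\<in>?S. pf_term \<eta> (Suc m) v (\<sigma> \<circ> \<tau>))" by (rule sum.swap)
  also have "\<dots> = (\<Sum>\<tau>\<in>?T. \<Sum>\<sigma>\<in>?S. pf_term \<eta> (Suc m) v \<sigma>)" by (intro sum.cong refl reindex)
  also have "\<dots> = fact (2 * m) * (\<Sum>\<sigma>\<in>?S. pf_term \<eta> (Suc m) v \<sigma>)"
    using card_permutations[of "{..<2*m}" "2 * m"] by simp
  finally show ?case by simp
qed

lemma wedge_power_cong:
  assumes "\<And>i j. i < 2 * m \<Longrightarrow> j < 2 * m \<Longrightarrow> \<eta> (v i) (v j) = \<eta>' (v' i) (v' j)"
  shows "wedge_power \<eta> m v = wedge_power \<eta>' m v'"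
proof -
  have "pf_term \<eta> m v \<sigma> = pf_term \<eta>' m v' \<sigma>" if "\<sigma> permutes {..<2 * m}" for \<sigma>
    unfolding pf_term_def
    by (intro arg_cong2[where f = "(*)"] refl prod.cong assms) (auto simp: permutes_lessThan_iff[OF that])
  then show ?thesis by (simp add: wedge_power_eq_pf_sum)
qed

lemma wedge_power_Suc_eq_0:
  assumes "\<And>v. (\<And>i. v i \<in> T) \<Longrightarrow> wedge_power \<eta> m v = 0" "\<And>i. v i \<in> T"
  shows "wedge_power \<eta> (Suc m) v = 0"
  using assms by (simp add: wedge_def)

lemma wedge_power_permute:
  assumes "\<rho> permutes {..<2 * m}"
  shows "wedge_power \<eta> m (\<lambda>i. v (\<rho> i)) = of_int (sign \<rho>) * wedge_power \<eta> m v"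
proof -
  have "pf_term \<eta> m (\<lambda>i. v (\<rho> i)) \<sigma> = of_int (sign \<rho>) * pf_term \<eta> m v (\<rho> \<circ> \<sigma>)"
    if "\<sigma> permutes {..<2 * m}" for \<sigma>
  proof -
    have "sign (\<rho> \<circ> \<sigma>) = sign \<rho> * sign \<sigma>"
      by (intro sign_compose permutes_permutation[OF assms] permutes_permutation[OF that])
    then show ?thesis by (simp add: pf_term_def flip: mult.assoc of_int_mult)
  qed
  then have "(\<Sum>\<sigma> | \<sigma> permutes {..<2 * m}. pf_term \<eta> m (\<lambda>i. v (\<rho> i)) \<sigma>)
      = of_int (sign \<rho>) * (\<Sum>\<sigma> | \<sigma> permutes {..<2 * m}. pf_term \<eta> m v (\<rho> \<circ> \<sigma>))"
    by (simp add: sum_distrib_left)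
  then show ?thesis
    using setum_permutations_compose_left[OF assms, of "pf_term \<eta> m v"]
    by (simp add: wedge_power_eq_pf_sum)
qed

text \<open>The permutations that preserve the pairing \<open>{2i, 2i+1}\<close> of the slots, up to the order of
  the pairs, act trivially on the Pfaffian terms.\<close>

lemma pf_term_swap_in_pair:
  assumes "\<sigma> permutes {..<2 * m}" "k < m" "\<And>u w. \<eta> u w = - \<eta> w u"
  shows "pf_term \<eta> m v (\<sigma> \<circ> Transposition.transpose (2 * k) (2 * k + 1)) = pf_term \<eta> m v \<sigma>"
proof -
  let ?t = "Transposition.transpose (2 * k) (2 * k + 1)"
  have "sign (\<sigma> \<circ> ?t) = - sign \<sigma>"
    by (simp add: sign_compose permutes_permutation[OF assms(1)] permutation_swap_id sign_swap_id)
  moreover have "(\<Prod>i<m. \<eta> (v (\<sigma> (?t (2 * i)))) (v (\<sigma> (?t (2 * i + 1)))))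
      = (\<Prod>i<m. (if i = k then - 1 else 1) * \<eta> (v (\<sigma> (2 * i))) (v (\<sigma> (2 * i + 1))))"
  proof (intro prod.cong refl)
    fix i
    have "?t (2 * i) = 2 * i" "?t (2 * i + 1) = 2 * i + 1" if "i \<noteq> k"
      using that by (simp_all add: Transposition.transpose_def)
    then show "\<eta> (v (\<sigma> (?t (2 * i)))) (v (\<sigma> (?t (2 * i + 1))))
        = (if i = k then - 1 else 1) * \<eta> (v (\<sigma> (2 * i))) (v (\<sigma> (2 * i + 1)))"
      using assms(3)[of "v (\<sigma> (2 * k + 1))" "v (\<sigma> (2 * k))"] by (cases "i = k") auto
  qed
  moreover have "(\<Prod>i<m. if i = k then - 1 else 1 :: real) = - 1"
    using assms(2) by (simp add: prod.delta)
  ultimately show ?thesis by (simp add: pf_term_def prod.distrib)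
qed

lemma pf_term_swap_pairs:
  assumes "\<sigma> permutes {..<2 * m}" "k < m" "l < m" "k \<noteq> l"
  shows "pf_term \<eta> m v (\<sigma> \<circ> (Transposition.transpose (2 * k) (2 * l) \<circ> Transposition.transpose (2 * k + 1) (2 * l + 1))) = pf_term \<eta> m v \<sigma>"
proof -
  let ?t = "Transposition.transpose (2 * k) (2 * l) \<circ> Transposition.transpose (2 * k + 1) (2 * l + 1)"
  have "sign (\<sigma> \<circ> ?t) = sign \<sigma>"
    using assms(4)
    by (simp add: sign_compose permutes_permutation[OF assms(1)] permutation_swap_id permutation_compose sign_swap_id)
  moreover have "(\<Prod>i<m. \<eta> (v (\<sigma> (?t (2 * i)))) (v (\<sigma> (?t (2 * i + 1)))))
      = (\<Prod>i<m. \<eta> (v (\<sigma> (2 * i))) (v (\<sigma> (2 * i + 1))))"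
  proof (rule prod.reindex_bij_witness[where i = "Transposition.transpose k l" and j = "Transposition.transpose k l"])
    fix i
    have "?t (2 * i) = 2 * Transposition.transpose k l i" "?t (2 * i + 1) = 2 * Transposition.transpose k l i + 1"
      using assms(4) by (simp_all add: Transposition.transpose_def)
    then show "\<eta> (v (\<sigma> (2 * Transposition.transpose k l i))) (v (\<sigma> (2 * Transposition.transpose k l i + 1)))
        = \<eta> (v (\<sigma> (?t (2 * i)))) (v (\<sigma> (?t (2 * i + 1))))" by simp
  qed (use assms(2,3) in \<open>auto simp: Transposition.transpose_def\<close>)
  ultimately show ?thesis by (simp add: pf_term_def)
qed

text \<open>Expansion along the last slot: the \<open>2m + 2\<close> positions that a permutation can give to the
  entry \<open>2m\<close> contribute equally, because they are related by symmetries of the pairing.\<close>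

lemma wedge_power_orthogonal_pair:
  assumes skew: "\<And>u w. \<eta> u w = - \<eta> w u"
    and orth: "\<And>i. i < 2 * m \<Longrightarrow> \<eta> (v i) (v (2 * m)) = 0"
  shows "wedge_power \<eta> (Suc m) v = real (Suc m) * wedge_power \<eta> m v * \<eta> (v (2 * m)) (v (2 * m + 1))"
proof -
  let ?S = "{\<sigma>. \<sigma> permutes {..<2 * Suc m}}"
  let ?g = "pf_term \<eta> (Suc m) v"
  let ?h = "\<lambda>j \<sigma>. if \<sigma> j = 2 * m then ?g \<sigma> else 0"
  define good where "good \<rho> \<longleftrightarrow> \<rho> permutes {..<2 * Suc m} \<and> (\<forall>\<sigma>\<in>?S. ?g (\<sigma> \<circ> \<rho>) = ?g \<sigma>)" for \<rho>
  have good_comp: "good (\<rho> \<circ> \<rho>')" if "good \<rho>" "good \<rho>'" for \<rho> \<rho>'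
  proof -
    have "?g (\<sigma> \<circ> (\<rho> \<circ> \<rho>')) = ?g \<sigma>" if "\<sigma> \<in> ?S" for \<sigma>
    proof -
      have "\<sigma> \<circ> \<rho> \<in> ?S" using \<open>good \<rho>\<close> \<open>\<sigma> \<in> ?S\<close> by (simp add: good_def permutes_compose)
      then have "?g ((\<sigma> \<circ> \<rho>) \<circ> \<rho>') = ?g (\<sigma> \<circ> \<rho>)" using \<open>good \<rho>'\<close> unfolding good_def by blast
      then show ?thesis using \<open>good \<rho>\<close> \<open>\<sigma> \<in> ?S\<close> by (simp add: good_def comp_assoc)
    qed
    then show ?thesis using that by (simp add: good_def permutes_compose)
  qed
  have good_move: "\<exists>\<rho>. good \<rho> \<and> \<rho> (2 * m) = j" if "j < 2 * Suc m" for j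
  proof -
    define k where "k = j div 2"
    have k: "k < Suc m" using that by (auto simp: k_def)
    have "\<exists>\<rho>. good \<rho> \<and> \<rho> (2 * m) = 2 * k \<and> \<rho> (2 * m + 1) = 2 * k + 1"
    proof (cases "k = m")
      case True
      then show ?thesis by (intro exI[of _ id]) (simp add: good_def permutes_id)
    next
      case False
      let ?t = "Transposition.transpose (2 * k) (2 * m) \<circ> Transposition.transpose (2 * k + 1) (2 * m + 1)"
      have "?t permutes {..<2 * Suc m}" using k by (intro permutes_compose permutes_swap_id) auto
      moreover have "?g (\<sigma> \<circ> ?t) = ?g \<sigma>" if "\<sigma> \<in> ?S" for \<sigma>
        using that k False by (intro pf_term_swap_pairs) auto
      ultimately have "good ?t" unfolding good_def by blast
      moreover have "?t (2 * m) = 2 * k" "?t (2 * m + 1) = 2 * k + 1"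
        using False by (simp_all add: Transposition.transpose_def)
      ultimately show ?thesis by blast
    qed
    then obtain \<rho> where \<rho>: "good \<rho>" "\<rho> (2 * m) = 2 * k" "\<rho> (2 * m + 1) = 2 * k + 1" by blast
    show ?thesis
    proof (cases "even j")
      case True then show ?thesis using \<rho> by (intro exI[of _ \<rho>]) (auto simp: k_def)
    next
      case False
      have "Transposition.transpose (2 * m) (2 * m + 1) permutes {..<2 * Suc m}" by (intro permutes_swap_id) auto
      moreover have "?g (\<sigma> \<circ> Transposition.transpose (2 * m) (2 * m + 1)) = ?g \<sigma>" if "\<sigma> \<in> ?S" for \<sigma>
        using that by (intro pf_term_swap_in_pair skew) auto
      ultimately have "good (Transposition.transpose (2 * m) (2 * m + 1))" unfolding good_def by blast
      then have "good (\<rho> \<circ> Transposition.transpose (2 * m) (2 * m + 1))" by (rule good_comp[OF \<rho>(1)])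
      moreover have "(\<rho> \<circ> Transposition.transpose (2 * m) (2 * m + 1)) (2 * m) = j"
        using \<rho>(3) False by (simp add: k_def)
      ultimately show ?thesis by blast
    qed
  qed
  have slot: "sum (?h j) ?S = sum (?h (2 * m)) ?S" if j: "j < 2 * Suc m" for j
  proof -
    obtain \<rho> where \<rho>: "good \<rho>" "\<rho> (2 * m) = j" using good_move[OF j] by blast
    have "sum (?h (2 * m)) ?S = (\<Sum>\<sigma>\<in>?S. ?h (2 * m) (\<sigma> \<circ> \<rho>))"
      using \<rho>(1) by (intro sum_permutations_compose_right) (simp add: good_def)
    also have "\<dots> = sum (?h j) ?S"
    proof (intro sum.cong refl)
      fix \<sigma> assume "\<sigma> \<in> ?S"
      then have "?g (\<sigma> \<circ> \<rho>) = ?g \<sigma>" using \<rho>(1) unfolding good_def by blast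
      then show "?h (2 * m) (\<sigma> \<circ> \<rho>) = ?h j \<sigma>" by (simp only: o_apply \<rho>(2))
    qed
    finally show ?thesis by (rule sym)
  qed
  have last: "sum (?h (2 * m)) ?S
      = (\<Sum>\<sigma> | \<sigma> permutes {..<2 * m}. pf_term \<eta> m v \<sigma>) * \<eta> (v (2 * m)) (v (2 * m + 1))"
  proof -
    have sub: "{\<sigma>. \<sigma> permutes {..<2 * m}} \<subseteq> ?S"
    proof clarify
      fix \<sigma> :: "nat \<Rightarrow> nat" assume "\<sigma> permutes {..<2 * m}"
      then show "\<sigma> permutes {..<2 * Suc m}" by (rule permutes_subset) simp
    qed
    have vanish: "?h (2 * m) \<sigma> = 0" if \<sigma>: "\<sigma> \<in> ?S" "\<not> \<sigma> permutes {..<2 * m}" for \<sigma>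
    proof (cases "\<sigma> (2 * m) = 2 * m")
      case True
      have "\<sigma> (2 * m + 1) \<noteq> 2 * m + 1"
      proof
        assume "\<sigma> (2 * m + 1) = 2 * m + 1"
        have "\<sigma> permutes {..<2 * m}"
        proof (rule permutes_superset[of \<sigma> "{..<2 * Suc m}"])
          fix x assume "x \<in> {..<2 * Suc m} - {..<2 * m}"
          then have "x = 2 * m \<or> x = 2 * m + 1" by auto
          then show "\<sigma> x = x" using True \<open>\<sigma> (2 * m + 1) = 2 * m + 1\<close> by (elim disjE) simp_all
        qed (use \<sigma>(1) in simp)
        with \<sigma>(2) show False ..
      qed
      moreover have "\<sigma> (2 * m + 1) \<noteq> 2 * m"
      proof
        assume "\<sigma> (2 * m + 1) = 2 * m"
        then have "\<sigma> (2 * m + 1) = \<sigma> (2 * m)" using True by simp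
        moreover have "inj \<sigma>" using \<sigma>(1) permutes_inj by blast
        ultimately show False by (simp add: inj_eq)
      qed
      moreover have "\<sigma> (2 * m + 1) < 2 * Suc m" using \<sigma>(1) by (simp add: permutes_lessThan_iff)
      ultimately have "\<sigma> (2 * m + 1) < 2 * m" by simp
      then have "\<eta> (v (\<sigma> (2 * m))) (v (\<sigma> (2 * m + 1))) = 0" 
        using orth[of "\<sigma> (2 * m + 1)"] skew[of "v (2 * m)" "v (\<sigma> (2 * m + 1))"] True by simp
      then show ?thesis using True by (simp add: pf_term_def)
    qed simp
    have "sum (?h (2 * m)) ?S = sum (?h (2 * m)) {\<sigma>. \<sigma> permutes {..<2 * m}}"
    proof (rule sum.mono_neutral_right[OF _ sub])
      show "finite ?S" by (rule finite_permutations) simp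
      show "\<forall>\<sigma>\<in>?S - {\<sigma>. \<sigma> permutes {..<2 * m}}. ?h (2 * m) \<sigma> = 0" using vanish by blast
    qed
    also have "\<dots> = (\<Sum>\<sigma> | \<sigma> permutes {..<2 * m}. pf_term \<eta> m v \<sigma> * \<eta> (v (2 * m)) (v (2 * m + 1)))"
    proof (intro sum.cong refl)
      fix \<sigma> assume "\<sigma> \<in> {\<sigma>. \<sigma> permutes {..<2 * m}}"
      then have "\<sigma> (2 * m) = 2 * m" "\<sigma> (2 * m + 1) = 2 * m + 1" by (auto intro: permutes_not_in)
      then show "?h (2 * m) \<sigma> = pf_term \<eta> m v \<sigma> * \<eta> (v (2 * m)) (v (2 * m + 1))"
        by (simp add: pf_term_def)
    qed
    finally show ?thesis by (simp add: sum_distrib_right)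
  qed
  have "sum ?g ?S = (\<Sum>\<sigma>\<in>?S. \<Sum>j<2 * Suc m. ?h j \<sigma>)"
  proof (intro sum.cong refl)
    fix \<sigma> assume "\<sigma> \<in> ?S"
    then have \<sigma>: "\<sigma> permutes {..<2 * Suc m}" by simp
    have "(\<Sum>j<2 * Suc m. ?h j \<sigma>) = (\<Sum>j\<in>{inv \<sigma> (2 * m)}. ?h j \<sigma>)"
    proof (rule sum.mono_neutral_right)
      show "{inv \<sigma> (2 * m)} \<subseteq> {..<2 * Suc m}"
        using permutes_lessThan_iff[OF permutes_inv[OF \<sigma>]] by simp
      show "\<forall>j\<in>{..<2 * Suc m} - {inv \<sigma> (2 * m)}. ?h j \<sigma> = 0"
      proof
        fix j assume "j \<in> {..<2 * Suc m} - {inv \<sigma> (2 * m)}"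
        then show "?h j \<sigma> = 0" using permutes_inverses(2)[OF \<sigma>, of j] by auto
      qed
    qed simp
    then show "?g \<sigma> = (\<Sum>j<2 * Suc m. ?h j \<sigma>)" using permutes_inverses(1)[OF \<sigma>] by simp
  qed
  also have "\<dots> = (\<Sum>j<2 * Suc m. sum (?h j) ?S)" by (rule sum.swap)
  also have "\<dots> = (\<Sum>j<2 * Suc m. sum (?h (2 * m)) ?S)" by (intro sum.cong refl slot) auto
  also have "\<dots> = real (2 * Suc m) * sum (?h (2 * m)) ?S" by simp
  finally have "sum ?g ?S = real (2 * Suc m) * sum (?h (2 * m)) ?S" .
  then show ?thesis unfolding wedge_power_eq_pf_sum[of _ "Suc m"] last by (simp add: wedge_power_eq_pf_sum field_simps)
qed

lemma wedge_power_1: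
  assumes "\<And>u w. \<eta> u w = - \<eta> w u"
  shows "wedge_power \<eta> (Suc 0) v = \<eta> (v 0) (v 1)"
proof -
  have "wedge_power \<eta> (Suc 0) v = real (Suc 0) * wedge_power \<eta> 0 v * \<eta> (v (2 * 0)) (v (2 * 0 + 1))"
    by (rule wedge_power_orthogonal_pair[OF assms]) simp
  then show ?thesis by (simp only: wedge_power.simps) simp
qed

lemma wedge_power_2:
  assumes skew: "\<And>u w. \<eta> u w = - \<eta> w u"
  shows "wedge_power \<eta> 2 v = 2 * (\<eta> (v 0) (v 1) * \<eta> (v 2) (v 3)
    - \<eta> (v 0) (v 2) * \<eta> (v 1) (v 3) + \<eta> (v 0) (v 3) * \<eta> (v 1) (v 2))"
proof -
  have f0123: "finite {1::nat, 2, 3}" "0 \<notin> {1::nat, 2, 3}"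
    and f123: "finite {2::nat, 3}" "1 \<notin> {2::nat, 3}"
    and f23: "finite {3::nat}" "2 \<notin> {3::nat}" by auto
  have set: "{..<2 * 2} = {0::nat, 1, 2, 3}" by auto
  have prod: "(\<Prod>i<2. \<eta> (v (\<sigma> (2 * i))) (v (\<sigma> (2 * i + 1)))) = \<eta> (v (\<sigma> 0)) (v (\<sigma> 1)) * \<eta> (v (\<sigma> 2)) (v (\<sigma> 3))"
    for \<sigma> :: "nat \<Rightarrow> nat"
    by (simp add: numeral_2_eq_2 numeral_3_eq_3)
  note s = skew[of "v 1" "v 0"] skew[of "v 2" "v 0"] skew[of "v 3" "v 0"]
    skew[of "v 2" "v 1"] skew[of "v 3" "v 1"] skew[of "v 3" "v 2"]
  have "(\<Sum>\<sigma> | \<sigma> permutes {..<2 * 2}. pf_term \<eta> 2 v \<sigma>)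
      = 8 * (\<eta> (v 0) (v 1) * \<eta> (v 2) (v 3) - \<eta> (v 0) (v 2) * \<eta> (v 1) (v 3) + \<eta> (v 0) (v 3) * \<eta> (v 1) (v 2))"
    unfolding pf_term_def set prod
      sum_over_permutations_insert[OF f0123] sum_over_permutations_insert[OF f123]
      sum_over_permutations_insert[OF f23] permutes_sing
    by (simp add: sign_swap_id permutation_swap_id permutation_compose sign_compose sign_id
        Transposition.transpose_def s del: One_nat_def)
  then show ?thesis by (simp add: wedge_power_eq_pf_sum)
qed

text \<open>The vectors below position \<open>2a\<close> form an arbitrary block, and the vectors from there up to
  \<open>2m\<close> form hyperbolic pairs that are orthogonal to the block and to each other.  The pairs are
  positive but not normalised, so that the condition is open.\<close>

definition hyperbolic_from :: "('v \<Rightarrow> 'v \<Rightarrow> real) \<Rightarrow> nat \<Rightarrow> nat \<Rightarrow> (nat \<Rightarrow> 'v) \<Rightarrow> bool" where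
  "hyperbolic_from \<eta> a m v \<longleftrightarrow>
     (\<forall>j k. j < k \<longrightarrow> 2 * a \<le> k \<longrightarrow> k < 2 * m \<longrightarrow> \<not> (even j \<and> k = Suc j) \<longrightarrow> \<eta> (v j) (v k) = 0) \<and>
     (\<forall>i. a \<le> i \<longrightarrow> i < m \<longrightarrow> \<eta> (v (2 * i)) (v (2 * i + 1)) > 0)"

text \<open>The pairs can be peeled off one by one by the expansion along the last slot.\<close>

lemma wedge_power_hyperbolic:
  assumes skew: "\<And>u w. \<eta> u w = - \<eta> w u" and "hyperbolic_from \<eta> a m v" "a \<le> m"
  shows "\<exists>C>0. wedge_power \<eta> m v = C * wedge_power \<eta> a v"
  using assms(2,3)
proof (induction m)
  case 0
  then show ?case by (intro exI[of _ 1]) simp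
next
  case (Suc m)
  show ?case
  proof (cases "a = Suc m")
    case True then show ?thesis by (intro exI[of _ 1]) simp
  next
    case False
    have "hyperbolic_from \<eta> a m v" using Suc.prems(1) by (simp add: hyperbolic_from_def)
    then obtain C where C: "C > 0" "wedge_power \<eta> m v = C * wedge_power \<eta> a v"
      using Suc.IH Suc.prems False by auto
    let ?h = "\<eta> (v (2 * m)) (v (2 * m + 1))"
    have "?h > 0" using Suc.prems False by (simp add: hyperbolic_from_def)
    moreover have "wedge_power \<eta> (Suc m) v = real (Suc m) * wedge_power \<eta> m v * ?h"
    proof (rule wedge_power_orthogonal_pair[OF skew])
      fix i assume "i < 2 * m"
      moreover have "\<not> (even i \<and> 2 * m = Suc i)" by presburger
      moreover have "2 * a \<le> 2 * m" "2 * m < 2 * Suc m" using Suc.prems(2) False by auto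
      ultimately show "\<eta> (v i) (v (2 * m)) = 0"
        using Suc.prems(1) unfolding hyperbolic_from_def by blast
    qed
    ultimately show ?thesis using C
      by (intro exI[of _ "real (Suc m) * C * ?h"]) (simp add: mult_ac)
  qed
qed

lemma det_swap_matrix:
  fixes k l :: "'c::finite"
  assumes "k \<noteq> l"
  shows "det ((\<chi> i j. mat 1 $ i $ Transposition.transpose k l j) :: real ^ 'c ^ 'c) = - 1"
proof -
  have "((\<chi> i j. mat 1 $ i $ Transposition.transpose k l j) :: real ^ 'c ^ 'c)
      = (\<chi> i. (mat 1 :: real^'c^'c) $ Transposition.transpose k l i)"
    by (auto simp: vec_eq_iff mat_def Transposition.transpose_def)
  then have "det ((\<chi> i j. mat 1 $ i $ Transposition.transpose k l j) :: real ^ 'c ^ 'c)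
      = of_int (sign (Transposition.transpose k l)) * det (mat 1 :: real^'c^'c)"
    using det_permute_rows[OF permutes_swap_id[OF UNIV_I UNIV_I, of k l], of "mat 1 :: real^'c^'c"] by simp
  then show ?thesis using assms by (simp add: sign_swap_id)
qed

lemma det_shear_matrix:
  fixes k l :: "'c::finite"
  assumes "k \<noteq> l"
  shows "det ((\<chi> i j. of_bool (i = k \<and> j = l \<or> i = j)) :: real ^ 'c ^ 'c) = 1"
proof -
  have "((\<chi> i j. of_bool (i = k \<and> j = l \<or> i = j)) :: real ^ 'c ^ 'c)
      = (\<chi> i. if i = k then row k (mat 1) + 1 *s row l (mat 1) else row i (mat 1 :: real^'c^'c))"
    using assms by (auto simp: vec_eq_iff row_def mat_def)
  then show ?thesis using det_row_operation[OF assms, of "mat 1" 1] by simp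
qed

locale alternating_form =
  fixes \<eta> :: "'v::real_vector \<Rightarrow> 'v \<Rightarrow> real"
  assumes add_left: "\<eta> (u + v) w = \<eta> u w + \<eta> v w"
    and scale_left: "\<eta> (c *\<^sub>R u) w = c * \<eta> u w"
    and skew: "\<eta> u w = - \<eta> w u"
begin

lemma add_right: "\<eta> w (u + v) = \<eta> w u + \<eta> w v"
  by (metis add_left skew minus_add_distrib)

lemma scale_right: "\<eta> w (c *\<^sub>R u) = c * \<eta> w u"
  by (metis scale_left skew mult_minus_right)

lemma zero_left [simp]: "\<eta> 0 w = 0"
  using scale_left[of 0 0 w] by simp

lemma zero_right [simp]: "\<eta> w 0 = 0"
  using skew[of w 0] by simp

lemma self [simp]: "\<eta> u u = 0"
  using skew[of u u] by simp

lemma sum_left: "\<eta> (\<Sum>i\<in>I. f i) w = (\<Sum>i\<in>I. \<eta> (f i) w)"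
  by (induction I rule: infinite_finite_induct) (simp_all add: add_left)

lemma sum_right: "\<eta> w (\<Sum>i\<in>I. f i) = (\<Sum>i\<in>I. \<eta> w (f i))"
  by (induction I rule: infinite_finite_induct) (simp_all add: add_right)

lemma diff_left: "\<eta> (u - v) w = \<eta> u w - \<eta> v w"
  using add_left[of "u - v" v w] by simp

lemma diff_right: "\<eta> w (u - v) = \<eta> w u - \<eta> w v"
  using add_right[of w "u - v" v] by simp

lemma wedge_power_slot:
  assumes "j < 2 * m"
  shows "wedge_power \<eta> m (v(j := a *\<^sub>R u + b *\<^sub>R w)) = a * wedge_power \<eta> m (v(j := u)) + b * wedge_power \<eta> m (v(j := w))"
proof -
  have "pf_term \<eta> m (v(j := a *\<^sub>R u + b *\<^sub>R w)) \<sigma> = a * pf_term \<eta> m (v(j := u)) \<sigma> + b * pf_term \<eta> m (v(j := w)) \<sigma>"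
    if \<sigma>: "\<sigma> permutes {..<2 * m}" for \<sigma>
  proof -
    define p where "p = inv \<sigma> j"
    define k where "k = p div 2"
    have p: "p < 2 * m" using permutes_lessThan_iff[OF permutes_inv[OF \<sigma>]] assms by (simp add: p_def)
    then have k: "k < m" by (auto simp: k_def)
    have eqj: "\<sigma> l = j \<longleftrightarrow> l = p" for l
      using permutes_inv_eq[OF \<sigma>, of j l] by (auto simp: p_def)
    let ?f = "\<lambda>x i. \<eta> ((v(j := x)) (\<sigma> (2 * i))) ((v(j := x)) (\<sigma> (2 * i + 1)))"
    have "?f x i = \<eta> (v (\<sigma> (2 * i))) (v (\<sigma> (2 * i + 1)))" if "i \<noteq> k" for i x
    proof -
      have "2 * i \<noteq> p" "2 * i + 1 \<noteq> p" using that by (auto simp: k_def)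
      then show ?thesis by (simp add: eqj)
    qed
    then have rest: "(\<Prod>i<m. ?f x i) = ?f x k * (\<Prod>i\<in>{..<m} - {k}. \<eta> (v (\<sigma> (2 * i))) (v (\<sigma> (2 * i + 1))))" for x
      using k by (simp add: prod.remove[of "{..<m}" k])
    have "?f (a *\<^sub>R u + b *\<^sub>R w) k = a * ?f u k + b * ?f w k"
    proof (cases "even p")
      case True
      then have "2 * k = p" "2 * k + 1 \<noteq> p" by (auto simp: k_def)
      then show ?thesis by (simp add: eqj add_left scale_left)
    next
      case False
      then have "2 * k + 1 = p" by (simp add: k_def)
      moreover from this have "2 * k \<noteq> p" by simp
      ultimately show ?thesis by (simp add: eqj add_right scale_right)
    qed
    then show ?thesis unfolding pf_term_def rest by (simp add: algebra_simps)
  qed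
  then show ?thesis
    by (simp add: wedge_power_eq_pf_sum sum.distrib sum_distrib_left add_divide_distrib)
qed

lemma wedge_power_slot_sum:
  assumes "j < 2 * m" "finite I"
  shows "wedge_power \<eta> m (v(j := (\<Sum>i\<in>I. a i *\<^sub>R u i))) = (\<Sum>i\<in>I. a i * wedge_power \<eta> m (v(j := u i)))"
  using assms(2)
proof (induction I)
  case empty
  then show ?case using wedge_power_slot[OF assms(1), of v 0 0 0 0] by (simp add: fun_upd_def)
next
  case (insert x I)
  then show ?case
    using wedge_power_slot[OF assms(1), of v "a x" "u x" 1 "\<Sum>i\<in>I. a i *\<^sub>R u i"] by (simp add: fun_upd_def)
qed

lemma wedge_power_repeated:
  assumes "j < 2 * m" "k < 2 * m" "j \<noteq> k" "v j = v k"
  shows "wedge_power \<eta> m v = 0"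
proof -
  have "(\<lambda>i. v (Transposition.transpose j k i)) = v" using assms(4) by (auto simp: Transposition.transpose_def)
  moreover have "Transposition.transpose j k permutes {..<2 * m}" using assms by (intro permutes_swap_id) auto
  ultimately show ?thesis
    using wedge_power_permute[of "Transposition.transpose j k" m \<eta> v] assms(3) by (simp add: sign_swap_id)
qed

lemma wedge_power_radical_slot:
  assumes "j < 2 * m" "\<And>w. \<eta> (v j) w = 0"
  shows "wedge_power \<eta> m v = 0"
proof -
  have "wedge_power \<eta> m v = wedge_power \<eta> m (v(j := 0))"
    using assms(2) skew by (intro wedge_power_cong) (metis fun_upd_apply minus_zero zero_left zero_right)
  also have "\<dots> = 0" using wedge_power_slot[OF assms(1), of v 0 0 0 0] by simp
  finally show ?thesis .
qed

text \<open>Vectors that are linearly dependent modulo the radical have vanishing Pfaffian.\<close>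

lemma wedge_power_dependent:
  assumes "j < 2 * m" "a j \<noteq> 0" "\<And>w. \<eta> (\<Sum>i<2 * m. a i *\<^sub>R v i) w = 0"
  shows "wedge_power \<eta> m v = 0"
proof -
  have "0 = wedge_power \<eta> m (v(j := (\<Sum>i<2 * m. a i *\<^sub>R v i)))"
    using wedge_power_radical_slot[OF assms(1), of "v(j := (\<Sum>i<2 * m. a i *\<^sub>R v i))"] assms(3) by simp
  also have "\<dots> = (\<Sum>i<2 * m. a i * wedge_power \<eta> m (v(j := v i)))"
    by (rule wedge_power_slot_sum[OF assms(1)]) simp
  also have "\<dots> = (\<Sum>i\<in>{j}. a i * wedge_power \<eta> m (v(j := v i)))"
  proof (rule sum.mono_neutral_right)
    show "\<forall>i\<in>{..<2 * m} - {j}. a i * wedge_power \<eta> m (v(j := v i)) = 0"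
      using wedge_power_repeated[of j m _ "v(j := v _)"] assms(1) by auto
  qed (use assms(1) in auto)
  finally show ?thesis using assms(2) by simp
qed

text \<open>The top power is a determinant: both sides are multiplicative in \<open>A\<close>, so it suffices to
  compare them on elementary matrices.\<close>

lemma wedge_power_top:
  fixes A :: "real ^ 'k ^ 'k" and e :: "nat \<Rightarrow> 'k::finite"
  assumes e: "bij_betw e {..<2 * m} UNIV"
  shows "wedge_power \<eta> m (\<lambda>j. \<Sum>l\<in>UNIV. A $ e j $ l *\<^sub>R u l) = det A * wedge_power \<eta> m (\<lambda>j. u (e j))"
proof -
  define F where "F u = wedge_power \<eta> m (\<lambda>j. u (e j))" for u :: "'k \<Rightarrow> 'v"
  define f where "f = inv_into {..<2 * m} e"
  have f: "f k < 2 * m" "e (f k) = k" for k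
    using bij_betw_inv_into_right[OF e] inv_into_into[of k e "{..<2*m}"] e
    by (auto simp: f_def bij_betw_def)
  have fe: "f (e j) = j" if "j < 2 * m" for j
    using bij_betw_inv_into_left[OF e] that by (simp add: f_def)
  have F_upd: "F (u(k := x)) = wedge_power \<eta> m ((\<lambda>j. u (e j))(f k := x))" for u k x
    unfolding F_def
  proof (rule wedge_power_cong)
    have "(u(k := x)) (e i) = ((\<lambda>j. u (e j))(f k := x)) i" if "i < 2 * m" for i
      using f(2)[of k] fe[OF that] by auto
    then show "\<eta> ((u(k := x)) (e i)) ((u(k := x)) (e j))
        = \<eta> (((\<lambda>j. u (e j))(f k := x)) i) (((\<lambda>j. u (e j))(f k := x)) j)" if "i < 2 * m" "j < 2 * m" for i j
      using that by simp
  qed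
  have F_scale: "F (u(k := c *\<^sub>R x)) = c * F (u(k := x))" for u k x c
    unfolding F_upd using wedge_power_slot[OF f(1)[of k], of "\<lambda>j. u (e j)" c x 0 0] by simp
  have F_add: "F (u(k := x + y)) = F (u(k := x)) + F (u(k := y))" for u k x y
    unfolding F_upd using wedge_power_slot[OF f(1)[of k], of "\<lambda>j. u (e j)" 1 x 1 y] by simp
  have F_swap: "F (\<lambda>i. u (Transposition.transpose k l i)) = - F u" if "k \<noteq> l" for u k l
  proof -
    have inj: "f k \<noteq> f l" using f(2)[of k] f(2)[of l] that by auto
    have tr: "Transposition.transpose k l (e j) = e (Transposition.transpose (f k) (f l) j)" if "j < 2 * m" for j
    proof -
      have "e j = k \<longleftrightarrow> j = f k" "e j = l \<longleftrightarrow> j = f l" using fe[OF that] f(2)[of k] f(2)[of l] by auto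
      then show ?thesis using f(2)[of k] f(2)[of l] by (auto simp: Transposition.transpose_def)
    qed
    have "F (\<lambda>i. u (Transposition.transpose k l i)) = wedge_power \<eta> m (\<lambda>j. u (e (Transposition.transpose (f k) (f l) j)))"
      unfolding F_def by (rule wedge_power_cong) (simp add: tr)
    also have "\<dots> = of_int (sign (Transposition.transpose (f k) (f l))) * F u"
      unfolding F_def
      by (rule wedge_power_permute[of _ _ _ "\<lambda>j. u (e j)"], rule permutes_swap_id) (simp_all add: f(1))
    finally show ?thesis using inj by (simp add: sign_swap_id)
  qed
  have F_rep: "F u = 0" if "k \<noteq> l" "u k = u l" for u k l
  proof -
    have "(\<lambda>i. u (Transposition.transpose k l i)) = u" using that(2) by (auto simp: Transposition.transpose_def)
    then show ?thesis using F_swap[OF that(1), of u] by simp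
  qed
  have "\<forall>u. F (\<lambda>k. \<Sum>l\<in>UNIV. A $ k $ l *\<^sub>R u l) = det A * F u"
  proof (induction A rule: induct_matrix_elementary_alt)
    case (1 A B)
    show ?case
    proof
      fix u :: "'k \<Rightarrow> 'v"
      have "(\<lambda>k. \<Sum>l\<in>UNIV. (A ** B) $ k $ l *\<^sub>R u l) = (\<lambda>k. \<Sum>i\<in>UNIV. A $ k $ i *\<^sub>R (\<Sum>l\<in>UNIV. B $ i $ l *\<^sub>R u l))"
      proof
        fix k
        have "(\<Sum>l\<in>UNIV. (A ** B) $ k $ l *\<^sub>R u l) = (\<Sum>l\<in>UNIV. \<Sum>i\<in>UNIV. (A $ k $ i * B $ i $ l) *\<^sub>R u l)"
          unfolding matrix_matrix_mult_def by (simp only: vec_lambda_beta scaleR_left.sum)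
        also have "\<dots> = (\<Sum>i\<in>UNIV. \<Sum>l\<in>UNIV. (A $ k $ i * B $ i $ l) *\<^sub>R u l)" by (rule sum.swap)
        finally show "(\<Sum>l\<in>UNIV. (A ** B) $ k $ l *\<^sub>R u l) = (\<Sum>i\<in>UNIV. A $ k $ i *\<^sub>R (\<Sum>l\<in>UNIV. B $ i $ l *\<^sub>R u l))"
          by (simp add: scaleR_right.sum)
      qed
      with 1 show "F (\<lambda>k. \<Sum>l\<in>UNIV. (A ** B) $ k $ l *\<^sub>R u l) = det (A ** B) * F u" by (simp add: det_mul)
    qed
  next
    case (2 A i)
    show ?case
    proof
      fix u :: "'k \<Rightarrow> 'v"
      let ?u = "\<lambda>k. \<Sum>l\<in>UNIV. A $ k $ l *\<^sub>R u l"
      have "A $ i = 0" using 2 by (simp add: row_def vec_eq_iff)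
      then have "?u = ?u(i := 0 *\<^sub>R 0)" by auto
      then have "F ?u = 0" using F_scale[of ?u i 0 0] by simp
      then show "F ?u = det A * F u" using det_zero_row(2)[OF 2] by simp
    qed
  next
    case (3 A)
    show ?case
    proof
      fix u :: "'k \<Rightarrow> 'v"
      have "(\<lambda>k. \<Sum>l\<in>UNIV. A $ k $ l *\<^sub>R u l) = (\<lambda>k. A $ k $ k *\<^sub>R u k)"
      proof
        fix k
        have "(\<Sum>l\<in>UNIV. A $ k $ l *\<^sub>R u l) = (\<Sum>l\<in>{k}. A $ k $ l *\<^sub>R u l)"
          by (rule sum.mono_neutral_right) (use 3 in auto)
        then show "(\<Sum>l\<in>UNIV. A $ k $ l *\<^sub>R u l) = A $ k $ k *\<^sub>R u k" by simp
      qed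
      moreover have "F (\<lambda>k. if k \<in> I then A $ k $ k *\<^sub>R u k else u k) = (\<Prod>k\<in>I. A $ k $ k) * F u" if "finite I" for I
        using that
      proof (induction I)
        case (insert i I)
        let ?w = "\<lambda>k. if k \<in> I then A $ k $ k *\<^sub>R u k else u k"
        have "(\<lambda>k. if k \<in> insert i I then A $ k $ k *\<^sub>R u k else u k) = ?w(i := A $ i $ i *\<^sub>R u i)" by auto
        moreover have "?w(i := u i) = ?w" using insert by auto
        ultimately show ?case using insert F_scale[of ?w i "A $ i $ i" "u i"] by simp
      qed simp
      from this[of UNIV] have "F (\<lambda>k. A $ k $ k *\<^sub>R u k) = (\<Prod>k\<in>UNIV. A $ k $ k) * F u" by simp
      ultimately show "F (\<lambda>k. \<Sum>l\<in>UNIV. A $ k $ l *\<^sub>R u l) = det A * F u"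
        using det_diagonal[OF 3] by simp
    qed
  next
    case (4 k l)
    let ?S = "(\<chi> i j. mat 1 $ i $ Transposition.transpose k l j) :: real ^ 'k ^ 'k"
    have "det ?S = - 1" by (rule det_swap_matrix[OF 4])
    moreover have "(\<lambda>i. \<Sum>j\<in>UNIV. ?S $ i $ j *\<^sub>R u j) = (\<lambda>i. u (Transposition.transpose k l i))" for u :: "'k \<Rightarrow> 'v"
    proof
      fix i
      have "(\<Sum>j\<in>UNIV. ?S $ i $ j *\<^sub>R u j) = (\<Sum>j\<in>{Transposition.transpose k l i}. ?S $ i $ j *\<^sub>R u j)"
        by (rule sum.mono_neutral_right) (auto simp: mat_def Transposition.transpose_def split: if_splits)
      then show "(\<Sum>j\<in>UNIV. ?S $ i $ j *\<^sub>R u j) = u (Transposition.transpose k l i)" by (simp add: mat_def)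
    qed
    ultimately show ?case using F_swap[OF 4] by simp
  next
    case (5 k l)
    let ?E = "(\<chi> i j. of_bool (i = k \<and> j = l \<or> i = j)) :: real ^ 'k ^ 'k"
    have "det ?E = 1" by (rule det_shear_matrix[OF 5])
    moreover have "F (\<lambda>i. \<Sum>j\<in>UNIV. ?E $ i $ j *\<^sub>R u j) = F u" for u :: "'k \<Rightarrow> 'v"
    proof -
      have "(\<lambda>i. \<Sum>j\<in>UNIV. ?E $ i $ j *\<^sub>R u j) = u(k := u k + u l)"
      proof
        fix i
        have "(\<Sum>j\<in>UNIV. ?E $ i $ j *\<^sub>R u j) = (\<Sum>j\<in>(if i = k then {k, l} else {i}). u j)"
          by (rule sum.mono_neutral_cong_right) (auto split: if_splits)
        then show "(\<Sum>j\<in>UNIV. ?E $ i $ j *\<^sub>R u j) = (u(k := u k + u l)) i" using 5 by simp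
      qed
      then show ?thesis using F_add[of u k "u k" "u l"] F_rep[OF 5, of "u(k := u l)"] 5 by simp
    qed
    ultimately show ?case by simp
  qed
  then show ?thesis by (simp add: F_def)
qed

end

section \<open>Orienting semidefinite spaces of two-forms in dimension four\<close>

lemma sign_preserved_on_path:
  fixes f :: "real \<Rightarrow> real"
  assumes "continuous_on {0..1} f" "\<And>t. 0 \<le> t \<Longrightarrow> t \<le> 1 \<Longrightarrow> f t \<noteq> 0"
  shows "f 0 * f 1 > 0"
proof (rule ccontr)
  assume "\<not> f 0 * f 1 > 0"
  then have "(f 0 \<le> 0 \<and> 0 \<le> f 1) \<or> (f 1 \<le> 0 \<and> 0 \<le> f 0)"
    by (simp add: not_less mult_le_0_iff) blast
  then have "\<exists>t. 0 \<le> t \<and> t \<le> 1 \<and> f t = 0"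
    using IVT'[of f 0 0 1] IVT2'[of f 1 0 0] assms(1) by (elim disjE) simp_all
  with assms(2) show False by blast
qed

lemma continuous_on_det:
  assumes "\<And>i j. continuous_on S (\<lambda>t. A t $ i $ j)"
  shows "continuous_on S (\<lambda>t. det (A t :: real ^ 'n ^ 'n))"
  unfolding det_def by (intro continuous_on_sum continuous_on_mult continuous_on_prod continuous_on_const assms)

text \<open>A two-form on a four-space with a frame is a skew matrix \<open>S\<close>.  Its Pfaffian \<open>q\<close> is a
  quadratic form of signature \<open>(3,3)\<close>; the components of \<open>sd s\<close> for \<open>s = 1\<close> (\<open>s = -1\<close>) are the
  coordinates of the self-dual (anti-self-dual) part, on whose kernel \<open>q\<close> is negative
  (positive) definite.\<close>

definition skew_mat :: "real ^ 4 ^ 4 \<Rightarrow> bool" where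
  "skew_mat S \<longleftrightarrow> (\<forall>i j. S $ i $ j = - S $ j $ i)"

definition pf4 :: "real ^ 4 ^ 4 \<Rightarrow> real" where
  "pf4 S = S $ 1 $ 2 * S $ 3 $ 4 - S $ 1 $ 3 * S $ 2 $ 4 + S $ 1 $ 4 * S $ 2 $ 3"

definition sd :: "real \<Rightarrow> real ^ 4 ^ 4 \<Rightarrow> real ^ 3" where
  "sd s S = vector [S $ 1 $ 2 + s * S $ 3 $ 4, S $ 1 $ 3 - s * S $ 2 $ 4, S $ 1 $ 4 + s * S $ 2 $ 3]"

definition congr :: "real ^ 4 ^ 4 \<Rightarrow> real ^ 4 ^ 4 \<Rightarrow> real ^ 4 ^ 4" where
  "congr g S = g ** S ** transpose g"

lemma sd_nth [simp]:
  "sd s S $ 1 = S $ 1 $ 2 + s * S $ 3 $ 4"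
  "sd s S $ 2 = S $ 1 $ 3 - s * S $ 2 $ 4"
  "sd s S $ 3 = S $ 1 $ 4 + s * S $ 2 $ 3"
  by (simp_all add: sd_def)

lemma skew_mat_nth:
  assumes "skew_mat S"
  shows "S $ i $ i = 0" "S $ 2 $ 1 = - S $ 1 $ 2" "S $ 3 $ 1 = - S $ 1 $ 3" "S $ 4 $ 1 = - S $ 1 $ 4"
    "S $ 3 $ 2 = - S $ 2 $ 3" "S $ 4 $ 2 = - S $ 2 $ 4" "S $ 4 $ 3 = - S $ 3 $ 4"
proof -
  have sk: "S $ i $ j = - S $ j $ i" for i j using assms unfolding skew_mat_def by (elim allE)
  show "S $ i $ i = 0" using sk[of i i] by simp
qed (rule assms[unfolded skew_mat_def, rule_format])+

lemma congr_nth: "congr g S $ i $ j = (\<Sum>a\<in>UNIV. \<Sum>b\<in>UNIV. g $ i $ a * S $ a $ b * g $ j $ b)"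
proof -
  have "congr g S $ i $ j = (\<Sum>b\<in>UNIV. \<Sum>a\<in>UNIV. g $ i $ a * S $ a $ b * g $ j $ b)"
    by (simp add: congr_def matrix_matrix_mult_def transpose_def sum_distrib_right)
  also have "\<dots> = (\<Sum>a\<in>UNIV. \<Sum>b\<in>UNIV. g $ i $ a * S $ a $ b * g $ j $ b)" by (rule sum.swap)
  finally show ?thesis .
qed

lemma congr_mult: "congr (A ** B) S = congr A (congr B S)"
  by (simp add: congr_def matrix_transpose_mul matrix_mul_assoc)

lemma congr_one: "congr (mat 1) S = S"
  by (simp add: congr_def transpose_mat)

lemma skew_mat_congr:
  assumes "skew_mat S"
  shows "skew_mat (congr g S)"
  unfolding skew_mat_def
proof (intro allI)
  fix i j
  have "congr g S $ i $ j = (\<Sum>a\<in>UNIV. \<Sum>b\<in>UNIV. - (g $ j $ b * S $ b $ a * g $ i $ a))"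
    unfolding congr_nth
  proof (intro sum.cong refl)
    fix a b show "g $ i $ a * S $ a $ b * g $ j $ b = - (g $ j $ b * S $ b $ a * g $ i $ a)"
      using assms[unfolded skew_mat_def, rule_format, of a b] by simp
  qed
  also have "\<dots> = (\<Sum>b\<in>UNIV. \<Sum>a\<in>UNIV. - (g $ j $ b * S $ b $ a * g $ i $ a))" by (rule sum.swap)
  also have "\<dots> = - congr g S $ j $ i" by (simp add: congr_nth sum_negf)
  finally show "congr g S $ i $ j = - congr g S $ j $ i" .
qed

lemma congr_monomial:
  assumes "\<And>a. a \<noteq> p \<Longrightarrow> g $ i $ a = 0" "\<And>b. b \<noteq> r \<Longrightarrow> g $ j $ b = 0"
  shows "congr g S $ i $ j = g $ i $ p * S $ p $ r * g $ j $ r"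
proof -
  have "congr g S $ i $ j = (\<Sum>a\<in>{p}. \<Sum>b\<in>UNIV. g $ i $ a * S $ a $ b * g $ j $ b)"
    unfolding congr_nth by (rule sum.mono_neutral_right) (use assms(1) in auto)
  also have "\<dots> = (\<Sum>b\<in>UNIV. g $ i $ p * S $ p $ b * g $ j $ b)" by simp
  also have "\<dots> = (\<Sum>b\<in>{r}. g $ i $ p * S $ p $ b * g $ j $ b)"
    by (rule sum.mono_neutral_right) (use assms(2) in auto)
  finally show ?thesis by simp
qed

lemma congr_diagonal:
  assumes "\<And>i j. i \<noteq> j \<Longrightarrow> g $ i $ j = 0"
  shows "congr g S $ i $ j = g $ i $ i * S $ i $ j * g $ j $ j"
  by (rule congr_monomial) (simp_all add: assms)

definition swap_mat :: "4 \<Rightarrow> 4 \<Rightarrow> real ^ 4 ^ 4" where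
  "swap_mat k l = (\<chi> i j. mat 1 $ i $ Transposition.transpose k l j)"

definition shear_mat :: "4 \<Rightarrow> 4 \<Rightarrow> real ^ 4 ^ 4" where
  "shear_mat k l = (\<chi> i j. of_bool (i = k \<and> j = l \<or> i = j))"

lemma swap_mat_nth: "swap_mat k l $ i $ a = (if a = Transposition.transpose k l i then 1 else 0)"
proof -
  have "i = Transposition.transpose k l a \<longleftrightarrow> a = Transposition.transpose k l i"
  proof
    assume "i = Transposition.transpose k l a"
    then show "a = Transposition.transpose k l i" by (simp only: transpose_involutory)
  next
    assume "a = Transposition.transpose k l i"
    then show "i = Transposition.transpose k l a" by (simp only: transpose_involutory)
  qed
  then show ?thesis by (simp add: swap_mat_def mat_def)
qed

lemma congr_swap: "congr (swap_mat k l) S $ i $ j = S $ Transposition.transpose k l i $ Transposition.transpose k l j"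
proof -
  have "congr (swap_mat k l) S $ i $ j = swap_mat k l $ i $ Transposition.transpose k l i
      * S $ Transposition.transpose k l i $ Transposition.transpose k l j * swap_mat k l $ j $ Transposition.transpose k l j"
    by (rule congr_monomial) (simp_all only: swap_mat_nth if_False)
  then show ?thesis by (simp only: swap_mat_nth) simp
qed

lemma congr_shear:
  assumes "k \<noteq> l"
  shows "congr (shear_mat k l) S $ i $ j = S $ i $ j + of_bool (i = k) * S $ l $ j
    + of_bool (j = k) * (S $ i $ l + of_bool (i = k) * S $ l $ l)"
proof -
  have e: "shear_mat k l $ i $ a = of_bool (a = i) + of_bool (i = k) * of_bool (a = l)" for i a
    using assms by (auto simp: shear_mat_def)
  have d: "(\<Sum>a\<in>UNIV. (of_bool (a = i) + of_bool (i = k) * of_bool (a = l)) * f a) = f i + of_bool (i = k) * f l"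
    for f :: "4 \<Rightarrow> real" and i
  proof -
    have "(\<Sum>a\<in>UNIV. of_bool (a = m) * f a) = f m" for m
      by (simp add: of_bool_def if_distrib[of "\<lambda>x. x * _"] cong: if_cong)
    then show ?thesis by (simp add: distrib_right sum.distrib mult.assoc flip: sum_distrib_left)
  qed
  have "congr (shear_mat k l) S $ i $ j = (\<Sum>b\<in>UNIV. (of_bool (b = j) + of_bool (j = k) * of_bool (b = l)) *
      (\<Sum>a\<in>UNIV. (of_bool (a = i) + of_bool (i = k) * of_bool (a = l)) * S $ a $ b))"
    unfolding congr_nth e by (subst sum.swap) (simp add: sum_distrib_left mult_ac)
  then show ?thesis unfolding d by simp
qed

lemma det_swap_mat: "k \<noteq> l \<Longrightarrow> det (swap_mat k l) = - 1"
  unfolding swap_mat_def by (rule det_swap_matrix)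

text \<open>A path of matrices of determinant one from the identity to a shear.\<close>

definition shear_path :: "4 \<Rightarrow> 4 \<Rightarrow> real \<Rightarrow> real ^ 4 ^ 4" where
  "shear_path k l t = (\<chi> i j. if i = k \<and> j = l then t else of_bool (i = j))"

lemma det_shear_path: "k \<noteq> l \<Longrightarrow> det (shear_path k l t) = 1"
proof -
  assume "k \<noteq> l"
  have "shear_path k l t = (\<chi> i. if i = k then row k (mat 1) + t *s row l (mat 1) else row i (mat 1 :: real^4^4))"
    using \<open>k \<noteq> l\<close> by (auto simp: shear_path_def vec_eq_iff row_def mat_def)
  then show ?thesis using det_row_operation[OF \<open>k \<noteq> l\<close>, of "mat 1 :: real^4^4" t] by simp
qed

lemma shear_path_0: "k \<noteq> l \<Longrightarrow> shear_path k l 0 = mat 1"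
  and shear_path_1: "shear_path k l 1 = shear_mat k l"
  by (auto simp: shear_path_def shear_mat_def vec_eq_iff mat_def)

lemma det_diagonal_4:
  fixes D :: "real ^ 4 ^ 4"
  assumes "\<And>i j. i \<noteq> j \<Longrightarrow> D $ i $ j = 0"
  shows "det D = D $ 1 $ 1 * D $ 2 $ 2 * D $ 3 $ 3 * D $ 4 $ 4"
proof -
  have "(\<Prod>i\<in>UNIV. D $ i $ i) = D $ 1 $ 1 * D $ 2 $ 2 * D $ 3 $ 3 * D $ 4 $ 4"
    unfolding UNIV_4 by simp
  moreover have "det D = (\<Prod>i\<in>UNIV. D $ i $ i)" by (rule det_diagonal) (rule assms)
  ultimately show ?thesis by simp
qed

text \<open>Both sides are multiplicative in \<open>g\<close>, so elementary matrices suffice.\<close>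

lemma pf4_congr:
  assumes "skew_mat S"
  shows "pf4 (congr g S) = det g * pf4 S"
proof -
  have "\<forall>S. skew_mat S \<longrightarrow> pf4 (congr g S) = det g * pf4 S"
  proof (induction g rule: induct_matrix_elementary_alt)
    case (1 A B)
    then show ?case by (simp add: congr_mult skew_mat_congr det_mul)
  next
    case (2 A i)
    then have "A $ i $ a = 0" for a by (simp add: row_def vec_eq_iff)
    then have "congr A S $ i $ j = 0" "congr A S $ j $ i = 0" for S j by (simp_all add: congr_nth)
    then show ?case using exhaust_4[of i] det_zero_row(2)[OF 2] by (auto simp: pf4_def)
  next
    case (3 A)
    have "congr A S $ i $ j = A $ i $ i * S $ i $ j * A $ j $ j" for S i j
      by (rule congr_diagonal) (rule 3)
    moreover have "det A = A $ 1 $ 1 * A $ 2 $ 2 * A $ 3 $ 3 * A $ 4 $ 4"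
      by (rule det_diagonal_4) (rule 3)
    ultimately show ?case unfolding pf4_def by (simp add: algebra_simps)
  next
    case (4 k l)
    show ?case unfolding swap_mat_def[symmetric]
      using exhaust_4[of k] exhaust_4[of l] 4
      by (elim disjE) (simp_all add: det_swap_mat pf4_def congr_swap Transposition.transpose_def skew_mat_nth)
  next
    case (5 k l)
    show ?case unfolding shear_mat_def[symmetric]
      using exhaust_4[of k] exhaust_4[of l] 5 det_shear_path[OF 5, of 1]
      by (elim disjE) (simp_all add: shear_path_1 pf4_def congr_shear skew_mat_nth algebra_simps)
  qed
  with assms show ?thesis by blast
qed

definition sd_mat :: "real \<Rightarrow> (3 \<Rightarrow> real ^ 4 ^ 4) \<Rightarrow> real ^ 3 ^ 3" where
  "sd_mat s S = (\<chi> i a. sd s (S a) $ i)"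

definition comb3 :: "(3 \<Rightarrow> real ^ 4 ^ 4) \<Rightarrow> real ^ 3 \<Rightarrow> real ^ 4 ^ 4" where
  "comb3 S v = (\<Sum>a\<in>UNIV. v $ a *\<^sub>R S a)"

text \<open>The span of the \<open>S a\<close> is a three-dimensional space of two-forms on which \<open>s\<close> times the
  Pfaffian is nonnegative.  The Pfaffian may vanish on some of them; what is required is that the
  projection \<open>sd s\<close> is an isomorphism of the span onto \<open>\<real>\<^sup>3\<close>.\<close>

definition semidef :: "real \<Rightarrow> (3 \<Rightarrow> real ^ 4 ^ 4) \<Rightarrow> bool" where
  "semidef s S \<longleftrightarrow> (s = 1 \<or> s = - 1) \<and> (\<forall>a. skew_mat (S a)) \<and> (\<forall>v. 0 \<le> s * pf4 (comb3 S v)) \<and> det (sd_mat s S) \<noteq> 0"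

lemma comb3_eq: "comb3 S v = v $ 1 *\<^sub>R S 1 + v $ 2 *\<^sub>R S 2 + v $ 3 *\<^sub>R S 3"
  by (simp add: comb3_def sum_3)

lemma skew_mat_comb3:
  assumes "\<And>a. skew_mat (S a)"
  shows "skew_mat (comb3 S v)"
  unfolding skew_mat_def
proof (intro allI)
  fix i j
  have sk: "S a $ i $ j = - S a $ j $ i" for a using assms[of a] unfolding skew_mat_def by (elim allE)
  show "comb3 S v $ i $ j = - comb3 S v $ j $ i"
    by (simp add: comb3_eq sk[of 1] sk[of 2] sk[of 3])
qed

lemma congr_add: "congr g (S + T) = congr g S + congr g T"
  by (simp add: vec_eq_iff congr_nth distrib_left distrib_right sum.distrib)

lemma congr_scale: "congr g (c *\<^sub>R S) = c *\<^sub>R congr g S"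
  by (simp add: vec_eq_iff congr_nth sum_distrib_left mult_ac)

lemma congr_comb3: "congr g (comb3 S v) = comb3 (\<lambda>a. congr g (S a)) v"
  by (simp only: comb3_eq congr_add congr_scale)

lemma det_nonzero_iff_ker: "det (M :: real ^ 'n ^ 'n) \<noteq> 0 \<longleftrightarrow> (\<forall>v. M *v v = 0 \<longrightarrow> v = 0)"
  by (simp only: invertible_det_nz[symmetric] invertible_left_inverse matrix_left_invertible_ker)

lemma sd_comb3: "sd s (comb3 S v) = sd_mat s S *v v"
  by (simp add: vec_eq_iff forall_3 sd_mat_def matrix_vector_mult_def comb3_def sum_3 algebra_simps)

text \<open>A form in the kernel of \<open>sd\<close> has Pfaffian of the sign opposite to \<open>s\<close> unless it vanishes,
  so \<open>sd\<close> stays injective on a semidefinite space after any invertible change of frame.\<close>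

lemma sd_eq_0_semidef:
  assumes "s = 1 \<or> s = - 1" "skew_mat S" "0 \<le> s * pf4 S" "sd s S = 0"
  shows "S = 0"
proof -
  have 0: "sd s S $ 1 = 0" "sd s S $ 2 = 0" "sd s S $ 3 = 0" using assms(4) by (simp_all del: sd_nth)
  have eq: "S $ 1 $ 2 = - (s * S $ 3 $ 4)" "S $ 1 $ 3 = s * S $ 2 $ 4" "S $ 1 $ 4 = - (s * S $ 2 $ 3)"
    using 0 unfolding sd_nth by linarith+
  have "s * pf4 S = - ((S $ 3 $ 4)\<^sup>2 + (S $ 2 $ 4)\<^sup>2 + (S $ 2 $ 3)\<^sup>2)"
    using assms(1) by (elim disjE) (simp_all add: pf4_def eq power2_eq_square)
  then have "(S $ 3 $ 4)\<^sup>2 \<le> 0" "(S $ 2 $ 4)\<^sup>2 \<le> 0" "(S $ 2 $ 3)\<^sup>2 \<le> 0"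
    using assms(3) zero_le_power2[of "S $ 3 $ 4"] zero_le_power2[of "S $ 2 $ 4"] zero_le_power2[of "S $ 2 $ 3"]
    by linarith+
  then have "S $ 3 $ 4 = 0" "S $ 2 $ 4 = 0" "S $ 2 $ 3 = 0" by simp_all
  then show ?thesis
    by (simp add: vec_eq_iff forall_4 skew_mat_nth[OF assms(2)] eq)
qed

lemma semidef_congr:
  assumes "semidef s S" "det g \<noteq> 0"
  shows "semidef (s * sgn (det g)) (\<lambda>a. congr g (S a))"
proof -
  let ?s = "s * sgn (det g)"
  have s: "s = 1 \<or> s = - 1" and sk: "\<And>a. skew_mat (S a)" and nn: "\<And>v. 0 \<le> s * pf4 (comb3 S v)"
    and nz: "det (sd_mat s S) \<noteq> 0" using assms(1) by (auto simp: semidef_def)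
  have s': "?s = 1 \<or> ?s = - 1" using s assms(2) by (auto simp: sgn_if)
  have pf: "?s * pf4 (congr g (comb3 S v)) = \<bar>det g\<bar> * (s * pf4 (comb3 S v))" for v
    unfolding pf4_congr[OF skew_mat_comb3[OF sk]] by (simp add: sgn_if abs_if)
  have nn': "0 \<le> ?s * pf4 (congr g (comb3 S v))" for v unfolding pf using nn by simp
  have "det (sd_mat ?s (\<lambda>a. congr g (S a))) \<noteq> 0"
  proof
    assume "det (sd_mat ?s (\<lambda>a. congr g (S a))) = 0"
    then obtain v where v: "sd_mat ?s (\<lambda>a. congr g (S a)) *v v = 0" "v \<noteq> 0"
      using det_nonzero_iff_ker by blast
    then have "sd ?s (congr g (comb3 S v)) = 0" by (simp add: congr_comb3 sd_comb3)
    then have 0: "congr g (comb3 S v) = 0"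
      by (intro sd_eq_0_semidef[OF s' skew_mat_congr[OF skew_mat_comb3[OF sk]] nn'])
    obtain h where h: "h ** g = mat 1" using assms(2) by (metis invertible_def invertible_det_nz)
    have "comb3 S v = congr h (congr g (comb3 S v))" by (simp add: h congr_one flip: congr_mult)
    also have "\<dots> = 0" unfolding 0 by (simp add: vec_eq_iff congr_nth)
    finally have "sd_mat s S *v v = 0" by (simp add: vec_eq_iff forall_3 flip: sd_comb3)
    then show False using nz v(2) det_nonzero_iff_ker by blast
  qed
  then show ?thesis
    using s' sk nn' by (simp add: semidef_def skew_mat_congr flip: congr_comb3)
qed

lemma semidef_path:
  fixes g :: "real \<Rightarrow> real ^ 4 ^ 4"
  assumes S: "semidef s S" and cont: "\<And>i j. continuous_on {0..1} (\<lambda>t. g t $ i $ j)"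
    and nz: "\<And>t. 0 \<le> t \<Longrightarrow> t \<le> 1 \<Longrightarrow> det (g t) \<noteq> 0"
    and sg: "\<And>t. 0 \<le> t \<Longrightarrow> t \<le> 1 \<Longrightarrow> sgn (det (g t)) = e"
  shows "det (sd_mat (s * e) (\<lambda>a. congr (g 0) (S a))) * det (sd_mat (s * e) (\<lambda>a. congr (g 1) (S a))) > 0"
proof (rule sign_preserved_on_path[where f = "\<lambda>t. det (sd_mat (s * e) (\<lambda>a. congr (g t) (S a)))"])
  have c: "continuous_on {0..1} (\<lambda>t. congr (g t) (S a) $ i $ j)" for a i j
    unfolding congr_nth by (intro continuous_on_sum continuous_on_mult continuous_on_const cont)
  have "continuous_on {0..1} (\<lambda>t. sd (s * e) (congr (g t) (S a)) $ i)" for a i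
    using exhaust_3[of i]
    by (elim disjE)
      (simp_all add: continuous_on_add continuous_on_diff continuous_on_mult continuous_on_const c)
  then show "continuous_on {0..1} (\<lambda>t. det (sd_mat (s * e) (\<lambda>a. congr (g t) (S a))))"
    by (intro continuous_on_det) (simp add: sd_mat_def)
  show "det (sd_mat (s * e) (\<lambda>a. congr (g t) (S a))) \<noteq> 0" if "0 \<le> t" "t \<le> 1" for t
    using semidef_congr[OF S nz[OF that]] sg[OF that] by (simp add: semidef_def)
qed

text \<open>The sign of the determinant of \<open>sd\<close> on a semidefinite space changes with the frame
  by the sign of \<open>det g\<close>.  Both sides are multiplicative in \<open>g\<close>; shears and positive diagonal
  matrices are joined to the identity by paths along which the determinant cannot vanish.\<close>

lemma sd_mat_congr_sign:
  assumes "semidef s S" "det g \<noteq> 0"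
  shows "det (sd_mat (s * sgn (det g)) (\<lambda>a. congr g (S a))) * det g * det (sd_mat s S) > 0"
proof -
  have "\<forall>s S. semidef s S \<longrightarrow> det g \<noteq> 0 \<longrightarrow>
      det (sd_mat (s * sgn (det g)) (\<lambda>a. congr g (S a))) * det g * det (sd_mat s S) > 0"
  proof (induction g rule: induct_matrix_elementary_alt)
    case (1 A B)
    show ?case
    proof (intro allI impI)
      fix s and S :: "3 \<Rightarrow> real ^ 4 ^ 4" assume S: "semidef s S" and nz: "det (A ** B) \<noteq> 0"
      then have nzA: "det A \<noteq> 0" and nzB: "det B \<noteq> 0" by (simp_all add: det_mul)
      let ?s = "s * sgn (det B)" and ?S = "\<lambda>a. congr B (S a)"
      have b: "det (sd_mat ?s ?S) * det B * det (sd_mat s S) > 0" using 1(2) S nzB by blast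
      have a: "det (sd_mat (?s * sgn (det A)) (\<lambda>a. congr A (?S a))) * det A * det (sd_mat ?s ?S) > 0"
        using 1(1) semidef_congr[OF S nzB] nzA by blast
      have eq: "s * sgn (det (A ** B)) = ?s * sgn (det A)" by (simp add: det_mul sgn_mult)
      have "0 < (det (sd_mat (?s * sgn (det A)) (\<lambda>a. congr A (?S a))) * det A * det (sd_mat ?s ?S))
          * (det (sd_mat ?s ?S) * det B * det (sd_mat s S))" by (rule mult_pos_pos[OF a b])
      also have "\<dots> = (det (sd_mat ?s ?S))\<^sup>2 * (det (sd_mat (s * sgn (det (A ** B))) (\<lambda>a. congr (A ** B) (S a)))
          * det (A ** B) * det (sd_mat s S))"
        unfolding eq by (simp add: congr_mult det_mul power2_eq_square mult_ac)
      finally show "det (sd_mat (s * sgn (det (A ** B))) (\<lambda>a. congr (A ** B) (S a))) * det (A ** B) * det (sd_mat s S) > 0"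
        by (simp add: zero_less_mult_iff)
    qed
  next
    case (2 A i)
    then show ?case using det_zero_row(2)[OF 2] by simp
  next
    case (3 A)
    show ?case
    proof (intro allI impI)
      fix s and S :: "3 \<Rightarrow> real ^ 4 ^ 4" assume S: "semidef s S" and nz: "det A \<noteq> 0"
      have prodA: "det A = A $ 1 $ 1 * A $ 2 $ 2 * A $ 3 $ 3 * A $ 4 $ 4"
        by (rule det_diagonal_4) (rule 3)
      have dA: "A $ i $ i \<noteq> 0" for i using nz exhaust_4[of i] unfolding prodA by auto
      define g :: "real \<Rightarrow> real ^ 4 ^ 4"
        where "g t = (\<chi> i j. if i = j then (1 - t) * sgn (A $ i $ i) + t * A $ i $ i else 0)" for t
      have off: "g t $ i $ j = 0" if "i \<noteq> j" for t i j using that by (simp add: g_def)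
      have sgd: "sgn (g t $ i $ i) = sgn (A $ i $ i)" if "0 \<le> t" "t \<le> 1" for t i
      proof (cases "A $ i $ i > 0")
        case True
        have "(1 - t) + t * A $ i $ i > 0"
          using that True by (cases "t = 0") (simp_all add: add_nonneg_pos)
        with True show ?thesis by (simp add: g_def)
      next
        case False
        then have neg: "A $ i $ i < 0" using dA[of i] by simp
        then have "(1 - t) + t * - A $ i $ i > 0"
          using that mult_pos_pos[of t "- A $ i $ i"] by (cases "t = 0") auto
        with neg show ?thesis by (simp add: g_def)
      qed
      have sg: "sgn (det (g t)) = sgn (det A)" if "0 \<le> t" "t \<le> 1" for t
      proof -
        have "det (g t) = g t $ 1 $ 1 * g t $ 2 $ 2 * g t $ 3 $ 3 * g t $ 4 $ 4"
          by (rule det_diagonal_4) (rule off)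
        then show ?thesis by (simp only: prodA sgn_mult sgd[OF that])
      qed
      have "det (g t) \<noteq> 0" if "0 \<le> t" "t \<le> 1" for t
        using sg[OF that] nz by (metis sgn_0_0)
      moreover have "continuous_on {0..1} (\<lambda>t. g t $ i $ j)" for i j
        by (cases "i = j") (simp_all add: g_def, intro continuous_intros)
      ultimately have path: "det (sd_mat (s * sgn (det A)) (\<lambda>a. congr (g 0) (S a)))
          * det (sd_mat (s * sgn (det A)) (\<lambda>a. congr (g 1) (S a))) > 0"
        by (intro semidef_path[OF S _ _ sg]) simp_all
      have g1: "g 1 = A" using 3 by (simp add: g_def vec_eq_iff)
      let ?e = "\<lambda>i. sgn (A $ i $ i)"
      have e: "?e i = 1 \<or> ?e i = - 1" for i using dA[of i] by (auto simp: sgn_if)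
      have c0: "congr (g 0) (S a) $ i $ j = ?e i * S a $ i $ j * ?e j" for a i j
      proof -
        have "congr (g 0) (S a) $ i $ j = g 0 $ i $ i * S a $ i $ j * g 0 $ j $ j"
          by (rule congr_diagonal) (rule off)
        then show ?thesis by (simp add: g_def)
      qed
      have sA: "sgn (det A) = ?e 1 * ?e 2 * ?e 3 * ?e 4" by (simp add: prodA sgn_mult)
      have "det (sd_mat (s * sgn (det A)) (\<lambda>a. congr (g 0) (S a))) = sgn (det A) * det (sd_mat s S)"
        unfolding sA det_3 sd_mat_def
        using e[of 1] e[of 2] e[of 3] e[of 4]
        by (elim disjE) (simp_all add: c0 algebra_simps)
      then have "0 < sgn (det A) * (det (sd_mat s S) * det (sd_mat (s * sgn (det A)) (\<lambda>a. congr A (S a))))"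
        using path g1 by (simp add: mult.assoc)
      then show "det (sd_mat (s * sgn (det A)) (\<lambda>a. congr A (S a))) * det A * det (sd_mat s S) > 0"
        using nz by (cases "det A > 0") (auto simp: zero_less_mult_iff mult_less_0_iff sgn_if split: if_splits)
    qed
  next
    case (4 k l)
    show ?case unfolding swap_mat_def[symmetric]
    proof (intro allI impI)
      fix s and S :: "3 \<Rightarrow> real ^ 4 ^ 4" assume S: "semidef s S"
      then have sk: "skew_mat (S a)" for a by (simp add: semidef_def)
      have "s = 1 \<or> s = - 1" using S by (simp add: semidef_def)
      then have "det (sd_mat (- s) (\<lambda>a. congr (swap_mat k l) (S a))) = - det (sd_mat s S)"
        using exhaust_4[of k] exhaust_4[of l] 4
        by (elim disjE) (simp_all add: det_3 sd_mat_def congr_swap Transposition.transpose_def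
            skew_mat_nth[OF sk] algebra_simps)
      moreover have "det (sd_mat s S) \<noteq> 0" using S by (simp add: semidef_def)
      ultimately show "det (sd_mat (s * sgn (det (swap_mat k l))) (\<lambda>a. congr (swap_mat k l) (S a)))
          * det (swap_mat k l) * det (sd_mat s S) > 0"
        by (simp add: det_swap_mat[OF 4] flip: power2_eq_square)
    qed
  next
    case (5 k l)
    show ?case unfolding shear_mat_def[symmetric]
    proof (intro allI impI)
      fix s and S :: "3 \<Rightarrow> real ^ 4 ^ 4" assume S: "semidef s S"
      have "continuous_on {0..1} (\<lambda>t. shear_path k l t $ i $ j)" for i j
        unfolding shear_path_def vec_lambda_beta
        by (cases "i = k \<and> j = l") (simp_all only: simp_thms if_True if_False continuous_on_id continuous_on_const)
      then have "det (sd_mat (s * 1) (\<lambda>a. congr (shear_path k l 0) (S a)))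
          * det (sd_mat (s * 1) (\<lambda>a. congr (shear_path k l 1) (S a))) > 0"
        by (intro semidef_path[OF S]) (simp_all add: det_shear_path[OF 5])
      then show "det (sd_mat (s * sgn (det (shear_mat k l))) (\<lambda>a. congr (shear_mat k l) (S a)))
          * det (shear_mat k l) * det (sd_mat s S) > 0"
        using det_shear_path[OF 5, of 1] by (simp add: shear_path_0[OF 5] shear_path_1 congr_one mult.commute)
    qed
  qed
  with assms show ?thesis by blast
qed

section \<open>Frames adapted to an alternating form\<close>

context alternating_form
begin

lemmas wedge_power_hyperbolic = wedge_power_hyperbolic[where \<eta> = \<eta>, OF skew]
lemmas wedge_power_1 = wedge_power_1[where \<eta> = \<eta>, OF skew]
lemmas wedge_power_2 = wedge_power_2[where \<eta> = \<eta>, OF skew]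

text \<open>Pairing with the partner of a basis vector reads off its coefficient.\<close>

lemma hyperbolic_coefficient:
  assumes "hyperbolic_from \<eta> a m v" "a \<le> i" "i < m"
  shows "\<eta> (\<Sum>l<2 * m. c l *\<^sub>R v l) (v (2 * i + 1)) = c (2 * i) * \<eta> (v (2 * i)) (v (2 * i + 1))"
    and "\<eta> (\<Sum>l<2 * m. c l *\<^sub>R v l) (v (2 * i)) = - c (2 * i + 1) * \<eta> (v (2 * i)) (v (2 * i + 1))"
proof -
  have orth: "\<eta> (v j) (v k) = 0" if "j < k" "2 * a \<le> k" "k < 2 * m" "\<not> (even j \<and> k = Suc j)" for j k
    using assms(1) that unfolding hyperbolic_from_def by blast
  have o1: "\<eta> (v l) (v (2 * i + 1)) = 0" if "l < 2 * m" "l \<noteq> 2 * i" for l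
  proof (cases "l < 2 * i + 1")
    case True then show ?thesis using that assms by (intro orth) auto
  next
    case False
    show ?thesis
    proof (cases "l = 2 * i + 1")
      case True then show ?thesis by simp
    next
      case ne: False
      have "\<eta> (v (2 * i + 1)) (v l) = 0" using that assms ne \<open>\<not> l < 2 * i + 1\<close> by (intro orth) auto
      then show ?thesis using skew[of "v l" "v (2 * i + 1)"] by simp
    qed
  qed
  have o2: "\<eta> (v l) (v (2 * i)) = 0" if "l < 2 * m" "l \<noteq> 2 * i + 1" for l
  proof (cases "l < 2 * i")
    case True
    have "\<not> (even l \<and> 2 * i = Suc l)" by presburger
    then show ?thesis using True that assms by (intro orth) auto
  next
    case False
    show ?thesis
    proof (cases "l = 2 * i")
      case True then show ?thesis by simp
    next
      case ne: False
      have "\<eta> (v (2 * i)) (v l) = 0" using that assms ne \<open>\<not> l < 2 * i\<close> by (intro orth) auto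
      then show ?thesis using skew[of "v l" "v (2 * i)"] by simp
    qed
  qed
  have "\<eta> (\<Sum>l<2 * m. c l *\<^sub>R v l) (v (2 * i + 1)) = (\<Sum>l<2 * m. c l * \<eta> (v l) (v (2 * i + 1)))"
    by (simp add: sum_left scale_left)
  also have "\<dots> = (\<Sum>l\<in>{2 * i}. c l * \<eta> (v l) (v (2 * i + 1)))"
    by (rule sum.mono_neutral_right) (use assms(3) o1 in auto)
  finally show "\<eta> (\<Sum>l<2 * m. c l *\<^sub>R v l) (v (2 * i + 1)) = c (2 * i) * \<eta> (v (2 * i)) (v (2 * i + 1))" by simp
  have "\<eta> (\<Sum>l<2 * m. c l *\<^sub>R v l) (v (2 * i)) = (\<Sum>l<2 * m. c l * \<eta> (v l) (v (2 * i)))"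
    by (simp add: sum_left scale_left)
  also have "\<dots> = (\<Sum>l\<in>{2 * i + 1}. c l * \<eta> (v l) (v (2 * i)))"
    by (rule sum.mono_neutral_right) (use assms(3) o2 in auto)
  also have "\<dots> = - c (2 * i + 1) * \<eta> (v (2 * i)) (v (2 * i + 1))"
    using skew[of "v (2 * i + 1)" "v (2 * i)"] by simp
  finally show "\<eta> (\<Sum>l<2 * m. c l *\<^sub>R v l) (v (2 * i)) = - c (2 * i + 1) * \<eta> (v (2 * i)) (v (2 * i + 1))" .
qed

lemma hyperbolic_coefficients_0:
  assumes "hyperbolic_from \<eta> a m v" "\<And>w. \<eta> (\<Sum>l<2 * m. c l *\<^sub>R v l) w = 0" "2 * a \<le> l" "l < 2 * m"
  shows "c l = 0"
proof -
  let ?i = "l div 2"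
  have i: "a \<le> ?i" "?i < m" using assms(3,4) by auto
  have "\<eta> (v (2 * ?i)) (v (2 * ?i + 1)) > 0" using assms(1) i unfolding hyperbolic_from_def by blast
  then have "c (2 * ?i) = 0" "c (2 * ?i + 1) = 0"
    using hyperbolic_coefficient[OF assms(1) i, of c] assms(2) by auto
  moreover have "l = 2 * ?i \<or> l = 2 * ?i + 1" by presburger
  ultimately show ?thesis by metis
qed

end

text \<open>Darboux bases of a subspace, found by splitting off one hyperbolic pair at a time.\<close>

lemma hyperbolic_basis:
  fixes \<eta> :: "'v::euclidean_space \<Rightarrow> 'v \<Rightarrow> real"
  assumes "alternating_form \<eta>" "subspace U"
  shows "\<exists>r c. (\<forall>i. c i \<in> U) \<and> hyperbolic_from \<eta> 0 r c \<and>
    (\<forall>u\<in>U. \<exists>a z. z \<in> U \<and> (\<forall>w\<in>U. \<eta> z w = 0) \<and> u = (\<Sum>i<2 * r. a i *\<^sub>R c i) + z)"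
  using assms(2)
proof (induction "dim U" arbitrary: U rule: less_induct)
  case less
  interpret alternating_form \<eta> by fact
  show ?case
  proof (cases "\<forall>u\<in>U. \<forall>w\<in>U. \<eta> u w = 0")
    case True
    then show ?thesis
      using subspace_0[OF less.prems]
      by (intro exI[of _ "0::nat"] exI[of _ "\<lambda>_. 0::'v"]) (simp add: hyperbolic_from_def)
  next
    case False
    then obtain a b' where ab': "a \<in> U" "b' \<in> U" "\<eta> a b' \<noteq> 0" by blast
    define b where "b = (1 / \<eta> a b') *\<^sub>R b'"
    have b: "b \<in> U" "\<eta> a b = 1" "\<eta> b a = - 1"
      using ab' subspace_scale[OF less.prems] skew[of b a] by (auto simp: b_def scale_right)
    define U' where "U' = {u \<in> U. \<eta> u a = 0 \<and> \<eta> u b = 0}"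
    have sub: "subspace U'"
      using less.prems unfolding subspace_def U'_def by (auto simp: add_left scale_left)
    have "dim U' < dim U"
    proof (rule ccontr)
      assume "\<not> dim U' < dim U"
      then have "U' = U" by (intro subspace_dim_equal[OF sub less.prems]) (auto simp: U'_def)
      then have "a \<in> U'" using ab'(1) by simp
      then show False using b(2) by (simp add: U'_def)
    qed
    from less.hyps[OF this sub] obtain r c where c: "\<forall>i. c i \<in> U'" "hyperbolic_from \<eta> 0 r c"
      "\<forall>u\<in>U'. \<exists>f z. z \<in> U' \<and> (\<forall>w\<in>U'. \<eta> z w = 0) \<and> u = (\<Sum>i<2 * r. f i *\<^sub>R c i) + z"
      by blast
    define d where "d i = (if i = 0 then a else if i = 1 then b else c (i - 2))" for i :: nat
    have d2: "d (Suc (Suc i)) = c i" and d0: "d 0 = a" and d1: "d (Suc 0) = b" for i by (simp_all add: d_def)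
    have cU: "c i \<in> U" "\<eta> (c i) a = 0" "\<eta> (c i) b = 0" "\<eta> a (c i) = 0" "\<eta> b (c i) = 0" for i
      using c(1) skew[of a "c i"] skew[of b "c i"] by (auto simp: U'_def)
    have proj: "u - \<eta> u b *\<^sub>R a + \<eta> u a *\<^sub>R b \<in> U'" if "u \<in> U" for u
      using that ab'(1) b less.prems
      by (auto simp: U'_def add_left diff_left scale_left subspace_add subspace_diff subspace_scale)
    have hyp: "hyperbolic_from \<eta> 0 (Suc r) d"
      unfolding hyperbolic_from_def
    proof (intro conjI allI impI)
      fix j k :: nat assume jk: "j < k" "k < 2 * Suc r" "\<not> (even j \<and> k = Suc j)"
      show "\<eta> (d j) (d k) = 0"
      proof (cases "j = 0 \<or> j = 1")
        case True
        then obtain k' where "k = Suc (Suc k')" using jk by (cases k; cases "k - 1") auto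
        then show ?thesis using True cU by (auto simp: d2 d0 d1)
      next
        case False
        then obtain j' k' where e: "j = Suc (Suc j')" "k = Suc (Suc k')"
          using jk by (metis One_nat_def less_nat_zero_code not0_implies_Suc not_less_eq)
        have "\<eta> (c j') (c k') = 0" using c(2) jk unfolding hyperbolic_from_def e by simp
        then show ?thesis by (simp add: e d2)
      qed
    next
      fix i :: nat assume "i < Suc r"
      then show "\<eta> (d (2 * i)) (d (2 * i + 1)) > 0"
        using c(2) b(2) by (cases i) (simp_all add: d0 d1 d2 hyperbolic_from_def)
    qed
    have dec: "\<exists>f z. z \<in> U \<and> (\<forall>w\<in>U. \<eta> z w = 0) \<and> u = (\<Sum>i<2 * Suc r. f i *\<^sub>R d i) + z" if uU: "u \<in> U" for u
    proof -
      obtain f z where fz: "z \<in> U'" "\<forall>w\<in>U'. \<eta> z w = 0"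
        "u - \<eta> u b *\<^sub>R a + \<eta> u a *\<^sub>R b = (\<Sum>i<2 * r. f i *\<^sub>R c i) + z"
        using c(3) proj[OF uU] by blast
      define f' where "f' i = (if i = 0 then \<eta> u b else if i = 1 then - \<eta> u a else f (i - 2))" for i :: nat
      have S: "(\<Sum>i<2 * Suc r. f' i *\<^sub>R d i) = \<eta> u b *\<^sub>R a - \<eta> u a *\<^sub>R b + (\<Sum>i<2 * r. f i *\<^sub>R c i)"
        by (simp add: sum.lessThan_Suc_shift f'_def d_def del: sum.lessThan_Suc)
      have "u = \<eta> u b *\<^sub>R a - \<eta> u a *\<^sub>R b + (u - \<eta> u b *\<^sub>R a + \<eta> u a *\<^sub>R b)" by simp
      also have "\<dots> = (\<Sum>i<2 * Suc r. f' i *\<^sub>R d i) + z" unfolding fz(3) S by (simp only: add.assoc)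
      finally have "u = (\<Sum>i<2 * Suc r. f' i *\<^sub>R d i) + z" .
      moreover have "\<eta> z w = 0" if "w \<in> U" for w
      proof -
        have "\<eta> z (w - \<eta> w b *\<^sub>R a + \<eta> w a *\<^sub>R b) = 0" using fz(2) proj[OF that] by blast
        then show ?thesis using fz(1) by (simp add: U'_def add_right diff_right scale_right)
      qed
      ultimately show ?thesis using fz(1) by (auto simp: U'_def)
    qed
    have "d i \<in> U" for i using ab'(1) b(1) cU(1) by (simp add: d_def)
    with hyp dec show ?thesis by blast
  qed
qed

text \<open>The basis misses \<open>U\<close> only by the radical of \<open>\<eta>\<close> on \<open>U\<close>, which bounds the rank from below.\<close>

lemma hyperbolic_basis_dim:
  fixes \<eta> :: "'v::euclidean_space \<Rightarrow> 'v \<Rightarrow> real"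
  assumes "alternating_form \<eta>" "subspace U"
  obtains r c where "\<And>i. c i \<in> U" "hyperbolic_from \<eta> 0 r c"
    "dim U \<le> 2 * r + dim {z \<in> U. \<forall>w\<in>U. \<eta> z w = 0}"
proof -
  let ?R = "{z \<in> U. \<forall>w\<in>U. \<eta> z w = 0}"
  obtain r c where c: "\<forall>i. c i \<in> U" "hyperbolic_from \<eta> 0 r c"
    "\<forall>u\<in>U. \<exists>a z. z \<in> U \<and> (\<forall>w\<in>U. \<eta> z w = 0) \<and> u = (\<Sum>i<2 * r. a i *\<^sub>R c i) + z"
    using hyperbolic_basis[OF assms] by blast
  obtain B where B: "B \<subseteq> ?R" "independent B" "?R \<subseteq> span B" "card B = dim ?R" using basis_exists by blast
  have fin: "finite B" using B(2) independent_imp_finite by blast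
  have "U \<subseteq> span (c ` {..<2 * r} \<union> B)"
  proof
    fix u assume "u \<in> U"
    then obtain a z where z: "z \<in> ?R" "u = (\<Sum>i<2 * r. a i *\<^sub>R c i) + z" using c(3) by blast
    have "z \<in> span (c ` {..<2 * r} \<union> B)" using z(1) B(3) span_mono[of B "c ` {..<2 * r} \<union> B"] by blast
    moreover have "(\<Sum>i<2 * r. a i *\<^sub>R c i) \<in> span (c ` {..<2 * r} \<union> B)"
      by (intro span_sum span_scale span_base) simp
    ultimately show "u \<in> span (c ` {..<2 * r} \<union> B)" unfolding z(2) by (intro span_add)
  qed
  then have "dim U \<le> card (c ` {..<2 * r} \<union> B)" using fin by (intro dim_le_card) simp_all
  also have "\<dots> \<le> card (c ` {..<2 * r}) + card B" by (rule card_Un_le)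
  also have "\<dots> \<le> 2 * r + dim ?R" using card_image_le[of "{..<2 * r}" c] B(4) by simp
  finally show thesis using that c(1,2) by blast
qed

text \<open>The enumeration of the coordinates, and with it the frame matrix, are those by which
  \<open>oriented_frame\<close> is defined.\<close>

definition idx :: "'k::{finite,linorder} \<Rightarrow> nat" where
  "idx j = card {k. k < j}"

definition frame_mat :: "(nat \<Rightarrow> (real, 'k::{finite,linorder}) vec) \<Rightarrow> ((real, 'k) vec, 'k) vec" where
  "frame_mat v = (\<chi> i j. v (idx j) $ i)"

abbreviation unidx :: "nat \<Rightarrow> 'k::{finite,linorder}" where
  "unidx \<equiv> inv_into UNIV idx"

lemma bij_idx: "bij_betw idx (UNIV :: 'k::{finite,linorder} set) {..<CARD('k)}"
proof -
  have mono: "idx i < idx j" if "i < j" for i j :: 'k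
    unfolding idx_def by (rule psubset_card_mono) (use that in auto)
  have "inj (idx :: 'k \<Rightarrow> nat)"
    by (rule injI) (metis mono less_irrefl linorder_less_linear)
  moreover have "idx j < CARD('k)" for j :: 'k
    unfolding idx_def by (rule psubset_card_mono) auto
  then have "range (idx :: 'k \<Rightarrow> nat) \<subseteq> {..<CARD('k)}" by auto
  ultimately show ?thesis
    by (simp add: bij_betw_def card_image card_subset_eq)
qed

lemma idx_unidx: "i < CARD('k) \<Longrightarrow> idx (unidx i :: 'k::{finite,linorder}) = i"
  using bij_betw_inv_into_right[OF bij_idx] by blast

lemma idx_less: "idx (j :: 'k::{finite,linorder}) < CARD('k)"
  using bij_betwE[OF bij_idx] by auto

lemma unidx_idx: "unidx (idx k) = (k :: 'k::{finite,linorder})"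
  using bij_betw_inv_into_left[OF bij_idx] by blast

lemma bij_unidx: "bij_betw unidx {..<CARD('k)} (UNIV :: 'k::{finite,linorder} set)"
  by (rule bij_betw_inv_into[OF bij_idx])

lemma frame_mat_mult:
  "frame_mat v *v x = (\<Sum>i<CARD('k). x $ unidx i *\<^sub>R v i)" for v :: "nat \<Rightarrow> (real, 'k::{finite,linorder}) vec"
proof -
  have "frame_mat v *v x = (\<Sum>j\<in>UNIV. x $ j *\<^sub>R v (idx j))"
    by (simp add: vec_eq_iff matrix_vector_mult_def frame_mat_def mult.commute)
  also have "\<dots> = (\<Sum>i<CARD('k). x $ unidx i *\<^sub>R v (idx (unidx i :: 'k)))"
    by (rule sum.reindex_bij_betw[OF bij_unidx, symmetric])
  finally show ?thesis by (simp add: idx_unidx)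
qed

lemma det_frame_mat_nonzero_iff:
  fixes v :: "nat \<Rightarrow> (real, 'k::{finite,linorder}) vec"
  shows "det (frame_mat v) \<noteq> 0 \<longleftrightarrow>
    (\<forall>a. (\<Sum>i<CARD('k). a i *\<^sub>R v i) = 0 \<longrightarrow> (\<forall>i<CARD('k). a i = 0))"
proof
  assume nz: "det (frame_mat v) \<noteq> 0"
  show "\<forall>a. (\<Sum>i<CARD('k). a i *\<^sub>R v i) = 0 \<longrightarrow> (\<forall>i<CARD('k). a i = 0)"
  proof (intro allI impI)
    fix a :: "nat \<Rightarrow> real" and i assume 0: "(\<Sum>i<CARD('k). a i *\<^sub>R v i) = 0" and i: "i < CARD('k)"
    have "frame_mat v *v (\<chi> j. a (idx j)) = 0" using 0 by (simp add: frame_mat_mult idx_unidx)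
    then have "(\<chi> j. a (idx j)) = (0 :: (real, 'k) vec)" using nz det_nonzero_iff_ker by blast
    then have "(\<chi> j. a (idx j)) $ (unidx i :: 'k) = 0" by simp
    then show "a i = 0" by (simp add: idx_unidx[OF i])
  qed
next
  assume indep: "\<forall>a. (\<Sum>i<CARD('k). a i *\<^sub>R v i) = 0 \<longrightarrow> (\<forall>i<CARD('k). a i = 0)"
  have "x = 0" if "frame_mat v *v x = 0" for x
  proof -
    have z: "\<forall>i<CARD('k). x $ unidx i = 0" using indep[rule_format, of "\<lambda>i. x $ unidx i"] that by (simp add: frame_mat_mult)
    have "x $ j = 0" for j
      using z[rule_format, OF idx_less[of j]] by (simp add: unidx_idx)
    then show ?thesis by (simp add: vec_eq_iff)
  qed
  then show "det (frame_mat v) \<noteq> 0" using det_nonzero_iff_ker by blast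
qed

lemma frame_coordinates:
  fixes v :: "nat \<Rightarrow> (real, 'k::{finite,linorder}) vec"
  assumes "det (frame_mat v) \<noteq> 0"
  obtains l where "\<And>i. linear (l i)" "\<And>u. u = (\<Sum>i<CARD('k). l i u *\<^sub>R v i)"
    "\<And>i j. i < CARD('k) \<Longrightarrow> j < CARD('k) \<Longrightarrow> l i (v j) = of_bool (i = j)"
proof -
  obtain B where B: "frame_mat v ** B = mat 1"
    using assms by (metis invertible_def invertible_det_nz)
  define l where "l i u = (B *v u) $ unidx i" for i u
  have lin: "linear (l i)" for i
    by (rule linearI) (simp_all add: l_def matrix_vector_right_distrib matrix_vector_mult_scaleR)
  have rep: "u = (\<Sum>i<CARD('k). l i u *\<^sub>R v i)" for u
  proof -
    have "u = frame_mat v *v (B *v u)" by (simp add: matrix_vector_mul_assoc B)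
    then show ?thesis by (simp add: frame_mat_mult l_def)
  qed
  have "l i (v j) = of_bool (i = j)" if ij: "i < CARD('k)" "j < CARD('k)" for i j
  proof -
    have "(\<Sum>i<CARD('k). of_bool (i = j) *\<^sub>R v i) = (\<Sum>i\<in>{j}. of_bool (i = j) *\<^sub>R v i)"
      by (rule sum.mono_neutral_right) (use ij in auto)
    then have "(\<Sum>i<CARD('k). (l i (v j) - of_bool (i = j)) *\<^sub>R v i) = 0"
      using rep[of "v j"] by (simp add: scaleR_diff_left sum_subtractf)
    from assms[unfolded det_frame_mat_nonzero_iff, rule_format, OF this ij(1)] show ?thesis by simp
  qed
  with lin rep that show thesis by blast
qed

lemma sum_lessThan_zero_beyond:
  fixes f :: "nat \<Rightarrow> 'v::real_vector"
  assumes "a \<le> N" "\<And>i. a \<le> i \<Longrightarrow> i < N \<Longrightarrow> f i = 0"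
  shows "(\<Sum>i<N. f i) = (\<Sum>i<a. f i)"
  by (rule sum.mono_neutral_right) (use assms in auto)

lemma hyperbolic_frame_det:
  fixes v :: "nat \<Rightarrow> (real, 'k::{finite,linorder}) vec"
  assumes "alternating_form \<eta>" "CARD('k) = 2 * n" "2 \<le> n" "hyperbolic_from \<eta> 2 n v"
    and rad: "\<And>j w. j < 4 \<Longrightarrow> \<eta> (v j) w = 0"
    and indep: "\<And>a. (\<Sum>j<4. a j *\<^sub>R v j) = 0 \<Longrightarrow> \<forall>j<4. a j = (0::real)"
  shows "det (frame_mat v) \<noteq> 0"
  unfolding det_frame_mat_nonzero_iff
proof (intro allI impI)
  interpret alternating_form \<eta> by fact
  fix a :: "nat \<Rightarrow> real" and i assume 0: "(\<Sum>i<CARD('k). a i *\<^sub>R v i) = 0" and i: "i < CARD('k)"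
  have large: "a l = 0" if "4 \<le> l" "l < 2 * n" for l
    by (rule hyperbolic_coefficients_0[OF assms(4)]) (use that 0 assms(2) in simp_all)
  have "(\<Sum>i<4. a i *\<^sub>R v i) = (\<Sum>i<CARD('k). a i *\<^sub>R v i)"
    by (rule sum_lessThan_zero_beyond[symmetric]) (use assms(2,3) large in auto)
  then have "\<forall>j<4. a j = 0" using 0 by (intro indep) simp
  then show "a i = 0" using large i assms(2) by (cases "i < 4") auto
qed

lemma wedge_power_frame:
  fixes \<eta> :: "(real, 'k::{finite,linorder}) vec \<Rightarrow> (real, 'k) vec \<Rightarrow> real"
  assumes "alternating_form \<eta>" "CARD('k) = 2 * n"
  shows "wedge_power \<eta> n v = det (frame_mat v) * wedge_power \<eta> n (\<lambda>j. axis (unidx j) 1)"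
proof -
  have "v j = (\<Sum>l\<in>UNIV. transpose (frame_mat v) $ unidx j $ l *\<^sub>R axis l 1)" if "j < 2 * n" for j
  proof -
    have "idx (unidx j :: 'k) = j" using that assms(2) by (intro idx_unidx) simp
    moreover have "(\<Sum>l\<in>UNIV. x $ l *\<^sub>R axis l 1) = x" for x :: "(real, 'k) vec"
      using basis_expansion[of x] by (simp add: scalar_mult_eq_scaleR)
    ultimately show ?thesis by (simp add: transpose_def frame_mat_def)
  qed
  then have "wedge_power \<eta> n v = wedge_power \<eta> n (\<lambda>j. \<Sum>l\<in>UNIV. transpose (frame_mat v) $ unidx j $ l *\<^sub>R axis l 1)"
    by (intro wedge_power_cong) simp
  also have "\<dots> = det (transpose (frame_mat v)) * wedge_power \<eta> n (\<lambda>j. axis (unidx j) 1)"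
    by (rule alternating_form.wedge_power_top[OF assms(1)]) (use bij_unidx[where 'k = 'k] assms(2) in simp)
  finally show ?thesis by (simp add: det_transpose)
qed

text \<open>The first four entries are a basis of the kernel of \<open>\<eta>\<close>, and the remaining ones a Darboux
  basis of a complement.  The orientation of the whole frame then orients the kernel.\<close>

definition pos_frame :: "nat \<Rightarrow> ((real, 'k::{finite,linorder}) vec \<Rightarrow> (real, 'k) vec \<Rightarrow> real) \<Rightarrow> (nat \<Rightarrow> (real, 'k) vec) \<Rightarrow> bool" where
  "pos_frame n \<eta> v \<longleftrightarrow> (\<forall>j<4. \<forall>w. \<eta> (v j) w = 0) \<and> hyperbolic_from \<eta> 2 n v \<and> det (frame_mat v) > 0"

definition enum4 :: "4 \<Rightarrow> nat" where
  "enum4 i = (if i = 1 then 0 else if i = 2 then 1 else if i = 3 then 2 else 3)"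

lemma enum4_simps [simp]: "enum4 1 = 0" "enum4 2 = 1" "enum4 3 = 2" "enum4 4 = 3"
  by (simp_all add: enum4_def)

lemma enum4_less: "enum4 i < 4"
  by (simp add: enum4_def)

lemma enum4_surj: "m < 4 \<Longrightarrow> \<exists>a. enum4 a = m"
proof -
  assume "m < 4"
  then have "m = 0 \<or> m = 1 \<or> m = 2 \<or> m = 3" by linarith
  then show ?thesis using enum4_simps by blast
qed

lemma sum_enum4: "(\<Sum>i\<in>UNIV. f (enum4 i)) = (\<Sum>i<4. f i)"
  by (simp add: sum_4 eval_nat_numeral)

text \<open>A symplectic change of frame of a complement has positive determinant, so the orientation
  of the kernel does not depend on the Darboux basis.  To see this, \<open>\<eta>\<close> is made nondegenerate by a
  form \<open>\<theta>\<close> of Pfaffian one on the kernel, and the top powers of the sum on the two frames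
  are compared.\<close>

lemma pos_frame_change:
  fixes \<eta> :: "(real, 'k::{finite,linorder}) vec \<Rightarrow> (real, 'k) vec \<Rightarrow> real"
  assumes alt: "alternating_form \<eta>" and card: "CARD('k) = 2 * n" and n: "2 \<le> n"
    and v: "pos_frame n \<eta> v" and w: "pos_frame n \<eta> w"
  obtains g :: "real ^ 4 ^ 4" where "det g > 0" "\<And>i. w (enum4 i) = (\<Sum>j\<in>UNIV. g $ i $ j *\<^sub>R v (enum4 j))"
proof -
  interpret alternating_form \<eta> by fact
  have vrad: "\<And>j u. j < 4 \<Longrightarrow> \<eta> (v j) u = 0" and vhyp: "hyperbolic_from \<eta> 2 n v" and vdet: "det (frame_mat v) > 0"
    using v by (auto simp: pos_frame_def)
  have wrad: "\<And>j u. j < 4 \<Longrightarrow> \<eta> (w j) u = 0" and whyp: "hyperbolic_from \<eta> 2 n w" and wdet: "det (frame_mat w) > 0"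
    using w by (auto simp: pos_frame_def)
  have vrad': "\<And>j u. j < 4 \<Longrightarrow> \<eta> u (v j) = 0" subgoal for j u using vrad[of j u] skew[of u "v j"] by simp done
  have wrad': "\<And>j u. j < 4 \<Longrightarrow> \<eta> u (w j) = 0" subgoal for j u using wrad[of j u] skew[of u "w j"] by simp done
  obtain l where l: "\<And>i. linear (l i)" "\<And>u. u = (\<Sum>i<CARD('k). l i u *\<^sub>R v i)"
    "\<And>i j. i < CARD('k) \<Longrightarrow> j < CARD('k) \<Longrightarrow> l i (v j) = of_bool (i = j)"
    by (rule frame_coordinates[of v]) (use vdet in auto)
  note l_lin = linear_add[OF l(1)] linear_scale[OF l(1)] linear_diff[OF l(1)] linear_sum[OF l(1)]
  have rad_expand: "u = (\<Sum>i<4. l i u *\<^sub>R v i)" if "\<And>x. \<eta> u x = 0" for u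
  proof -
    have "\<eta> (\<Sum>i<2 * n. l i u *\<^sub>R v i) x = 0" for x using that l(2)[of u] card by simp
    then have "l i u = 0" if "4 \<le> i" "i < 2 * n" for i
      using hyperbolic_coefficients_0[OF vhyp, of "\<lambda>i. l i u" i] that by simp
    then have "(\<Sum>i<CARD('k). l i u *\<^sub>R v i) = (\<Sum>i<4. l i u *\<^sub>R v i)"
      using card n by (intro sum_lessThan_zero_beyond) auto
    then show ?thesis using l(2)[of u] by simp
  qed
  define g :: "real ^ 4 ^ 4" where "g = (\<chi> i j. l (enum4 j) (w (enum4 i)))"
  have wg: "w (enum4 i) = (\<Sum>j\<in>UNIV. g $ i $ j *\<^sub>R v (enum4 j))" for i
  proof -
    have "w (enum4 i) = (\<Sum>j<4. l j (w (enum4 i)) *\<^sub>R v j)" by (rule rad_expand[OF wrad[OF enum4_less]])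
    also have "\<dots> = (\<Sum>j\<in>UNIV. l (enum4 j) (w (enum4 i)) *\<^sub>R v (enum4 j))" by (rule sum_enum4[symmetric])
    finally show ?thesis by (simp add: g_def)
  qed
  define \<theta> where "\<theta> u x = l 0 u * l 1 x - l 1 u * l 0 x + (l 2 u * l 3 x - l 3 u * l 2 x)" for u x
  define \<omega> where "\<omega> u x = \<eta> u x + \<theta> u x" for u x
  have alt\<theta>: "alternating_form \<theta>"
    by unfold_locales (simp_all add: \<theta>_def l_lin algebra_simps)
  have alt\<omega>: "alternating_form \<omega>"
  proof
    fix u x y c
    show "\<omega> (u + x) y = \<omega> u y + \<omega> x y"
      by (simp add: \<omega>_def add_left alternating_form.add_left[OF alt\<theta>])
    show "\<omega> (c *\<^sub>R u) y = c * \<omega> u y"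
      by (simp add: \<omega>_def scale_left alternating_form.scale_left[OF alt\<theta>] distrib_left)
    show "\<omega> u x = - \<omega> x u"
      using skew[of u x] alternating_form.skew[OF alt\<theta>, of u x] by (simp add: \<omega>_def)
  qed
  have lv: "l 0 (v j) = of_bool (j = 0)" "l 1 (v j) = of_bool (j = 1)" "l 2 (v j) = of_bool (j = 2)" "l 3 (v j) = of_bool (j = 3)"
    if "j < 2 * n" for j using l(3)[of _ j] that card n by auto
  (* Removing from the entries of w their kernel components does not change the orientation: this can
     be done continuously, and the frame stays a basis. *)
  define wt where "wt t j = (if j < 4 then w j else w j - t *\<^sub>R (\<Sum>i<4. l i (w j) *\<^sub>R v i))" for t j
  have \<eta>wt: "\<eta> (wt t i) (wt t j) = \<eta> (w i) (w j)" for t i j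
    by (simp add: wt_def diff_left diff_right scale_left scale_right sum_left sum_right vrad vrad')
  have "det (frame_mat (wt t)) \<noteq> 0" for t
  proof (rule hyperbolic_frame_det[OF alt card n])
    show "hyperbolic_from \<eta> 2 n (wt t)" using whyp by (simp only: hyperbolic_from_def \<eta>wt)
    show "\<eta> (wt t j) x = 0" if "j < 4" for j x using that by (simp add: wt_def wrad)
    fix a :: "nat \<Rightarrow> real" assume "(\<Sum>j<4. a j *\<^sub>R wt t j) = 0"
    then have 0: "(\<Sum>j<4. a j *\<^sub>R w j) = 0" by (simp add: wt_def)
    have "(\<Sum>j<CARD('k). (if j < 4 then a j else 0) *\<^sub>R w j) = (\<Sum>j<4. (if j < 4 then a j else 0) *\<^sub>R w j)"
      using card n by (intro sum_lessThan_zero_beyond) auto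
    also have "\<dots> = 0" using 0 by simp
    finally have z: "(\<Sum>j<CARD('k). (if j < 4 then a j else 0) *\<^sub>R w j) = 0" .
    have wnz: "det (frame_mat w) \<noteq> 0" using wdet by simp
    show "\<forall>j<4. a j = 0"
    proof (intro allI impI)
      fix j :: nat assume "j < 4"
      then have "j < CARD('k)" using card n by simp
      from wnz[unfolded det_frame_mat_nonzero_iff, rule_format, OF z this] show "a j = 0"
        using \<open>j < 4\<close> by simp
    qed
  qed
  moreover have "continuous_on {0..1} (\<lambda>t. frame_mat (wt t) $ i $ j)" for i j
    by (cases "idx j < 4") (simp_all add: frame_mat_def wt_def, intro continuous_intros)
  ultimately have "det (frame_mat (wt 0)) * det (frame_mat (wt 1)) > 0"
    by (intro sign_preserved_on_path continuous_on_det)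
  moreover have "wt 0 = w" by (auto simp: wt_def)
  ultimately have wt1: "det (frame_mat (wt 1)) > 0" using wdet by (simp add: zero_less_mult_iff)
  have lwt: "l i (wt 1 j) = 0" if "i < 4" "4 \<le> j" for i j
  proof -
    have "(\<Sum>k<4. l k (w j) * l i (v k)) = (\<Sum>k\<in>{i}. l k (w j) * l i (v k))"
      by (rule sum.mono_neutral_right) (use that card n l(3)[of i] in auto)
    then show ?thesis using that card n l(3)[of i i] by (simp add: wt_def l_lin)
  qed
  have "hyperbolic_from \<omega> 2 n v"
    unfolding hyperbolic_from_def
  proof (intro conjI allI impI)
    fix j k assume *: "j < k" "2 * 2 \<le> k" "k < 2 * n" "\<not> (even j \<and> k = Suc j)"
    then have "\<eta> (v j) (v k) = 0" using vhyp unfolding hyperbolic_from_def by blast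
    then show "\<omega> (v j) (v k) = 0" using * by (simp add: \<omega>_def \<theta>_def lv del: One_nat_def)
  next
    fix i assume *: "2 \<le> i" "i < n"
    then have "\<eta> (v (2 * i)) (v (2 * i + 1)) > 0" using vhyp unfolding hyperbolic_from_def by blast
    then show "\<omega> (v (2 * i)) (v (2 * i + 1)) > 0" using * by (simp add: \<omega>_def \<theta>_def lv del: One_nat_def)
  qed
  then obtain C where C: "C > 0" "wedge_power \<omega> n v = C * wedge_power \<omega> 2 v"
    using alternating_form.wedge_power_hyperbolic[OF alt\<omega> _ n] by blast
  have "hyperbolic_from \<omega> 2 n (wt 1)"
    unfolding hyperbolic_from_def
  proof (intro conjI allI impI)
    fix j k assume *: "j < k" "2 * 2 \<le> k" "k < 2 * n" "\<not> (even j \<and> k = Suc j)"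
    then have "\<eta> (w j) (w k) = 0" using whyp unfolding hyperbolic_from_def by blast
    then show "\<omega> (wt 1 j) (wt 1 k) = 0" using * by (simp add: \<omega>_def \<theta>_def \<eta>wt lwt)
  next
    fix i assume *: "2 \<le> i" "i < n"
    then have "\<eta> (w (2 * i)) (w (2 * i + 1)) > 0" using whyp unfolding hyperbolic_from_def by blast
    then show "\<omega> (wt 1 (2 * i)) (wt 1 (2 * i + 1)) > 0" using * by (simp add: \<omega>_def \<theta>_def \<eta>wt lwt)
  qed
  then obtain C' where C': "C' > 0" "wedge_power \<omega> n (wt 1) = C' * wedge_power \<omega> 2 (wt 1)"
    using alternating_form.wedge_power_hyperbolic[OF alt\<omega> _ n] by blast
  have v2: "wedge_power \<omega> 2 v = 2"
    unfolding alternating_form.wedge_power_2[OF alt\<omega>] using n by (simp add: \<omega>_def \<theta>_def vrad lv del: One_nat_def)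
  define \<Theta> :: "real ^ 4 ^ 4" where "\<Theta> = (\<chi> i j. \<theta> (v (enum4 i)) (v (enum4 j)))"
  have "skew_mat \<Theta>" 
    unfolding skew_mat_def \<Theta>_def by (intro allI, simp only: vec_lambda_beta, rule alternating_form.skew[OF alt\<theta>])
  moreover have "pf4 \<Theta> = 1" using n by (simp add: pf4_def \<Theta>_def \<theta>_def lv del: One_nat_def)
  ultimately have "pf4 (congr g \<Theta>) = det g" by (simp add: pf4_congr)
  moreover have "congr g \<Theta> $ i $ j = \<theta> (w (enum4 i)) (w (enum4 j))" for i j
  proof -
    interpret T: alternating_form \<theta> by (rule alt\<theta>)
    have "\<theta> (w (enum4 i)) (w (enum4 j)) = (\<Sum>a\<in>UNIV. g $ i $ a * \<theta> (v (enum4 a)) (w (enum4 j)))"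
      by (subst wg[of i]) (simp only: T.sum_left T.scale_left)
    also have "\<dots> = (\<Sum>a\<in>UNIV. g $ i $ a * (\<Sum>b\<in>UNIV. g $ j $ b * \<theta> (v (enum4 a)) (v (enum4 b))))"
      by (subst wg[of j]) (simp only: T.sum_right T.scale_right)
    finally show ?thesis by (simp add: congr_nth \<Theta>_def sum_distrib_left mult_ac)
  qed
  ultimately have "wedge_power \<omega> 2 (wt 1) = 2 * det g"
    unfolding alternating_form.wedge_power_2[OF alt\<omega>] by (simp add: pf4_def \<omega>_def wt_def wrad del: One_nat_def)
  moreover have "wedge_power \<omega> n v * det (frame_mat (wt 1)) = wedge_power \<omega> n (wt 1) * det (frame_mat v)"
    unfolding wedge_power_frame[OF alt\<omega> card, of v] wedge_power_frame[OF alt\<omega> card, of "wt 1"] by simp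
  ultimately have eq: "C * 2 * det (frame_mat (wt 1)) = C' * 2 * det (frame_mat v) * det g"
    using C C' v2 by simp
  have pos: "C * 2 * det (frame_mat (wt 1)) > 0" using C(1) wt1 by simp
  have pos': "C' * 2 * det (frame_mat v) > 0" using C'(1) vdet by simp
  have "det g > 0" by (rule zero_less_mult_pos[OF pos[unfolded eq] pos'])
  then show thesis using that wg by blast
qed

section \<open>Block matrices\<close>

text \<open>The block matrix that is \<open>D\<close> on the coordinates in the range of \<open>f\<close> and the identity on the others.\<close>

definition embed_mat :: "('a \<Rightarrow> 'k) \<Rightarrow> real ^ 'a::finite ^ 'a \<Rightarrow> real ^ 'k::finite ^ 'k" where
  "embed_mat f D = (\<chi> i j. if i \<in> range f \<and> j \<in> range f then D $ inv f i $ inv f j else of_bool (i = j))"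

lemma embed_mat_mult:
  assumes "inj f"
  shows "embed_mat f (A ** B) = embed_mat f A ** embed_mat f B"
proof -
  have "embed_mat f (A ** B) $ i $ j = (embed_mat f A ** embed_mat f B) $ i $ j" for i j
  proof (cases "i \<in> range f")
    case True
    have "(embed_mat f A ** embed_mat f B) $ i $ j = (\<Sum>k\<in>range f. embed_mat f A $ i $ k * embed_mat f B $ k $ j)"
      unfolding matrix_matrix_mult_def vec_lambda_beta
      by (rule sum.mono_neutral_right) (use True in \<open>auto simp: embed_mat_def\<close>)
    also have "\<dots> = (\<Sum>a\<in>UNIV. embed_mat f A $ i $ f a * embed_mat f B $ f a $ j)"
      by (simp add: sum.reindex[OF assms])
    also have "\<dots> = embed_mat f (A ** B) $ i $ j"
    proof (cases "j \<in> range f")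
      case True
      then show ?thesis using \<open>i \<in> range f\<close> assms by (auto simp: embed_mat_def matrix_matrix_mult_def)
    next
      case False
      then have "f a \<noteq> j" "i \<noteq> j" for a using \<open>i \<in> range f\<close> by blast+
      then show ?thesis using False by (simp add: embed_mat_def)
    qed
    finally show ?thesis by simp
  next
    case False
    have "(embed_mat f A ** embed_mat f B) $ i $ j = (\<Sum>k\<in>{i}. embed_mat f A $ i $ k * embed_mat f B $ k $ j)"
      unfolding matrix_matrix_mult_def vec_lambda_beta
      by (rule sum.mono_neutral_right) (use False in \<open>auto simp: embed_mat_def\<close>)
    then show ?thesis using False by (simp add: embed_mat_def)
  qed
  then show ?thesis by (simp add: vec_eq_iff)
qed

lemma det_embed_mat:
  assumes "inj f"
  shows "det (embed_mat f D) = det D"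
proof (induction D rule: induct_matrix_elementary_alt)
  case (1 A B)
  then show ?case by (simp add: embed_mat_mult[OF assms] det_mul)
next
  case (2 A i)
  have "A $ i = 0" using 2 by (simp add: row_def vec_eq_iff)
  then have "row (f i) (embed_mat f A) = 0"
    using assms by (auto simp: row_def vec_eq_iff embed_mat_def)
  then show ?case using det_zero_row(2)[OF 2] det_zero_row(2) by metis
next
  case (3 A)
  have off: "embed_mat f A $ i $ j = 0" if "i \<noteq> j" for i j
  proof (cases "i \<in> range f \<and> j \<in> range f")
    case True
    then obtain a b where ab: "i = f a" "j = f b" by blast
    then have "A $ a $ b = 0" using that by (intro 3) auto
    then show ?thesis using assms by (simp add: ab embed_mat_def)
  next
    case False
    then show ?thesis using that by (auto simp: embed_mat_def)
  qed
  have "det (embed_mat f A) = (\<Prod>i\<in>UNIV. embed_mat f A $ i $ i)" by (rule det_diagonal) (rule off)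
  also have "\<dots> = (\<Prod>i\<in>range f. embed_mat f A $ i $ i)"
    by (rule prod.mono_neutral_right) (auto simp: embed_mat_def)
  also have "\<dots> = (\<Prod>a\<in>UNIV. A $ a $ a)"
    using assms by (simp add: prod.reindex embed_mat_def)
  also have "\<dots> = det A" by (rule det_diagonal[symmetric]) (rule 3)
  finally show ?case .
next
  case (4 m n)
  have inv: "inv f (f a) = a" for a using assms by simp
  have eq: "embed_mat f (\<chi> i j. mat 1 $ i $ Transposition.transpose m n j)
      = (\<chi> i j. mat 1 $ i $ Transposition.transpose (f m) (f n) j)"
  proof -
    have tr: "Transposition.transpose (f m) (f n) (f a) = f (Transposition.transpose m n a)" for a
      using assms by (simp add: Transposition.transpose_def inj_eq)
    have tr': "Transposition.transpose (f m) (f n) j = j" if "j \<notin> range f" for j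
      using that by (auto simp: Transposition.transpose_def)
    have trr: "Transposition.transpose (f m) (f n) j \<in> range f \<longleftrightarrow> j \<in> range f" for j
      by (auto simp: Transposition.transpose_def)
    have "embed_mat f (\<chi> i j. mat 1 $ i $ Transposition.transpose m n j) $ i $ j
        = mat 1 $ i $ Transposition.transpose (f m) (f n) j" for i j
    proof (cases "j \<in> range f")
      case True
      then obtain b where b: "j = f b" by blast
      show ?thesis
      proof (cases "i \<in> range f")
        case True
        then obtain a where "i = f a" by blast
        then show ?thesis by (simp add: b embed_mat_def inv tr mat_def inj_eq[OF assms])
      next
        case False
        then have "i \<noteq> f c" for c by blast
        then show ?thesis using False by (simp add: b embed_mat_def tr mat_def)
      qed
    next
      case False
      then show ?thesis by (simp add: embed_mat_def tr' mat_def)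
    qed
    then show ?thesis by (simp add: vec_eq_iff)
  qed
  have "f m \<noteq> f n" using 4 assms by (simp add: inj_eq)
  then show ?case unfolding eq det_swap_matrix[OF 4] by (rule det_swap_matrix)
next
  case (5 m n)
  have "embed_mat f (\<chi> i j. of_bool (i = m \<and> j = n \<or> i = j)) $ i $ j = of_bool (i = f m \<and> j = f n \<or> i = j)" for i j
    using assms by (auto simp: embed_mat_def)
  then have eq: "embed_mat f (\<chi> i j. of_bool (i = m \<and> j = n \<or> i = j)) = (\<chi> i j. of_bool (i = f m \<and> j = f n \<or> i = j))"
    by (simp add: vec_eq_iff)
  have "f m \<noteq> f n" using 5 assms by (simp add: inj_eq)
  then show ?case unfolding eq det_shear_matrix[OF 5] by (rule det_shear_matrix)
qed

text \<open>A partition of the coordinates into three and the rest; \<open>join\<close> is the resulting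
  isomorphism from \<open>\<real>\<^sup>3 \<times> \<real>\<^sup>l\<close> to \<open>\<real>\<^sup>k\<close>.\<close>

definition split_index :: "(3 \<Rightarrow> 'k) \<Rightarrow> ('l \<Rightarrow> 'k) \<Rightarrow> bool" where
  "split_index p q \<longleftrightarrow> inj p \<and> inj q \<and> range p \<inter> range q = {} \<and> range p \<union> range q = UNIV"

definition join :: "(3 \<Rightarrow> 'k) \<Rightarrow> ('l \<Rightarrow> 'k) \<Rightarrow> real ^ 3 \<Rightarrow> real ^ 'l::finite \<Rightarrow> real ^ 'k::finite" where
  "join p q s z = (\<chi> i. if i \<in> range p then s $ inv p i else z $ inv q i)"

lemma join_nth:
  assumes "split_index p q"
  shows "join p q s z $ p a = s $ a" "join p q s z $ q b = z $ b"
proof -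
  show "join p q s z $ p a = s $ a" using assms by (simp add: join_def split_index_def)
  have "q b \<notin> range p" using assms unfolding split_index_def by blast
  then show "join p q s z $ q b = z $ b" using assms by (simp add: join_def split_index_def)
qed

lemma split_index_eqI:
  assumes "split_index p q" "\<And>a. x $ p a = y $ p a" "\<And>b. x $ q b = y $ q b"
  shows "x = y"
proof -
  have "x $ i = y $ i" for i
    using assms unfolding split_index_def by (metis UNIV_I UnE rangeE)
  then show ?thesis by (simp add: vec_eq_iff)
qed

lemma join_eq_iff:
  assumes "split_index p q"
  shows "join p q s z = join p q s' z' \<longleftrightarrow> s = s' \<and> z = z'"
  using join_nth[OF assms] by (metis vec_eq_iff)

lemma join_surj:
  assumes "split_index p q"
  obtains s z where "v = join p q s z"
proof
  show "v = join p q (\<chi> a. v $ p a) (\<chi> b. v $ q b)"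
    by (rule split_index_eqI[OF assms]) (simp_all add: join_nth[OF assms])
qed

lemma join_add: "join p q (s + s') (z + z') = join p q s z + join p q s' z'"
  and join_scale: "join p q (c *\<^sub>R s) (c *\<^sub>R z) = c *\<^sub>R join p q s z"
  and join_diff: "join p q (s - s') (z - z') = join p q s z - join p q s' z'"
  and join_0: "join p q 0 0 = 0"
  by (simp_all add: join_def vec_eq_iff)

lemma embed_mat_join:
  assumes "split_index p q"
  shows "embed_mat p A *v join p q s z = join p q (A *v s) z"
    and "embed_mat q T *v join p q s z = join p q s (T *v z)"
proof -
  have inj: "inj p" "inj q" and disj: "p a \<noteq> q b" "q b \<notin> range p" "p a \<notin> range q" "q b \<noteq> p a" for a b
    using assms unfolding split_index_def by blast+
  have split: "(\<Sum>i\<in>UNIV. f i) = (\<Sum>a\<in>UNIV. f (p a)) + (\<Sum>b\<in>UNIV. f (q b))" for f :: "_ \<Rightarrow> real"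
  proof -
    have "(\<Sum>i\<in>UNIV. f i) = (\<Sum>i\<in>range p \<union> range q. f i)" using assms by (simp add: split_index_def)
    also have "\<dots> = (\<Sum>i\<in>range p. f i) + (\<Sum>i\<in>range q. f i)"
      using assms by (intro sum.union_disjoint) (simp_all add: split_index_def)
    finally show ?thesis using inj by (simp add: sum.reindex)
  qed
  have delta: "(\<Sum>b\<in>UNIV. of_bool (c = b) * f b) = f c" for f :: "'d::finite \<Rightarrow> real" and c
  proof -
    have "(\<Sum>b\<in>UNIV. of_bool (c = b) * f b) = (\<Sum>b\<in>{c}. of_bool (c = b) * f b)"
      by (rule sum.mono_neutral_right) auto
    then show ?thesis by simp
  qed
  have pq: "p a \<in> range p" "q b \<in> range q" for a b by blast+
  show "embed_mat p A *v join p q s z = join p q (A *v s) z"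
    by (rule split_index_eqI[OF assms])
      (simp_all only: join_nth[OF assms] matrix_vector_mult_def vec_lambda_beta split embed_mat_def pq
        disj simp_thms if_True if_False inv_f_f[OF inj(1)] of_bool_eq mult_zero_left sum.neutral_const
        inj_eq[OF inj(2)] delta add_0_left add_0_right)
  show "embed_mat q T *v join p q s z = join p q s (T *v z)"
    by (rule split_index_eqI[OF assms])
      (simp_all only: join_nth[OF assms] matrix_vector_mult_def vec_lambda_beta split embed_mat_def pq
        disj simp_thms if_True if_False inv_f_f[OF inj(2)] of_bool_eq mult_zero_left sum.neutral_const
        inj_eq[OF inj(1)] delta add_0_left add_0_right)
qed

text \<open>A block triangular matrix has determinant \<open>det A * det T\<close>; for the sign it suffices to scale the
  off-diagonal block \<open>C\<close> continuously to zero.\<close>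

lemma det_block_pos:
  fixes B :: "real ^ 'k::finite ^ 'k" and A :: "real ^ 3 ^ 3" and T :: "real ^ 'l::finite ^ 'l"
  assumes pq: "split_index p q"
    and B: "\<And>s z. B *v join p q s z = join p q (A *v s) (T *v z + C s)"
    and "det B > 0" "det A > 0"
  shows "det T > 0"
proof -
  let ?E = "embed_mat q T ** embed_mat p A"
  have E: "?E *v join p q s z = join p q (A *v s) (T *v z)" for s z
    by (simp add: embed_mat_join[OF pq] flip: matrix_vector_mul_assoc)
  define M where "M t = ?E + t *\<^sub>R (B - ?E)" for t :: real
  have M: "M t *v join p q s z = join p q (A *v s) (T *v z + t *\<^sub>R C s)" for t s z
  proof -
    have "M t *v join p q s z = join p q (A *v s) (T *v z) + t *\<^sub>R (join p q (A *v s) (T *v z + C s) - join p q (A *v s) (T *v z))"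
      by (simp add: M_def matrix_vector_mult_add_rdistrib matrix_vector_mult_diff_rdistrib E B
          flip: scaleR_matrix_vector_assoc)
    also have "\<dots> = join p q (A *v s) (T *v z + t *\<^sub>R C s)"
      by (simp flip: join_diff join_scale join_add)
    finally show ?thesis .
  qed
  have B0: "det B \<noteq> 0" and A0: "det A \<noteq> 0" using assms(3,4) by auto
  have C0: "C 0 = 0"
  proof -
    have "join p q (A *v 0) (T *v 0 + C 0) = join p q 0 0"
      using B[of 0 0] by (simp add: join_0)
    then show ?thesis by (simp add: join_eq_iff[OF pq])
  qed
  have T: "z = 0" if "T *v z = 0" for z
  proof -
    have "B *v join p q 0 z = 0" using that C0 B[of 0 z] by (simp add: join_0)
    then have "join p q 0 z = join p q 0 0" using B0 det_nonzero_iff_ker[of B] by (auto simp: join_0)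
    then show ?thesis by (simp add: join_eq_iff[OF pq])
  qed
  have "det (M t) \<noteq> 0" for t
    unfolding det_nonzero_iff_ker
  proof (intro allI impI)
    fix v assume 0: "M t *v v = 0"
    obtain s z where v: "v = join p q s z" by (rule join_surj[OF pq])
    have "join p q (A *v s) (T *v z + t *\<^sub>R C s) = join p q 0 0" using 0 unfolding v M by (simp add: join_0)
    then have *: "A *v s = 0" "T *v z + t *\<^sub>R C s = 0" by (simp_all add: join_eq_iff[OF pq])
    then have "s = 0" using A0 det_nonzero_iff_ker[of A] by blast
    then have "z = 0" using *(2) C0 T by simp
    then show "v = 0" using v \<open>s = 0\<close> by (simp add: join_0)
  qed
  moreover have "continuous_on {0..1} (\<lambda>t. M t $ i $ j)" for i j
    unfolding M_def by (simp, intro continuous_intros)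
  ultimately have "det (M 0) * det (M 1) > 0" by (intro sign_preserved_on_path continuous_on_det)
  moreover have "M 1 = B" by (simp add: M_def)
  moreover have "det (M 0) = det T * det A"
    using pq by (simp add: M_def det_mul det_embed_mat split_index_def)
  ultimately show ?thesis using assms(3,4) by (simp add: zero_less_mult_iff)
qed

section \<open>The local structure of the singular locus\<close>

abbreviation E :: "'k \<Rightarrow> (real, 'k::finite) vec" where
  "E i \<equiv> axis i 1"

lemma alternating_form_expand:
  fixes \<eta> :: "(real, 'k::finite) vec \<Rightarrow> (real, 'k) vec \<Rightarrow> real"
  assumes "alternating_form \<eta>"
  shows "\<eta> u w = (\<Sum>i\<in>UNIV. \<Sum>j\<in>UNIV. u $ i * w $ j * \<eta> (E i) (E j))"
proof -
  interpret alternating_form \<eta> by fact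
  have e: "x = (\<Sum>l\<in>UNIV. x $ l *\<^sub>R E l)" for x :: "(real, 'k) vec"
    using basis_expansion[of x] by (simp add: scalar_mult_eq_scaleR)
  have "\<eta> u w = (\<Sum>i\<in>UNIV. u $ i * \<eta> (E i) w)"
    by (subst e[of u]) (simp only: sum_left scale_left)
  also have "\<dots> = (\<Sum>i\<in>UNIV. u $ i * (\<Sum>j\<in>UNIV. w $ j * \<eta> (E i) (E j)))"
    by (subst e[of w]) (simp only: sum_right scale_right)
  finally show ?thesis by (simp add: sum_distrib_left mult.assoc)
qed

text \<open>The derivative of the coefficients of a family of bilinear forms: the vectors \<open>u\<close> and \<open>w\<close> are
  parallel for the flat connection.\<close>

definition dform :: "('v::real_normed_vector \<Rightarrow> 'w \<Rightarrow> 'w \<Rightarrow> real) \<Rightarrow> 'v \<Rightarrow> 'v \<Rightarrow> 'w \<Rightarrow> 'w \<Rightarrow> real" where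
  "dform \<rho> x v u w = frechet_derivative (\<lambda>y. \<rho> y u w) (at x) v"

text \<open>The representation of a two-form in a chart with image \<open>U\<close>.\<close>

locale form_family =
  fixes U :: "(real, 'k::finite) vec set" and \<rho> :: "(real, 'k) vec \<Rightarrow> (real, 'k) vec \<Rightarrow> (real, 'k) vec \<Rightarrow> real"
  assumes open_dom: "open U"
    and alt: "x \<in> U \<Longrightarrow> alternating_form (\<rho> x)"
    and smooth_coeff: "smooth_on U (\<lambda>x. \<rho> x u w)"
begin

lemma alternating_dform:
  assumes "x \<in> U"
  shows "alternating_form (dform \<rho> x v)"
proof
  note d = smooth_on_has_derivative[OF smooth_coeff assms]
  fix u u' w :: "(real, 'k) vec" and c :: real
  have "frechet_derivative (\<lambda>y. \<rho> y (u + u') w) (at x) = frechet_derivative (\<lambda>y. \<rho> y u w + \<rho> y u' w) (at x)"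
    by (rule frechet_derivative_cong_open[OF open_dom assms]) (rule alternating_form.add_left[OF alt])
  also have "\<dots> = (\<lambda>v. frechet_derivative (\<lambda>y. \<rho> y u w) (at x) v + frechet_derivative (\<lambda>y. \<rho> y u' w) (at x) v)"
    by (rule frechet_derivative_at[symmetric]) (intro has_derivative_add d)
  finally show "dform \<rho> x v (u + u') w = dform \<rho> x v u w + dform \<rho> x v u' w" by (simp add: dform_def)
  have "frechet_derivative (\<lambda>y. \<rho> y (c *\<^sub>R u) w) (at x) = frechet_derivative (\<lambda>y. c * \<rho> y u w) (at x)"
    by (rule frechet_derivative_cong_open[OF open_dom assms]) (rule alternating_form.scale_left[OF alt])
  also have "\<dots> = (\<lambda>v. c * frechet_derivative (\<lambda>y. \<rho> y u w) (at x) v)"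
    by (rule frechet_derivative_at[symmetric]) (intro has_derivative_mult_right d)
  finally show "dform \<rho> x v (c *\<^sub>R u) w = c * dform \<rho> x v u w" by (simp add: dform_def)
  have "frechet_derivative (\<lambda>y. \<rho> y u w) (at x) = frechet_derivative (\<lambda>y. - \<rho> y w u) (at x)"
    by (rule frechet_derivative_cong_open[OF open_dom assms]) (rule alternating_form.skew[OF alt])
  also have "\<dots> = (\<lambda>v. - frechet_derivative (\<lambda>y. \<rho> y w u) (at x) v)"
    by (rule frechet_derivative_at[symmetric]) (intro has_derivative_minus d)
  finally show "dform \<rho> x v u w = - dform \<rho> x v w u" by (simp add: dform_def)
qed

lemma linear_dform: "x \<in> U \<Longrightarrow> linear (\<lambda>v. dform \<rho> x v u w)"
  unfolding dform_def using linear_frechet_derivative_smooth[OF smooth_coeff] by simp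

lemma smooth_form:
  fixes \<tau> a b :: "'s::real_normed_vector \<Rightarrow> (real, 'k) vec"
  assumes "open S" "smooth_on S \<tau>" "smooth_on S a" "smooth_on S b" "\<tau> ` S \<subseteq> U"
  shows "smooth_on S (\<lambda>y. \<rho> (\<tau> y) (a y) (b y))"
proof -
  have "smooth_on S (\<lambda>y. a y $ i)" "smooth_on S (\<lambda>y. b y $ i)" for i
    using assms smooth_on_vec_iff by blast+
  then have "smooth_on S (\<lambda>y. \<Sum>i\<in>UNIV. \<Sum>j\<in>UNIV. a y $ i * b y $ j * \<rho> (\<tau> y) (E i) (E j))"
    by (intro smooth_on_sum smooth_on_mult assms(1) smooth_on_compose[OF assms(1) open_dom assms(2) smooth_coeff assms(5)])
  moreover have "\<rho> (\<tau> y) (a y) (b y) = (\<Sum>i\<in>UNIV. \<Sum>j\<in>UNIV. a y $ i * b y $ j * \<rho> (\<tau> y) (E i) (E j))" if "y \<in> S" for y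
    using alternating_form_expand[OF alt] that assms(5) by blast
  ultimately show ?thesis by (simp cong: smooth_on_cong[OF assms(1)])
qed

lemma form_derivative:
  fixes \<tau> a b :: "'s::real_normed_vector \<Rightarrow> (real, 'k) vec"
  assumes "open S" "smooth_on S \<tau>" "smooth_on S a" "smooth_on S b" "\<tau> ` S \<subseteq> U" "y \<in> S"
  shows "frechet_derivative (\<lambda>y. \<rho> (\<tau> y) (a y) (b y)) (at y) v
    = dform \<rho> (\<tau> y) (frechet_derivative \<tau> (at y) v) (a y) (b y)
      + \<rho> (\<tau> y) (frechet_derivative a (at y) v) (b y) + \<rho> (\<tau> y) (a y) (frechet_derivative b (at y) v)"
proof -
  have \<tau>y: "\<tau> y \<in> U" using assms by blast
  let ?t = "frechet_derivative \<tau> (at y) v" and ?a = "frechet_derivative a (at y) v" and ?b = "frechet_derivative b (at y) v"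
  let ?R = "\<lambda>i j. \<rho> (\<tau> y) (E i) (E j)"
  have da: "((\<lambda>y. a y $ i) has_derivative (\<lambda>v. frechet_derivative a (at y) v $ i)) (at y)"
    and db: "((\<lambda>y. b y $ i) has_derivative (\<lambda>v. frechet_derivative b (at y) v $ i)) (at y)" for i
    by (rule bounded_linear.has_derivative[OF bounded_linear_vec_nth smooth_on_has_derivative];
        use assms in blast)+
  have dR: "((\<lambda>y. \<rho> (\<tau> y) (E i) (E j)) has_derivative
      (\<lambda>v. dform \<rho> (\<tau> y) (frechet_derivative \<tau> (at y) v) (E i) (E j))) (at y)" for i j
    unfolding dform_def
    by (rule has_derivative_compose[OF smooth_on_has_derivative[OF assms(2,6)] smooth_on_has_derivative[OF smooth_coeff \<tau>y]])
  have "frechet_derivative (\<lambda>y. \<rho> (\<tau> y) (a y) (b y)) (at y)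
      = frechet_derivative (\<lambda>y. \<Sum>i\<in>UNIV. \<Sum>j\<in>UNIV. a y $ i * b y $ j * \<rho> (\<tau> y) (E i) (E j)) (at y)"
    by (rule frechet_derivative_cong_open[OF assms(1,6)])
      (use alternating_form_expand[OF alt] assms(5) in blast)
  also have "\<dots> = (\<lambda>v. \<Sum>i\<in>UNIV. \<Sum>j\<in>UNIV. a y $ i * b y $ j * dform \<rho> (\<tau> y) (frechet_derivative \<tau> (at y) v) (E i) (E j)
      + (a y $ i * frechet_derivative b (at y) v $ j + frechet_derivative a (at y) v $ i * b y $ j) * ?R i j)"
    by (rule frechet_derivative_at[symmetric])
      (intro has_derivative_sum has_derivative_mult[OF has_derivative_mult[OF da db] dR])
  finally have "frechet_derivative (\<lambda>y. \<rho> (\<tau> y) (a y) (b y)) (at y) v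
      = (\<Sum>i\<in>UNIV. \<Sum>j\<in>UNIV. a y $ i * b y $ j * dform \<rho> (\<tau> y) ?t (E i) (E j))
      + (\<Sum>i\<in>UNIV. \<Sum>j\<in>UNIV. ?a $ i * b y $ j * ?R i j) + (\<Sum>i\<in>UNIV. \<Sum>j\<in>UNIV. a y $ i * ?b $ j * ?R i j)"
    by (simp add: sum.distrib distrib_right)
  then show ?thesis
    unfolding alternating_form_expand[OF alt[OF \<tau>y], of ?a "b y"] alternating_form_expand[OF alt[OF \<tau>y], of "a y" ?b]
      alternating_form_expand[OF alternating_dform[OF \<tau>y], of ?t "a y" "b y"] .
qed

end

text \<open>Making a frame orthogonal, pair after pair, to the hyperbolic pairs of \<open>\<eta>\<close> that start at
  position four, without dividing by anything: all entries stay polynomial in \<open>\<eta>\<close>.\<close>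

primrec orth_frame :: "('v \<Rightarrow> 'v \<Rightarrow> real) \<Rightarrow> (nat \<Rightarrow> 'v) \<Rightarrow> nat \<Rightarrow> nat \<Rightarrow> 'v::real_vector" where
  "orth_frame \<eta> v 0 = v"
| "orth_frame \<eta> v (Suc i) = (\<lambda>j.
     if 4 \<le> j \<and> j < 2 * i + 6 then orth_frame \<eta> v i j
     else \<eta> (orth_frame \<eta> v i (2 * i + 4)) (orth_frame \<eta> v i (2 * i + 5)) *\<^sub>R orth_frame \<eta> v i j
       - \<eta> (orth_frame \<eta> v i j) (orth_frame \<eta> v i (2 * i + 5)) *\<^sub>R orth_frame \<eta> v i (2 * i + 4)
       + \<eta> (orth_frame \<eta> v i j) (orth_frame \<eta> v i (2 * i + 4)) *\<^sub>R orth_frame \<eta> v i (2 * i + 5))"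

text \<open>Each step subtracts the components along one pair, and the later steps preserve this because they
  combine vectors orthogonal to that pair.\<close>

lemma orth_frame_orthogonal:
  assumes "alternating_form \<eta>" "i < r" "j \<noteq> 2 * i + 4" "j \<noteq> 2 * i + 5"
  shows "\<eta> (orth_frame \<eta> v r j) (orth_frame \<eta> v r (2 * i + 4)) = 0 \<and> \<eta> (orth_frame \<eta> v r j) (orth_frame \<eta> v r (2 * i + 5)) = 0"
  using assms(2-4)
proof (induction r arbitrary: i j)
  case (Suc r)
  interpret alternating_form \<eta> by fact
  let ?F = "orth_frame \<eta> v r"
  let ?a = "?F (2 * r + 4)" and ?b = "?F (2 * r + 5)"
  have step: "orth_frame \<eta> v (Suc r) j = (if 4 \<le> j \<and> j < 2 * r + 6 then ?F j
      else \<eta> ?a ?b *\<^sub>R ?F j - \<eta> (?F j) ?b *\<^sub>R ?a + \<eta> (?F j) ?a *\<^sub>R ?b)" for j by simp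
  have keep: "orth_frame \<eta> v (Suc r) (2 * i + 4) = ?F (2 * i + 4)" "orth_frame \<eta> v (Suc r) (2 * i + 5) = ?F (2 * i + 5)"
    using Suc.prems(1) by simp_all
  show ?case
  proof (cases "i < r")
    case True
    have o: "\<eta> (?F k) (?F (2 * i + 4)) = 0" "\<eta> (?F k) (?F (2 * i + 5)) = 0" if "k \<noteq> 2 * i + 4" "k \<noteq> 2 * i + 5" for k
      using Suc.IH[OF True that] by blast+
    have ne: "2 * r + 4 \<noteq> 2 * i + 4" "2 * r + 4 \<noteq> 2 * i + 5" "2 * r + 5 \<noteq> 2 * i + 4" "2 * r + 5 \<noteq> 2 * i + 5"
      using True by presburger+
    show ?thesis
      unfolding keep unfolding step
      by (simp add: o[OF Suc.prems(2,3)] o[OF ne(1,2)] o[OF ne(3,4)] add_left diff_left scale_left)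
  next
    case False
    then have i: "i = r" using Suc.prems(1) by simp
    have ba: "\<eta> ?b ?a = - \<eta> ?a ?b" by (rule skew)
    show ?thesis
    proof (cases "4 \<le> j \<and> j < 2 * r + 6")
      case True
      define l where "l = (j - 4) div 2"
      have l: "l < r" "j = 2 * l + 4 \<or> j = 2 * l + 5" using True Suc.prems(2,3) i unfolding l_def by presburger+
      have ne: "2 * r + 4 \<noteq> 2 * l + 4" "2 * r + 4 \<noteq> 2 * l + 5" "2 * r + 5 \<noteq> 2 * l + 4" "2 * r + 5 \<noteq> 2 * l + 5"
        using l(1) by presburger+
      have "\<eta> ?a (?F j) = 0" "\<eta> ?b (?F j) = 0"
        using Suc.IH[OF l(1) ne(1,2)] Suc.IH[OF l(1) ne(3,4)] l(2) by (elim disjE; simp)+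
      then show ?thesis
        unfolding keep unfolding step i using True skew[of "?F j" ?a] skew[of "?F j" ?b] by simp
    next
      case False
      then have "orth_frame \<eta> v (Suc r) j = \<eta> ?a ?b *\<^sub>R ?F j - \<eta> (?F j) ?b *\<^sub>R ?a + \<eta> (?F j) ?a *\<^sub>R ?b"
        unfolding step by (rule if_not_P)
      then show ?thesis
        unfolding keep[unfolded i] i by (simp add: add_left diff_left scale_left ba)
    qed
  qed
qed simp

lemma orth_frame_hyperbolic:
  assumes "alternating_form \<eta>" "2 \<le> n"
    and "\<And>i. 2 \<le> i \<Longrightarrow> i < n \<Longrightarrow> \<eta> (orth_frame \<eta> v (n - 2) (2 * i)) (orth_frame \<eta> v (n - 2) (2 * i + 1)) > 0"
  shows "hyperbolic_from \<eta> 2 n (orth_frame \<eta> v (n - 2))"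
  unfolding hyperbolic_from_def
proof (intro conjI allI impI)
  fix j k :: nat assume jk: "j < k" "2 * 2 \<le> k" "k < 2 * n" "\<not> (even j \<and> k = Suc j)"
  define i where "i = (k - 4) div 2"
  have i: "i < n - 2" "k = 2 * i + 4 \<or> k = 2 * i + 5" using jk(2,3) unfolding i_def by presburger+
  have "j \<noteq> 2 * i + 4" "j \<noteq> 2 * i + 5" using i(2) jk(1,4) by presburger+
  from orth_frame_orthogonal[OF assms(1) i(1) this, of v] i(2)
  show "\<eta> (orth_frame \<eta> v (n - 2) j) (orth_frame \<eta> v (n - 2) k) = 0" by blast
qed (use assms(3) in blast)

text \<open>At the base point the pairs have \<open>\<eta>\<close>-value one and all else is orthogonal to them, so the
  recursion changes nothing.\<close>

lemma orth_frame_fixed: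
  assumes "alternating_form \<eta>" "hyperbolic_from \<eta> 2 n v"
    "\<And>i. 2 \<le> i \<Longrightarrow> i < n \<Longrightarrow> \<eta> (v (2 * i)) (v (2 * i + 1)) = 1" "r + 2 \<le> n" "j < 2 * n"
  shows "orth_frame \<eta> v r j = v j"
  using assms(4,5)
proof (induction r arbitrary: j)
  case (Suc r)
  interpret alternating_form \<eta> by fact
  have IH: "orth_frame \<eta> v r k = v k" if "k < 2 * n" for k using Suc.IH[of k] Suc.prems(1) that by simp
  have F: "orth_frame \<eta> v r (2 * r + 4) = v (2 * r + 4)" "orth_frame \<eta> v r (2 * r + 5) = v (2 * r + 5)" "orth_frame \<eta> v r j = v j"
    using IH Suc.prems by simp_all
  have one: "\<eta> (v (2 * r + 4)) (v (2 * r + 5)) = 1" 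
  proof -
    have "\<eta> (v (2 * (r + 2))) (v (2 * (r + 2) + 1)) = 1" by (rule assms(3)) (use Suc.prems(1) in auto)
    moreover have "2 * (r + 2) = 2 * r + 4" "2 * (r + 2) + 1 = 2 * r + 5" by simp_all
    ultimately show ?thesis by (simp only:)
  qed
  have orth: "\<eta> (v j) (v k) = 0" if "j < k" "2 * 2 \<le> k" "k < 2 * n" "\<not> (even j \<and> k = Suc j)" for j k
    using assms(2) that unfolding hyperbolic_from_def by blast
  show ?case
  proof (cases "4 \<le> j \<and> j < 2 * r + 6")
    case True then show ?thesis by (simp add: F)
  next
    case False
    have "\<eta> (v j) (v (2 * r + 4)) = 0 \<and> \<eta> (v j) (v (2 * r + 5)) = 0"
    proof (cases "j < 4")
      case True
      have "\<not> (even j \<and> 2 * r + 4 = Suc j)" "\<not> (even j \<and> 2 * r + 5 = Suc j)" using True by presburger+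
      then show ?thesis using True Suc.prems(1) by (intro conjI orth) auto
    next
      case ge: False
      then have j: "2 * r + 6 \<le> j" using False by simp
      have "\<eta> (v (2 * r + 4)) (v j) = 0" "\<eta> (v (2 * r + 5)) (v j) = 0"
        using j Suc.prems by (intro orth; simp)+
      then show ?thesis using skew[of "v j" "v (2 * r + 4)"] skew[of "v j" "v (2 * r + 5)"] by simp
    qed
    then show ?thesis using False by (simp add: F one)
  qed
qed simp

lemma (in form_family) smooth_orth_frame: "smooth_on U (\<lambda>x. orth_frame (\<rho> x) v r j)"
proof (induction r arbitrary: j)
  case 0
  then show ?case by (simp add: smooth_on_const open_dom)
next
  case (Suc r)
  have id: "smooth_on U (\<lambda>x. x)" by (rule smooth_on_bounded_linear[OF bounded_linear_ident open_dom])
  note f = smooth_form[OF open_dom id Suc.IH Suc.IH]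
  show ?case
  proof (cases "4 \<le> j \<and> j < 2 * r + 6")
    case True then show ?thesis using Suc.IH by simp
  next
    case False
    have "smooth_on U (\<lambda>x. \<rho> x (orth_frame (\<rho> x) v r (2 * r + 4)) (orth_frame (\<rho> x) v r (2 * r + 5)) *\<^sub>R orth_frame (\<rho> x) v r j
       - \<rho> x (orth_frame (\<rho> x) v r j) (orth_frame (\<rho> x) v r (2 * r + 5)) *\<^sub>R orth_frame (\<rho> x) v r (2 * r + 4)
       + \<rho> x (orth_frame (\<rho> x) v r j) (orth_frame (\<rho> x) v r (2 * r + 4)) *\<^sub>R orth_frame (\<rho> x) v r (2 * r + 5))"
      by (intro smooth_on_add smooth_on_diff smooth_on_scaleR open_dom f Suc.IH) simp_all
    then show ?thesis by (simp only: orth_frame.simps if_not_P[OF False])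
  qed
qed

lemma frame_mat_negate_first:
  fixes v :: "nat \<Rightarrow> (real, 'k::{finite,linorder}) vec"
  shows "det (frame_mat (v(0 := - v 0))) = - det (frame_mat v)"
proof -
  let ?k = "unidx 0 :: 'k"
  have k: "idx j = 0 \<longleftrightarrow> j = ?k" for j :: 'k
    using unidx_idx[of j] idx_unidx[where 'k = 'k, of 0] by auto
  have "transpose (frame_mat (v(0 := - v 0))) = (\<chi> i. if i = ?k then (- 1) *s transpose (frame_mat v) $ i else transpose (frame_mat v) $ i)"
    by (auto simp: vec_eq_iff transpose_def frame_mat_def k idx_unidx)
  then have "det (transpose (frame_mat (v(0 := - v 0)))) = - 1 * det (\<chi> i. if i = ?k then transpose (frame_mat v) $ i else transpose (frame_mat v) $ i)"
    by (simp only: det_row_mul)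
  then show ?thesis by (simp add: det_transpose)
qed

text \<open>The rank of \<open>\<eta>\<close> is \<open>2n - 4\<close>, so there are \<open>n - 2\<close> hyperbolic pairs to put after a basis of the
  kernel; the sign of one kernel vector adjusts the orientation.\<close>

lemma pos_frame_exists:
  fixes \<eta> :: "(real, 'k::{finite,linorder}) vec \<Rightarrow> (real, 'k) vec \<Rightarrow> real"
  assumes alt: "alternating_form \<eta>" and card: "CARD('k) = 2 * n" and n: "2 \<le> n"
    and dim: "dim {u. \<forall>w. \<eta> u w = 0} = 4"
  obtains v where "pos_frame n \<eta> v" "\<And>i. 2 \<le> i \<Longrightarrow> i < n \<Longrightarrow> \<eta> (v (2 * i)) (v (2 * i + 1)) = 1"
proof -
  interpret alternating_form \<eta> by fact
  let ?K = "{u. \<forall>w. \<eta> u w = 0}"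
  obtain B where B: "B \<subseteq> ?K" "independent B" "card B = 4" using basis_exists[of ?K] dim by metis
  have finB: "finite B" using B(3) card.infinite by fastforce
  obtain k where k: "bij_betw k {0..<4::nat} B" using ex_bij_betw_nat_finite[OF finB] B(3) by auto
  obtain r c where c: "hyperbolic_from \<eta> 0 r c"
    "dim (UNIV :: (real, 'k) vec set) \<le> 2 * r + dim {z \<in> UNIV. \<forall>w\<in>UNIV. \<eta> z w = 0}"
    by (rule hyperbolic_basis_dim[OF alt subspace_UNIV])
  have r: "n - 2 \<le> r" using c(2) dim card by (simp add: dim_UNIV)
  have chyp: "\<And>j k. j < k \<Longrightarrow> k < 2 * r \<Longrightarrow> \<not> (even j \<and> k = Suc j) \<Longrightarrow> \<eta> (c j) (c k) = 0"
    and cpos: "\<And>i. i < r \<Longrightarrow> \<eta> (c (2 * i)) (c (2 * i + 1)) > 0"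
    using c(1) unfolding hyperbolic_from_def by simp_all
  define s where "s j = (if even j then 1 else 1 / \<eta> (c (j - 1)) (c j))" for j
  define v where "v j = (if j < 4 then k j else s (j - 4) *\<^sub>R c (j - 4))" for j
  have vrad: "\<eta> (v j) w = 0" if "j < 4" for j w
  proof -
    have "k j \<in> B" using bij_betwE[OF k] that by simp
    then show ?thesis using B(1) that by (auto simp: v_def)
  qed
  have one: "\<eta> (v (2 * i)) (v (2 * i + 1)) = 1" if "2 \<le> i" "i < n" for i
  proof -
    have e: "2 * i - 4 = 2 * (i - 2)" "2 * i + 1 - 4 = 2 * (i - 2) + 1" using that by auto
    have "\<eta> (c (2 * (i - 2))) (c (2 * (i - 2) + 1)) > 0" by (rule cpos) (use that r in auto)
    then show ?thesis using that unfolding v_def e by (simp add: s_def scale_left scale_right)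
  qed
  have hyp: "hyperbolic_from \<eta> 2 n v"
    unfolding hyperbolic_from_def
  proof (intro conjI allI impI)
    fix j k' assume jk: "j < k'" "2 * 2 \<le> k'" "k' < 2 * n" "\<not> (even j \<and> k' = Suc j)"
    show "\<eta> (v j) (v k') = 0"
    proof (cases "j < 4")
      case False
      have "\<eta> (c (j - 4)) (c (k' - 4)) = 0"
      proof (rule chyp)
        show "\<not> (even (j - 4) \<and> k' - 4 = Suc (j - 4))" using jk(1,4) False by auto
      qed (use jk False r in auto)
      then show ?thesis using jk False by (simp add: v_def scale_left scale_right)
    qed (simp add: vrad)
  qed (use one in simp)
  have indep: "\<forall>j<4. a j = 0" if 0: "(\<Sum>j<4. a j *\<^sub>R v j) = 0" for a :: "nat \<Rightarrow> real"
  proof -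
    define f where "f b = a (inv_into {0..<4} k b)" for b
    have fk: "f (k j) = a j" if "j < 4" for j
      using bij_betw_inv_into_left[OF k] that by (simp add: f_def)
    have "(\<Sum>b\<in>B. f b *\<^sub>R b) = (\<Sum>j\<in>{0..<4}. f (k j) *\<^sub>R k j)"
      by (rule sum.reindex_bij_betw[OF k, symmetric])
    also have "\<dots> = (\<Sum>j<4. a j *\<^sub>R v j)"
      unfolding atLeast0LessThan by (intro sum.cong refl) (simp add: fk v_def)
    finally have "(\<Sum>b\<in>B. f b *\<^sub>R b) = 0" using 0 by simp
    then have z: "\<forall>b\<in>B. f b = 0" using B(2) independent_explicit_finite_subsets finB by (metis order_refl)
    show ?thesis
    proof (intro allI impI)
      fix j :: nat assume "j < 4"
      then have "k j \<in> B" using bij_betwE[OF k] by simp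
      then show "a j = 0" using z fk[OF \<open>j < 4\<close>] by simp
    qed
  qed
  have nz: "det (frame_mat v) \<noteq> 0"
    by (rule hyperbolic_frame_det[OF alt card n hyp vrad indep])
  show thesis
  proof (cases "det (frame_mat v) > 0")
    case True
    then show ?thesis using that[of v] vrad hyp one by (simp add: pos_frame_def)
  next
    case False
    let ?v = "v(0 := - v 0)"
    have neg: "\<eta> (- v 0) w = 0" for w using scale_left[of "- 1" "v 0" w] vrad[of 0 w] by simp
    have "det (frame_mat ?v) > 0" using False nz by (simp add: frame_mat_negate_first)
    moreover have "\<eta> (?v j) w = 0" if "j < 4" for j w using that vrad neg by simp
    moreover have "hyperbolic_from \<eta> 2 n ?v"
      using hyp unfolding hyperbolic_from_def by (auto simp: neg)
    moreover have "\<eta> (?v (2 * i)) (?v (2 * i + 1)) = 1" if "2 \<le> i" "i < n" for i using one[OF that] that by simp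
    ultimately show ?thesis using that[of ?v] by (simp add: pos_frame_def)
  qed
qed

lemma pos_frame_kernel_span:
  fixes \<eta> :: "(real, 'k::{finite,linorder}) vec \<Rightarrow> (real, 'k) vec \<Rightarrow> real"
  assumes alt: "alternating_form \<eta>" and card: "CARD('k) = 2 * n" and n: "2 \<le> n"
    and v: "pos_frame n \<eta> v" and u: "\<And>w. \<eta> u w = 0"
  obtains c where "u = (\<Sum>i<4. c i *\<^sub>R v i)"
proof -
  interpret alternating_form \<eta> by fact
  have vhyp: "hyperbolic_from \<eta> 2 n v" and vdet: "det (frame_mat v) \<noteq> 0" using v by (auto simp: pos_frame_def)
  obtain l where l: "\<And>u. u = (\<Sum>i<CARD('k). l i u *\<^sub>R v i)" 
    by (rule frame_coordinates[OF vdet]) (rule that, assumption)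
  have "\<eta> (\<Sum>i<2 * n. l i u *\<^sub>R v i) x = 0" for x using u l[of u] card by simp
  then have "l i u = 0" if "4 \<le> i" "i < 2 * n" for i
    using hyperbolic_coefficients_0[OF vhyp, of "\<lambda>i. l i u" i] that by simp
  then have "(\<Sum>i<CARD('k). l i u *\<^sub>R v i) = (\<Sum>i<4. l i u *\<^sub>R v i)"
    using card n by (intro sum_lessThan_zero_beyond) auto
  then have "u = (\<Sum>i<4. l i u *\<^sub>R v i)" using l[of u] by simp
  then show thesis by (rule that)
qed

lemma family_dependent:
  fixes w :: "nat \<Rightarrow> 'v::euclidean_space"
  assumes "DIM('v) < N"
  obtains a where "(\<Sum>i<N. a i *\<^sub>R w i) = 0" "\<exists>i<N. a i \<noteq> (0::real)"
proof (cases "inj_on w {..<N}")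
  case True
  have "dependent (w ` {..<N})"
    using independent_bound[of "w ` {..<N}"] assms card_image[OF True] by auto
  then obtain u where u: "\<exists>v\<in>w ` {..<N}. u v \<noteq> 0" "(\<Sum>v\<in>w ` {..<N}. u v *\<^sub>R v) = 0"
    using dependent_finite[of "w ` {..<N}"] by auto
  show thesis
    by (rule that[of "\<lambda>i. u (w i)"]) (use u sum.reindex[OF True, of "\<lambda>v. u v *\<^sub>R v"] in auto)
next
  case False
  then obtain i j where ij: "i < N" "j < N" "i \<noteq> j" "w i = w j" unfolding inj_on_def by blast
  let ?a = "\<lambda>k. if k = i then 1 else if k = j then - 1 else (0::real)"
  have "(\<Sum>k<N. ?a k *\<^sub>R w k) = (\<Sum>k\<in>{i, j}. ?a k *\<^sub>R w k)"
    by (rule sum.mono_neutral_right) (use ij in auto)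
  also have "\<dots> = 0" using ij by simp
  finally have "(\<Sum>k<N. ?a k *\<^sub>R w k) = 0" .
  moreover have "\<exists>k<N. ?a k \<noteq> 0" using ij(1) by (intro exI[of _ i]) simp
  ultimately show thesis by (rule that)
qed

text \<open>A kernel of dimension at least four makes the power \<open>n - 1\<close> vanish: any \<open>2n - 2\<close>
  vectors are dependent modulo the kernel.\<close>

lemma wedge_power_vanishes:
  fixes \<eta> :: "(real, 'k::{finite,linorder}) vec \<Rightarrow> (real, 'k) vec \<Rightarrow> real"
  assumes alt: "alternating_form \<eta>" and card: "CARD('k) = 2 * n" and n: "2 \<le> n"
    and rad: "\<And>j w. j < 4 \<Longrightarrow> \<eta> (k j) w = 0" and det: "det (frame_mat k) \<noteq> 0"
  shows "wedge_power \<eta> (n - 1) w = 0"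
proof -
  interpret alternating_form \<eta> by fact
  define m where "m = 2 * (n - 1)"
  define w' where "w' i = (if i < m then w i else k (i - m))" for i
  have "DIM((real, 'k) vec) < m + 4" using card n by (simp add: m_def)
  then obtain a where a: "(\<Sum>i<m + 4. a i *\<^sub>R w' i) = 0" "\<exists>i<m + 4. a i \<noteq> 0"
    by (rule family_dependent)
  have split: "(\<Sum>i<m + 4. a i *\<^sub>R w' i) = (\<Sum>i<m. a i *\<^sub>R w i) + (\<Sum>j<4. a (m + j) *\<^sub>R k j)"
    by (simp add: w'_def eval_nat_numeral)
  have radsum: "\<eta> (\<Sum>i<m. a i *\<^sub>R w i) x = 0" for x
  proof -
    have "\<eta> (\<Sum>i<m. a i *\<^sub>R w i) x + \<eta> (\<Sum>j<4. a (m + j) *\<^sub>R k j) x = 0"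
      using a(1) split by (simp flip: add_left)
    moreover have "\<eta> (\<Sum>j<4. a (m + j) *\<^sub>R k j) x = 0"
      by (simp add: sum_left scale_left rad)
    ultimately show ?thesis by simp
  qed
  have "\<exists>i<m. a i \<noteq> 0"
  proof (rule ccontr)
    assume "\<not> (\<exists>i<m. a i \<noteq> 0)"
    then have z: "a i = 0" if "i < m" for i using that by blast
    then have 0: "(\<Sum>j<4. a (m + j) *\<^sub>R k j) = 0" using a(1) split by simp
    have "(\<Sum>j<CARD('k). (if j < 4 then a (m + j) else 0) *\<^sub>R k j) = (\<Sum>j<4. (if j < 4 then a (m + j) else 0) *\<^sub>R k j)"
      using card n by (intro sum_lessThan_zero_beyond) auto
    also have "\<dots> = 0" using 0 by simp
    finally have s: "(\<Sum>j<CARD('k). (if j < 4 then a (m + j) else 0) *\<^sub>R k j) = 0" .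
    have "a (m + j) = 0" if "j < 4" for j
    proof -
      have "j < CARD('k)" using that card n by simp
      from det[unfolded det_frame_mat_nonzero_iff, rule_format, OF s this] show ?thesis using that by simp
    qed
    then have "a i = 0" if "i < m + 4" for i
      using z[of i] that le_Suc_ex[of "m" i] by (cases "i < m") auto
    with a(2) show False by blast
  qed
  then show ?thesis using wedge_power_dependent[of _ "n - 1" a w] radsum unfolding m_def by blast
qed

text \<open>The gradient \<open>D\<^sub>K v\<close> as a skew matrix, when the first four vectors of \<open>k\<close> are a frame of the kernel \<open>K\<close>.\<close>

definition kgrad :: "((real, 'k) vec \<Rightarrow> (real, 'k) vec \<Rightarrow> (real, 'k) vec \<Rightarrow> real) \<Rightarrow> (real, 'k::finite) vec
    \<Rightarrow> (nat \<Rightarrow> (real, 'k) vec) \<Rightarrow> (real, 'k) vec \<Rightarrow> real ^ 4 ^ 4" where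
  "kgrad \<rho> q k v = (\<chi> i j. dform \<rho> q v (k (enum4 i)) (k (enum4 j)))"

text \<open>The content of near-symplecticity in a positively oriented chart.  The last assumption says that the
  gradient restricted to the kernel has rank at least three: it provides three kernel vectors whose
  gradients are linearly independent.\<close>

locale near_symplectic_family = form_family U \<rho>
  for U :: "(real, 'k::{finite,linorder}) vec set" and \<rho> +
  fixes n :: nat
  assumes card: "CARD('k) = 2 * n" and n2: "2 \<le> n"
    and nonneg: "x \<in> U \<Longrightarrow> det (frame_mat v) > 0 \<Longrightarrow> wedge_power (\<rho> x) n v \<ge> 0"
    and ker_dim: "x \<in> U \<Longrightarrow> (\<And>v. wedge_power (\<rho> x) (n - 1) v = 0) \<Longrightarrow> dim {u. \<forall>w. \<rho> x u w = 0} = 4"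
    and grad_rank: "x \<in> U \<Longrightarrow> (\<And>v. wedge_power (\<rho> x) (n - 1) v = 0) \<Longrightarrow>
      \<exists>b :: 3 \<Rightarrow> (real, 'k) vec. (\<forall>a w. \<rho> x (b a) w = 0) \<and>
        (\<forall>c. (\<forall>u w. (\<forall>x'. \<rho> x u x' = 0) \<longrightarrow> (\<forall>x'. \<rho> x w x' = 0) \<longrightarrow> dform \<rho> x (\<Sum>a\<in>UNIV. c a *\<^sub>R b a) u w = 0)
          \<longrightarrow> (\<forall>a. c a = 0))"
begin

definition sing :: "(real, 'k) vec set" where
  "sing = {x \<in> U. \<forall>v. wedge_power (\<rho> x) (n - 1) v = 0}"

text \<open>What is needed from a local equation \<open>f\<close> of the singular locus at one of its points \<open>q\<close>.  Its
  derivative is the self-dual part of the gradient in an oriented frame of the kernel, which fixes the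
  orientation of the normal space, and it is onto already on the kernel, which makes the restriction
  nondegenerate.\<close>

definition adapted_at :: "((real, 'k) vec \<Rightarrow> real ^ 3) \<Rightarrow> (real, 'k) vec \<Rightarrow> bool" where
  "adapted_at f q \<longleftrightarrow> (\<exists>k. pos_frame n (\<rho> q) k \<and>
      (\<forall>v. frechet_derivative f (at q) v = sd 1 (kgrad \<rho> q k v)) \<and> (\<forall>v. 0 \<le> pf4 (kgrad \<rho> q k v))) \<and>
      (\<forall>s. \<exists>v. (\<forall>w. \<rho> q v w = 0) \<and> frechet_derivative f (at q) v = s)"

lemma skew_kgrad: "q \<in> U \<Longrightarrow> skew_mat (kgrad \<rho> q k v)"
  unfolding skew_mat_def kgrad_def vec_lambda_beta
  by (intro allI, rule alternating_form.skew[OF alternating_dform])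

lemma linear_kgrad: "q \<in> U \<Longrightarrow> linear (kgrad \<rho> q k)"
  by (rule linearI)
    (simp_all add: kgrad_def vec_eq_iff linear_add[OF linear_dform] linear_scale[OF linear_dform])

text \<open>The orthogonalised frame of a point turns the singular locus into the zero set of the
  restriction \<open>S\<close> of the form to the four-dimensional orthogonal complement of the Darboux part.
  Since the Pfaffian of \<open>S\<close> is nonnegative, this is the zero set of its self-dual part.\<close>

lemma local_equation:
  assumes "p \<in> sing"
  obtains V f where "open V" "p \<in> V" "V \<subseteq> U" "smooth_on V f"
    "\<And>x. x \<in> V \<Longrightarrow> f x = 0 \<longleftrightarrow> x \<in> sing" "\<And>q. q \<in> V \<Longrightarrow> q \<in> sing \<Longrightarrow> adapted_at f q"
proof -
  have pU: "p \<in> U" using assms by (simp add: sing_def)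
  have "dim {u. \<forall>w. \<rho> p u w = 0} = 4" using ker_dim[OF pU] assms by (simp add: sing_def)
  then obtain v0 where v0: "pos_frame n (\<rho> p) v0" "\<And>i. 2 \<le> i \<Longrightarrow> i < n \<Longrightarrow> \<rho> p (v0 (2 * i)) (v0 (2 * i + 1)) = 1"
    by (rule pos_frame_exists[OF alt[OF pU] card n2]) blast
  define F where "F x = orth_frame (\<rho> x) v0 (n - 2)" for x
  have smF: "smooth_on U (\<lambda>x. F x j)" for j unfolding F_def by (rule smooth_orth_frame)
  have id: "smooth_on U (\<lambda>x. x)" by (rule smooth_on_bounded_linear[OF bounded_linear_ident open_dom])
  have smFF: "smooth_on U (\<lambda>x. \<rho> x (F x i) (F x j))" for i j
    by (rule smooth_form[OF open_dom id smF smF]) simp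
  have Fp: "F p j = v0 j" if "j < 2 * n" for j
    unfolding F_def
    by (rule orth_frame_fixed[OF alt[OF pU] _ v0(2) _ that]) (use v0(1) n2 in \<open>auto simp: pos_frame_def\<close>)
  define d where "d x = det (frame_mat (F x))" for x
  have smd: "smooth_on U d" unfolding d_def
  proof (rule smooth_on_det[OF open_dom])
    show "smooth_on U (\<lambda>x. frame_mat (F x) $ i $ j)" for i j
      using smF[of "idx j"] by (simp add: frame_mat_def smooth_on_vec_iff[OF open_dom])
  qed
  (* The part of the chart where the orthogonalised frame is a positively oriented basis and its pairs
     stay positive. *)
  define V where "V = {x \<in> U. 0 < d x} \<inter> (\<Inter>i\<in>{2..<n}. {x \<in> U. 0 < \<rho> x (F x (2 * i)) (F x (2 * i + 1))}) \<inter> U"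
  have open_pos: "open {x \<in> U. 0 < h x}" if "smooth_on U h" for h :: "_ \<Rightarrow> real"
  proof -
    have "{x \<in> U. 0 < h x} = U \<inter> h -` {0<..}" by auto
    then show ?thesis using continuous_open_preimage[OF smooth_on_imp_continuous_on[OF that] open_dom open_greaterThan] by simp
  qed
  have VU: "V \<subseteq> U" by (simp add: V_def)
  have Vopen: "open V"
  proof -
    have "open (\<Inter>i\<in>{2..<n}. {x \<in> U. 0 < \<rho> x (F x (2 * i)) (F x (2 * i + 1))})"
      by (rule open_INT) (auto intro: open_pos[OF smFF])
    then show ?thesis unfolding V_def by (intro open_Int open_pos[OF smd] open_dom)
  qed
  have pV: "p \<in> V"
  proof -
    have "frame_mat (F p) = frame_mat v0"
      using idx_less[where 'k = 'k] card by (simp add: frame_mat_def vec_eq_iff Fp)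
    then have "0 < d p" using v0(1) by (simp add: d_def pos_frame_def)
    moreover have "0 < \<rho> p (F p (2 * i)) (F p (2 * i + 1))" if "2 \<le> i" "i < n" for i
      using v0(2)[OF that] that by (simp add: Fp)
    ultimately show ?thesis using pU by (simp add: V_def)
  qed
  have hyp: "hyperbolic_from (\<rho> x) 2 n (F x)" if "x \<in> V" for x
    unfolding F_def
  proof (rule orth_frame_hyperbolic)
    show "alternating_form (\<rho> x)" using that VU alt by blast
    show "0 < \<rho> x (orth_frame (\<rho> x) v0 (n - 2) (2 * i)) (orth_frame (\<rho> x) v0 (n - 2) (2 * i + 1))"
      if "2 \<le> i" "i < n" for i
      using \<open>x \<in> V\<close> that by (simp add: V_def F_def)
  qed (rule n2)
  have dpos: "det (frame_mat (F x)) > 0" if "x \<in> V" for x using that by (simp add: V_def d_def)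
  define S where "S x = (\<chi> i j. \<rho> x (F x (enum4 i)) (F x (enum4 j)))" for x
  have skS: "skew_mat (S x)" if "x \<in> V" for x
    unfolding skew_mat_def S_def vec_lambda_beta
    by (intro allI, rule alternating_form.skew[OF alt]) (use that VU in blast)
  have pfS: "0 \<le> pf4 (S x)" if xV: "x \<in> V" for x
  proof -
    interpret X: alternating_form "\<rho> x" using that VU alt by blast
    obtain C where C: "C > 0" "wedge_power (\<rho> x) n (F x) = C * wedge_power (\<rho> x) 2 (F x)"
      using X.wedge_power_hyperbolic[OF hyp[OF xV] n2] by blast
    have "0 \<le> wedge_power (\<rho> x) n (F x)" using nonneg[OF _ dpos[OF that]] that VU by blast
    then have "0 \<le> wedge_power (\<rho> x) 2 (F x)" using C by (simp add: zero_le_mult_iff)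
    moreover have "wedge_power (\<rho> x) 2 (F x) = 2 * pf4 (S x)"
      by (simp add: X.wedge_power_2 pf4_def S_def del: One_nat_def)
    ultimately show ?thesis by simp
  qed
  define f where "f x = sd 1 (S x)" for x
  have smf: "smooth_on V f"
  proof -
    have S_nth: "smooth_on V (\<lambda>x. S x $ i $ j)" for i j
      unfolding S_def by (simp, rule smooth_on_subset[OF smFF VU])
    have "smooth_on V (\<lambda>x. f x $ i)" for i
      using exhaust_3[of i] by (elim disjE) (simp_all add: f_def smooth_on_add smooth_on_diff Vopen S_nth)
    then show ?thesis using smooth_on_vec_iff[OF Vopen] by blast
  qed
  have S_sing: "S x = 0" if "x \<in> V" "x \<in> sing" for x
  proof -
    interpret X: alternating_form "\<rho> x" using that VU alt by blast
    have "\<rho> x (F x i) (F x j) = 0" if ij: "i < 4" "j < 4" for i j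
    proof -
      (* The power n - 1 on the pair (i, j) followed by the n - 2 hyperbolic pairs is a positive multiple
         of the value of the form on (i, j). *)
      define u where "u l = (if l = 0 then F x i else if l = 1 then F x j else F x (l + 2))" for l :: nat
      have orth: "\<rho> x (F x a) (F x b) = 0" if "a < b" "2 * 2 \<le> b" "b < 2 * n" "\<not> (even a \<and> b = Suc a)" for a b
        using hyp[OF \<open>x \<in> V\<close>] that unfolding hyperbolic_from_def by blast
      have "hyperbolic_from (\<rho> x) 1 (n - 1) u"
        unfolding hyperbolic_from_def
      proof (intro conjI allI impI)
        fix a b assume ab: "a < b" "2 * 1 \<le> b" "b < 2 * (n - 1)" "\<not> (even a \<and> b = Suc a)"
        then have b: "u b = F x (b + 2)" by (simp add: u_def)
        have ne: "\<not> (even i \<and> b + 2 = Suc i)" "\<not> (even j \<and> b + 2 = Suc j)" using ij ab(2) by presburger+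
        consider "a = 0" | "a = 1" | "2 \<le> a" by linarith
        then show "\<rho> x (u a) (u b) = 0"
        proof cases
          case 1 then show ?thesis unfolding b using ne(1) ij ab by (simp add: u_def, intro orth) auto
        next
          case 2 then show ?thesis unfolding b using ne(2) ij ab by (simp add: u_def, intro orth) auto
        next
          case 3 then show ?thesis unfolding b using ab by (simp add: u_def, intro orth) auto
        qed
      next
        fix a assume a: "1 \<le> a" "a < n - 1"
        have pos: "\<rho> x (F x (2 * i)) (F x (2 * i + 1)) > 0" if "2 \<le> i" "i < n" for i
          using hyp[OF \<open>x \<in> V\<close>] that unfolding hyperbolic_from_def by blast
        have "\<rho> x (F x (2 * (a + 1))) (F x (2 * (a + 1) + 1)) > 0"
          by (rule pos) (use a in auto)
        then show "\<rho> x (u (2 * a)) (u (2 * a + 1)) > 0" using a by (simp add: u_def)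
      qed
      then have "\<exists>C>0. wedge_power (\<rho> x) (n - 1) u = C * wedge_power (\<rho> x) 1 u"
        by (rule X.wedge_power_hyperbolic) (use n2 in simp)
      then obtain C where C: "C > 0" "wedge_power (\<rho> x) (n - 1) u = C * wedge_power (\<rho> x) 1 u"
        by (elim exE conjE)
      have "wedge_power (\<rho> x) (n - 1) u = 0" using \<open>x \<in> sing\<close> by (simp add: sing_def)
      then have "wedge_power (\<rho> x) (Suc 0) u = 0" using C unfolding One_nat_def by (simp del: wedge_power.simps)
      then show ?thesis unfolding X.wedge_power_1 by (simp add: u_def)
    qed
    then show ?thesis by (simp add: S_def vec_eq_iff enum4_less)
  qed
  have S_kernel: "\<rho> x (F x j) w = 0" if xV: "x \<in> V" and Sx: "S x = 0" and j4: "j < 4" for x j w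
  proof -
    interpret X: alternating_form "\<rho> x" using that VU alt by blast
    obtain l where l: "\<And>u. u = (\<Sum>i<CARD('k). l i u *\<^sub>R F x i)"
      by (rule frame_coordinates[of "F x"]) (use dpos[OF xV] in auto)
    have "\<rho> x (F x j) (F x i) = 0" if "i < 2 * n" for i
    proof (cases "i < 4")
      case True
      obtain a b where "enum4 a = j" "enum4 b = i" using enum4_surj[OF j4] enum4_surj[OF True] by blast
      moreover have "S x $ a $ b = 0" using \<open>S x = 0\<close> by simp
      ultimately show ?thesis by (simp add: S_def)
    next
      case False
      have "\<not> (even j \<and> i = Suc j)" using \<open>j < 4\<close> False by presburger
      then show ?thesis
        using hyp[OF \<open>x \<in> V\<close>] \<open>j < 4\<close> False that unfolding hyperbolic_from_def by auto
    qed
    then have "\<rho> x (F x j) (\<Sum>i<CARD('k). l i w *\<^sub>R F x i) = 0"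
      by (simp add: X.sum_right X.scale_right card)
    then show ?thesis using l[of w] by simp
  qed
  have zero_iff: "f x = 0 \<longleftrightarrow> x \<in> sing" if "x \<in> V" for x
  proof
    assume "f x = 0"
    then have "S x = 0"
      by (intro sd_eq_0_semidef[of 1]) (simp_all add: skS[OF that] pfS[OF that] f_def)
    have xU: "x \<in> U" using that VU by blast
    have "wedge_power (\<rho> x) (n - 1) w = 0" for w
    proof (rule wedge_power_vanishes[where k = "F x", OF alt[OF xU] card n2])
      show "\<rho> x (F x j) w = 0" if "j < 4" for j w using S_kernel[OF \<open>x \<in> V\<close> \<open>S x = 0\<close> that] .
      show "det (frame_mat (F x)) \<noteq> 0" using dpos[OF \<open>x \<in> V\<close>] by simp
    qed
    then show "x \<in> sing" using xU by (simp add: sing_def)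
  next
    assume "x \<in> sing"
    then have "S x = 0" by (rule S_sing[OF that])
    then show "f x = 0" by (simp add: f_def vec_eq_iff forall_3)
  qed
  have adapted: "adapted_at f q" if q: "q \<in> V" "q \<in> sing" for q
  proof -
    have qU: "q \<in> U" using q VU by blast
    interpret Q: alternating_form "\<rho> q" by (rule alt[OF qU])
    have S0: "S q = 0" by (rule S_sing[OF q])
    have rad: "\<rho> q (F q j) w = 0" "\<rho> q w (F q j) = 0" if "j < 4" for j w
      using S_kernel[OF q(1) S0 that, of w] Q.skew[of w "F q j"] by simp_all
    have pos: "pos_frame n (\<rho> q) (F q)" using rad(1) hyp[OF q(1)] dpos[OF q(1)] by (simp add: pos_frame_def)
    have dS: "((\<lambda>x. S x $ i $ j) has_derivative (\<lambda>v. kgrad \<rho> q (F q) v $ i $ j)) (at q)" for i j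
    proof -
      have "frechet_derivative (\<lambda>x. \<rho> x (F x (enum4 i)) (F x (enum4 j))) (at q) v = kgrad \<rho> q (F q) v $ i $ j" for v
        using form_derivative[OF open_dom id smF smF _ qU, of "enum4 i" "enum4 j" v]
        by (simp add: rad enum4_less kgrad_def)
      moreover have "((\<lambda>x. \<rho> x (F x (enum4 i)) (F x (enum4 j))) has_derivative
          frechet_derivative (\<lambda>x. \<rho> x (F x (enum4 i)) (F x (enum4 j))) (at q)) (at q)"
        by (rule smooth_on_has_derivative[OF smFF qU])
      moreover have "(\<lambda>x. S x $ i $ j) = (\<lambda>x. \<rho> x (F x (enum4 i)) (F x (enum4 j)))" by (simp add: S_def)
      ultimately show ?thesis by (metis (no_types, lifting) ext)
    qed
    have df: "frechet_derivative f (at q) v = sd 1 (kgrad \<rho> q (F q) v)" for v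
    proof -
      have "frechet_derivative (\<lambda>x. f x $ i) (at q) v = sd 1 (kgrad \<rho> q (F q) v) $ i" for i
      proof -
        have "((\<lambda>x. f x $ i) has_derivative (\<lambda>v. sd 1 (kgrad \<rho> q (F q) v) $ i)) (at q)"
          using exhaust_3[of i]
          by (elim disjE) (simp_all add: f_def, (intro has_derivative_add has_derivative_diff dS)+)
        from frechet_derivative_at[OF this] show ?thesis by (metis (no_types, lifting))
      qed
      then show ?thesis by (simp only: vec_eq_iff frechet_derivative_vec_nth[OF smf q(1)]) simp
    qed
    have pf: "0 \<le> pf4 (kgrad \<rho> q (F q) v)" for v
    proof -
      (* The gradient is a limit of difference quotients of S, all of nonnegative Pfaffian as S q = 0. *)
      have lim: "((\<lambda>t. S (q + t *\<^sub>R v) $ i $ j / t) \<longlongrightarrow> kgrad \<rho> q (F q) v $ i $ j) (at 0)" for i j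
      proof -
        have "((\<lambda>t. q + t *\<^sub>R v) has_derivative (\<lambda>h. h *\<^sub>R v)) (at 0)"
          by (auto intro!: derivative_eq_intros)
        moreover have "((\<lambda>x. S x $ i $ j) has_derivative (\<lambda>v. kgrad \<rho> q (F q) v $ i $ j)) (at (q + 0 *\<^sub>R v))"
          using dS by simp
        ultimately have "((\<lambda>t. S (q + t *\<^sub>R v) $ i $ j) has_derivative (\<lambda>h. kgrad \<rho> q (F q) (h *\<^sub>R v) $ i $ j)) (at 0)"
          by (rule has_derivative_compose)
        moreover have "(\<lambda>h. kgrad \<rho> q (F q) (h *\<^sub>R v) $ i $ j) = (*) (kgrad \<rho> q (F q) v $ i $ j)"
          by (simp add: fun_eq_iff linear_scale[OF linear_kgrad[OF qU]] mult.commute)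
        ultimately have "((\<lambda>t. S (q + t *\<^sub>R v) $ i $ j) has_field_derivative (kgrad \<rho> q (F q) v $ i $ j)) (at 0)"
          unfolding has_field_derivative_def by (simp only:)
        then show ?thesis by (simp add: has_field_derivative_iff S0)
      qed
      have "((\<lambda>t. pf4 (\<chi> i j. S (q + t *\<^sub>R v) $ i $ j / t)) \<longlongrightarrow> pf4 (kgrad \<rho> q (F q) v)) (at 0)"
        unfolding pf4_def vec_lambda_beta by (intro tendsto_add tendsto_diff tendsto_mult lim)
      moreover have "\<forall>\<^sub>F t in at 0. 0 \<le> pf4 (\<chi> i j. S (q + t *\<^sub>R v) $ i $ j / t)"
      proof -
        have "((\<lambda>t. q + t *\<^sub>R v) \<longlongrightarrow> q + 0 *\<^sub>R v) (at 0)" by (intro tendsto_intros)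
        then have "\<forall>\<^sub>F t in at 0. q + t *\<^sub>R v \<in> V"
          using topological_tendstoD[OF _ Vopen] q(1) by simp
        then show ?thesis
        proof (rule eventually_mono)
          fix t assume "q + t *\<^sub>R v \<in> V"
          have "pf4 (\<chi> i j. S (q + t *\<^sub>R v) $ i $ j / t) = pf4 (S (q + t *\<^sub>R v)) / (t * t)"
            by (simp add: pf4_def add_divide_distrib diff_divide_distrib)
          then show "0 \<le> pf4 (\<chi> i j. S (q + t *\<^sub>R v) $ i $ j / t)"
            using pfS[OF \<open>q + t *\<^sub>R v \<in> V\<close>] by simp
        qed
      qed
      ultimately show ?thesis by (rule tendsto_lowerbound) simp
    qed
    have surj: "\<exists>v. (\<forall>w. \<rho> q v w = 0) \<and> frechet_derivative f (at q) v = s" for s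
    proof -
      obtain b :: "3 \<Rightarrow> (real, 'k) vec" where b: "\<And>a w. \<rho> q (b a) w = 0"
        "\<And>c. (\<forall>u w. (\<forall>x'. \<rho> q u x' = 0) \<longrightarrow> (\<forall>x'. \<rho> q w x' = 0) \<longrightarrow> dform \<rho> q (\<Sum>a\<in>UNIV. c a *\<^sub>R b a) u w = 0) \<Longrightarrow> \<forall>a. c a = 0"
        using grad_rank[OF qU] q(2) unfolding sing_def by blast
      let ?Df = "frechet_derivative f (at q)"
      have lin: "linear ?Df" by (rule linear_frechet_derivative_smooth[OF smf q(1)])
      define M :: "real ^ 3 ^ 3" where "M = (\<chi> i a. ?Df (b a) $ i)"
      have M: "M *v c = ?Df (\<Sum>a\<in>UNIV. c $ a *\<^sub>R b a)" for c
        by (simp add: M_def matrix_vector_mult_def vec_eq_iff linear_sum[OF lin] linear_scale[OF lin] mult.commute)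
      have "c = 0" if "M *v c = 0" for c
      proof -
        let ?v = "\<Sum>a\<in>UNIV. c $ a *\<^sub>R b a"
        have "sd 1 (kgrad \<rho> q (F q) ?v) = 0" using that M df by simp
        then have k0: "kgrad \<rho> q (F q) ?v = 0"
          by (intro sd_eq_0_semidef[of 1]) (simp_all add: skew_kgrad[OF qU] pf)
        interpret D: alternating_form "dform \<rho> q ?v" by (rule alternating_dform[OF qU])
        have F0: "dform \<rho> q ?v (F q i) (F q j) = 0" if ij: "i < 4" "j < 4" for i j
        proof -
          obtain i' j' where e: "enum4 i' = i" "enum4 j' = j" using enum4_surj[OF ij(1)] enum4_surj[OF ij(2)] by blast
          have "kgrad \<rho> q (F q) ?v $ i' $ j' = 0" unfolding k0 by simp
          then show ?thesis by (simp only: kgrad_def vec_lambda_beta e)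
        qed
        have "dform \<rho> q ?v u w = 0" if uw: "\<forall>x'. \<rho> q u x' = 0" "\<forall>x'. \<rho> q w x' = 0" for u w
        proof -
          obtain cu where cu: "u = (\<Sum>i<4. cu i *\<^sub>R F q i)"
            by (rule pos_frame_kernel_span[OF alt[OF qU] card n2 pos uw(1)[rule_format]])
          obtain cw where cw: "w = (\<Sum>i<4. cw i *\<^sub>R F q i)"
            by (rule pos_frame_kernel_span[OF alt[OF qU] card n2 pos uw(2)[rule_format]])
          show ?thesis unfolding cu cw
            by (simp only: D.sum_left D.sum_right D.scale_left D.scale_right) (simp add: F0)
        qed
        then have "\<forall>a. c $ a = 0" by (intro b(2)) blast
        then show ?thesis by (simp add: vec_eq_iff)
      qed
      then have "det M \<noteq> 0" using det_nonzero_iff_ker by blast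
      then obtain N where N: "M ** N = mat 1" by (metis invertible_def invertible_det_nz)
      let ?v = "\<Sum>a\<in>UNIV. (N *v s) $ a *\<^sub>R b a"
      have "?Df ?v = s" unfolding M[symmetric] by (simp add: matrix_vector_mul_assoc N)
      moreover have "\<rho> q ?v w = 0" for w by (simp add: Q.sum_left Q.scale_left b(1))
      ultimately show ?thesis by blast
    qed
    show ?thesis unfolding adapted_at_def using pos df pf surj by blast
  qed
  show thesis by (rule that[OF Vopen pV VU smf zero_iff adapted])
qed

end

section \<open>Manifolds and forms in charts\<close>

lemma sum_fun_nth: "(\<Sum>x\<in>I. F x) y = (\<Sum>x\<in>I. F x y)" for F :: "'i \<Rightarrow> 'b \<Rightarrow> 'c::comm_monoid_add"
  by (induction I rule: infinite_finite_induct) simp_all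

lemma rank_nullity_onto:
  fixes f :: "'a::euclidean_space \<Rightarrow> 'b::euclidean_space"
  assumes f: "linear f" and K: "subspace K" and onto: "f ` K = UNIV"
  shows "dim {x \<in> K. f x = 0} + DIM('b) = dim K"
proof -
  obtain g where g: "range g \<subseteq> K" "linear g" "\<forall>v\<in>f ` K. f (g v) = v"
    using real_vector.linear_exists_right_inverse_on[OF f K] by blast
  have fg: "f (g v) = v" for v using g(3) onto by simp
  have inj: "inj g" by (rule injI) (metis fg)
  have sN: "subspace {x \<in> K. f x = 0}"
    using K unfolding subspace_def by (auto simp: linear_add[OF f] linear_scale[OF f] linear_0[OF f])
  have sR: "subspace (range g)" by (rule linear_subspace_image[OF g(2) subspace_UNIV])
  have dR: "dim (range g) = DIM('b)"
    using eucl.dim_image_eq[OF g(2), of UNIV] inj by simp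
  have "{x + y |x y. x \<in> {x \<in> K. f x = 0} \<and> y \<in> range g} = K"
  proof (intro equalityI subsetI)
    fix x assume "x \<in> {x + y |x y. x \<in> {x \<in> K. f x = 0} \<and> y \<in> range g}"
    then show "x \<in> K" using g(1) subspace_add[OF K] by blast
  next
    fix x assume x: "x \<in> K"
    have "x - g (f x) \<in> {x \<in> K. f x = 0}"
      using x g(1) subspace_diff[OF K] by (auto simp: linear_diff[OF f] fg)
    moreover have "x = (x - g (f x)) + g (f x)" by simp
    ultimately show "x \<in> {x + y |x y. x \<in> {x \<in> K. f x = 0} \<and> y \<in> range g}" by blast
  qed
  moreover have "{x \<in> K. f x = 0} \<inter> range g = {0}"
  proof -
    have "z = 0" if "f z = 0" "z \<in> range g" for z
      using that fg linear_0[OF g(2)] by auto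
    moreover have "0 \<in> range g" using linear_0[OF g(2)] by (metis rangeI)
    ultimately show ?thesis using subspace_0[OF K] linear_0[OF f] by blast
  qed
  ultimately show ?thesis using dim_sums_Int[OF sN sR] dR by simp
qed

lemma frame_mat_linear:
  fixes D :: "(real, 'k::{finite,linorder}) vec \<Rightarrow> (real, 'k) vec"
  assumes "linear D"
  shows "frame_mat (\<lambda>j. D (v j)) = matrix D ** frame_mat v"
proof -
  have "D (v (idx j)) $ i = (\<Sum>l\<in>UNIV. matrix D $ i $ l * v (idx j) $ l)" for i and j :: 'k
    unfolding matrix_vector_mul(2)[OF assms, THEN fun_cong, of "v (idx j)", symmetric] matrix_vector_mult_def by simp
  then show ?thesis by (simp add: frame_mat_def matrix_matrix_mult_def vec_eq_iff)
qed

text \<open>The manifold \<open>X\<close> with a fixed atlas \<open>A\<close>; \<open>Dtr c d p\<close> below is the change of coordinates of tangent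
  vectors at \<open>p\<close>.\<close>

locale atlas =
  fixes X :: "'a topology" and A :: "('a, 'k::finite) chart set"
  assumes smooth_manifold: "smooth_manifold X A"
begin

lemma chart_openin: "c \<in> A \<Longrightarrow> openin X (fst c)"
  and chart_open: "c \<in> A \<Longrightarrow> open (snd c ` fst c)"
  and chart_homeo: "c \<in> A \<Longrightarrow> homeomorphic_map (subtopology X (fst c)) (top_of_set (snd c ` fst c)) (snd c)"
  using smooth_manifold by (simp_all add: smooth_manifold_def chart_on_def)

lemma chart_subset: "c \<in> A \<Longrightarrow> fst c \<subseteq> topspace X"
  using chart_openin openin_subset by blast

lemma chart_topspace: "c \<in> A \<Longrightarrow> topspace (subtopology X (fst c)) = fst c"
  using chart_subset by (simp add: topspace_subtopology Int_absorb1)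

lemma chart_inj: "c \<in> A \<Longrightarrow> inj_on (snd c) (fst c)"
  using chart_homeo[of c] chart_topspace[of c] by (simp add: homeomorphic_map_def)

lemma chart_inv_chart: "c \<in> A \<Longrightarrow> p \<in> fst c \<Longrightarrow> chart_inv c (snd c p) = p"
  by (simp add: chart_inv_def chart_inj inv_into_f_f)

lemma chart_inv_in: "x \<in> snd c ` fst c \<Longrightarrow> chart_inv c x \<in> fst c"
  and chart_chart_inv: "x \<in> snd c ` fst c \<Longrightarrow> snd c (chart_inv c x) = x"
  by (simp_all add: chart_inv_def inv_into_into f_inv_into_f)

lemma chart_exists: "p \<in> topspace X \<Longrightarrow> \<exists>c\<in>A. p \<in> fst c"
  using smooth_manifold unfolding smooth_manifold_def by blast

lemma chart_image_open:
  assumes "c \<in> A" "openin X W"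
  shows "open (snd c ` (fst c \<inter> W))"
proof -
  have "openin (subtopology X (fst c)) (fst c \<inter> W)" by (rule openin_subtopology_Int2[OF assms(2)])
  then have "openin (top_of_set (snd c ` fst c)) (snd c ` (fst c \<inter> W))"
    using homeomorphic_imp_open_map[OF chart_homeo[OF assms(1)]] unfolding open_map_def by blast
  then show ?thesis using chart_open[OF assms(1)] by (simp add: openin_open_eq)
qed

lemma chart_continuous: "c \<in> A \<Longrightarrow> continuous_map (subtopology X (fst c)) euclidean (snd c)"
  using homeomorphic_imp_continuous_map[OF chart_homeo] continuous_map_into_fulltopology by blast

lemma chart_preimage_open:
  assumes "c \<in> A" "open V"
  shows "openin X {p \<in> fst c. snd c p \<in> V}"
proof -
  have "openin (subtopology X (fst c)) {p \<in> topspace (subtopology X (fst c)). snd c p \<in> V}"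
    by (rule openin_continuous_map_preimage[OF chart_continuous[OF assms(1)]]) (use assms(2) in simp)
  then have "openin (subtopology X (fst c)) {p \<in> fst c. snd c p \<in> V}"
    unfolding chart_topspace[OF assms(1)] .
  then show ?thesis using chart_openin[OF assms(1)] by (simp add: openin_open_subtopology)
qed

lemma chart_inv_continuous:
  assumes "c \<in> A"
  shows "continuous_map (top_of_set (snd c ` fst c)) X (chart_inv c)"
proof -
  obtain g where g: "homeomorphic_maps (subtopology X (fst c)) (top_of_set (snd c ` fst c)) (snd c) g"
    using chart_homeo[OF assms] by (auto simp: homeomorphic_map_maps)
  then have "continuous_map (top_of_set (snd c ` fst c)) (subtopology X (fst c)) g"
    by (simp add: homeomorphic_maps_def)
  then have "continuous_map (top_of_set (snd c ` fst c)) X g" by (rule continuous_map_into_fulltopology)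
  moreover have "g x = chart_inv c x" if "x \<in> topspace (top_of_set (snd c ` fst c))" for x
    using g that chart_topspace[OF assms] by (auto simp: homeomorphic_maps_def chart_inv_chart[OF assms])
  ultimately show ?thesis by (rule continuous_map_eq)
qed

lemma transition_at: "c \<in> A \<Longrightarrow> p \<in> fst c \<Longrightarrow> transition c d (snd c p) = snd d p"
  by (simp add: local_rep_def chart_inv_chart)

lemma overlap_open: "c \<in> A \<Longrightarrow> d \<in> A \<Longrightarrow> open (snd c ` (fst c \<inter> fst d))"
  by (rule chart_image_open[OF _ chart_openin])

lemma transition_smooth: "c \<in> A \<Longrightarrow> d \<in> A \<Longrightarrow> smooth_on (snd c ` (fst c \<inter> fst d)) (transition c d)"
  using smooth_manifold by (simp add: smooth_manifold_def)

abbreviation Dtr :: "('a, 'k) chart \<Rightarrow> ('a, 'k) chart \<Rightarrow> 'a \<Rightarrow> real ^ 'k \<Rightarrow> real ^ 'k" where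
  "Dtr c d p \<equiv> frechet_derivative (transition c d) (at (snd c p))"

lemma linear_Dtr: "c \<in> A \<Longrightarrow> d \<in> A \<Longrightarrow> p \<in> fst c \<Longrightarrow> p \<in> fst d \<Longrightarrow> linear (Dtr c d p)"
  by (rule linear_frechet_derivative_smooth[OF transition_smooth]) auto

lemma Dtr_id:
  assumes "c \<in> A" "p \<in> fst c"
  shows "Dtr c c p v = v"
proof -
  have "Dtr c c p = frechet_derivative (\<lambda>x. x) (at (snd c p))"
    by (rule frechet_derivative_cong_open[OF chart_open[OF assms(1)]])
      (use assms in \<open>auto simp: transition_at\<close>)
  also have "\<dots> = (\<lambda>x. x)" by (rule frechet_derivative_at[symmetric]) (rule has_derivative_ident)
  finally show ?thesis by simp
qed

lemma Dtr_Dtr: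
  assumes "c \<in> A" "d \<in> A" "e \<in> A" "p \<in> fst c" "p \<in> fst d" "p \<in> fst e"
  shows "Dtr d e p (Dtr c d p v) = Dtr c e p v"
proof -
  let ?S = "snd c ` (fst c \<inter> (fst d \<inter> fst e))"
  have op: "open ?S" by (rule chart_image_open[OF assms(1) openin_Int]) (use assms chart_openin in auto)
  have "Dtr c e p = frechet_derivative (\<lambda>x. transition d e (transition c d x)) (at (snd c p))"
    by (rule frechet_derivative_cong_open[OF op])
      (use assms in \<open>auto simp: transition_at\<close>)
  moreover have "frechet_derivative (\<lambda>x. transition d e (transition c d x)) (at (snd c p)) v
      = frechet_derivative (transition d e) (at (transition c d (snd c p))) (Dtr c d p v)"
    by (rule frechet_derivative_compose_smooth[OF transition_smooth[OF assms(1,2)] transition_smooth[OF assms(2,3)]])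
      (use assms in \<open>auto simp: transition_at\<close>)
  ultimately show ?thesis using assms by (simp add: transition_at)
qed

lemma coord_vector_nth: "d \<in> A \<Longrightarrow> p \<in> fst d \<Longrightarrow> coord_vector A c p e d = Dtr c d p e"
  by (simp add: coord_vector_def charts_at_def)

lemma coord_vector_self: "c \<in> A \<Longrightarrow> p \<in> fst c \<Longrightarrow> coord_vector A c p e c = e"
  by (simp add: coord_vector_nth Dtr_id)

lemma coord_vector_tangent:
  assumes "c \<in> A" "p \<in> fst c"
  shows "coord_vector A c p e \<in> tangent_space A p"
  unfolding tangent_space_def
proof (intro CollectI conjI allI ballI impI)
  show "coord_vector A c p e d = 0" if "d \<notin> charts_at A p" for d
    using that by (simp add: coord_vector_def)
  fix d d' assume "d \<in> charts_at A p" "d' \<in> charts_at A p"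
  then have "d \<in> A" "p \<in> fst d" "d' \<in> A" "p \<in> fst d'" by (simp_all add: charts_at_def)
  then show "coord_vector A c p e d' = Dtr d d' p (coord_vector A c p e d)"
    using assms by (simp only: coord_vector_nth Dtr_Dtr)
qed

lemma tangent_coord:
  assumes "v \<in> tangent_space A p" "c \<in> A" "p \<in> fst c"
  shows "coord_vector A c p (v c) = v"
proof
  fix d
  have c: "c \<in> charts_at A p" using assms by (simp add: charts_at_def)
  show "coord_vector A c p (v c) d = v d"
  proof (cases "d \<in> charts_at A p")
    case True
    then have "v d = Dtr c d p (v c)" using assms(1) c unfolding tangent_space_def by blast
    then show ?thesis using True by (simp add: coord_vector_def)
  next
    case False
    then have "v d = 0" using assms(1) unfolding tangent_space_def by blast
    then show ?thesis using False by (simp add: coord_vector_def)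
  qed
qed

lemma coord_vector_add:
  assumes "c \<in> A" "p \<in> fst c"
  shows "coord_vector A c p (a *\<^sub>R u + b *\<^sub>R v) = (\<lambda>d. a *\<^sub>R coord_vector A c p u d + b *\<^sub>R coord_vector A c p v d)"
proof
  fix d
  show "coord_vector A c p (a *\<^sub>R u + b *\<^sub>R v) d = a *\<^sub>R coord_vector A c p u d + b *\<^sub>R coord_vector A c p v d"
    using linear_Dtr[OF assms(1) _ assms(2), of d]
    by (simp add: coord_vector_def charts_at_def linear_add linear_scale)
qed

text \<open>Coordinates in a chart are linear, which turns dimensions of spaces of tangent vectors into dimensions
  in Euclidean space.\<close>

lemma tangent_sum:
  assumes "c \<in> A" "p \<in> fst c" "finite B" "B \<subseteq> tangent_space A p"
  shows "(\<Sum>b\<in>B. tvec_scale (f b) b) = coord_vector A c p (\<Sum>b\<in>B. f b *\<^sub>R b c)"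
  using assms(3,4)
proof (induction B)
  case empty
  have "coord_vector A c p (0 *\<^sub>R 0 + 0 *\<^sub>R 0) = 0"
    unfolding coord_vector_add[OF assms(1,2)] by (simp add: fun_eq_iff)
  then show ?case by simp
next
  case (insert x B)
  have "coord_vector A c p (f x *\<^sub>R x c + 1 *\<^sub>R (\<Sum>b\<in>B. f b *\<^sub>R b c)) = tvec_scale (f x) x + (\<Sum>b\<in>B. tvec_scale (f b) b)"
    unfolding coord_vector_add[OF assms(1,2)] using insert tangent_coord[OF _ assms(1,2), of x]
    by (simp add: fun_eq_iff)
  then show ?case using insert by simp
qed

end

locale form_on_manifold = atlas X A for X :: "'a topology" and A :: "('a, 'k::finite) chart set" +
  fixes \<omega> :: "('a, 'k) form2"
  assumes smooth_form2: "smooth_form2 X A \<omega>"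
begin

lemma form_tangent:
  assumes "c \<in> A" "p \<in> fst c" "u \<in> tangent_space A p" "w \<in> tangent_space A p"
  shows "\<omega> p u w = form_rep A \<omega> c (snd c p) (u c) (w c)"
  using assms by (simp add: form_rep_def chart_inv_chart tangent_coord)

lemma alternating_form_rep:
  assumes "c \<in> A" "x \<in> snd c ` fst c"
  shows "alternating_form (form_rep A \<omega> c x)"
proof -
  let ?p = "chart_inv c x" and ?C = "coord_vector A c (chart_inv c x)"
  have p: "?p \<in> fst c" by (rule chart_inv_in[OF assms(2)])
  have T: "?C e \<in> tangent_space A ?p" for e by (rule coord_vector_tangent[OF assms(1) p])
  have pX: "?p \<in> topspace X" using chart_subset[OF assms(1)] p by blast
  have lin: "\<omega> ?p (\<lambda>c'. a *\<^sub>R ?C u c' + b *\<^sub>R ?C v c') (?C w) = a * \<omega> ?p (?C u) (?C w) + b * \<omega> ?p (?C v) (?C w)"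
    and skew: "\<omega> ?p (?C u) (?C v) = - \<omega> ?p (?C v) (?C u)" for a b u v w
    using smooth_form2[unfolded smooth_form2_def, THEN conjunct1, rule_format, OF pX T T T] by blast+
  show ?thesis
  proof (rule alternating_form.intro)
    show "form_rep A \<omega> c x (u + v) w = form_rep A \<omega> c x u w + form_rep A \<omega> c x v w" for u v w
      using lin[of 1 u 1 v w] coord_vector_add[OF assms(1) p, of 1 u 1 v] by (simp add: form_rep_def)
    show "form_rep A \<omega> c x (a *\<^sub>R u) w = a * form_rep A \<omega> c x u w" for a u w
      using lin[of a u 0 0 w] coord_vector_add[OF assms(1) p, of a u 0 0] by (simp add: form_rep_def)
    show "form_rep A \<omega> c x u w = - form_rep A \<omega> c x w u" for u w
      unfolding form_rep_def by (rule skew)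
  qed
qed

lemma form_family_chart:
  assumes "c \<in> A"
  shows "form_family (snd c ` fst c) (form_rep A \<omega> c)"
proof (rule form_family.intro)
  show "open (snd c ` fst c)" by (rule chart_open[OF assms])
  show "alternating_form (form_rep A \<omega> c x)" if "x \<in> snd c ` fst c" for x
    by (rule alternating_form_rep[OF assms that])
  show "smooth_on (snd c ` fst c) (\<lambda>x. form_rep A \<omega> c x u w)" for u w
    using smooth_form2 assms unfolding smooth_form2_def by blast
qed

lemma form_rep_transition:
  assumes "c \<in> A" "d \<in> A" "p \<in> fst c" "p \<in> fst d"
  shows "form_rep A \<omega> c (snd c p) u w = form_rep A \<omega> d (snd d p) (Dtr c d p u) (Dtr c d p w)"
proof -
  have "form_rep A \<omega> c (snd c p) u w = \<omega> p (coord_vector A c p u) (coord_vector A c p w)"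
    using assms by (simp add: form_rep_def chart_inv_chart)
  also have "\<dots> = form_rep A \<omega> d (snd d p) (coord_vector A c p u d) (coord_vector A c p w d)"
    by (rule form_tangent) (use assms coord_vector_tangent in auto)
  finally show ?thesis using assms by (simp add: coord_vector_nth)
qed

lemma power_vanishes_iff:
  assumes "c \<in> A" "p \<in> fst c"
  shows "power_vanishes_at A \<omega> m p \<longleftrightarrow> (\<forall>v. wedge_power (form_rep A \<omega> c (snd c p)) m v = 0)"
proof
  assume pv: "power_vanishes_at A \<omega> m p"
  show "\<forall>v. wedge_power (form_rep A \<omega> c (snd c p)) m v = 0"
  proof
    fix v :: "nat \<Rightarrow> real ^ 'k"
    have "wedge_power (form_rep A \<omega> c (snd c p)) m v = wedge_power (\<omega> p) m (\<lambda>i. coord_vector A c p (v i))"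
      using assms by (intro wedge_power_cong) (simp add: form_rep_def chart_inv_chart)
    then show "wedge_power (form_rep A \<omega> c (snd c p)) m v = 0"
      using pv coord_vector_tangent[OF assms] by (simp add: power_vanishes_at_def)
  qed
next
  assume z: "\<forall>v. wedge_power (form_rep A \<omega> c (snd c p)) m v = 0"
  show "power_vanishes_at A \<omega> m p"
    unfolding power_vanishes_at_def
  proof (intro allI impI)
    fix v :: "nat \<Rightarrow> ('a, 'k) tvec" assume v: "\<forall>i. v i \<in> tangent_space A p"
    have "wedge_power (\<omega> p) m v = wedge_power (form_rep A \<omega> c (snd c p)) m (\<lambda>i. v i c)"
      using assms v by (intro wedge_power_cong form_tangent) auto
    then show "wedge_power (\<omega> p) m v = 0" using z by simp
  qed
qed

lemma kernel_iff:
  assumes "c \<in> A" "p \<in> fst c"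
  shows "v \<in> form_kernel A \<omega> p \<longleftrightarrow> v \<in> tangent_space A p \<and> (\<forall>w. form_rep A \<omega> c (snd c p) (v c) w = 0)"
proof (cases "v \<in> tangent_space A p")
  case True
  have "(\<forall>w\<in>tangent_space A p. \<omega> p v w = 0) \<longleftrightarrow> (\<forall>w. form_rep A \<omega> c (snd c p) (v c) w = 0)"
  proof
    assume k: "\<forall>w\<in>tangent_space A p. \<omega> p v w = 0"
    show "\<forall>w. form_rep A \<omega> c (snd c p) (v c) w = 0"
    proof
      fix w
      have "\<omega> p v (coord_vector A c p w) = form_rep A \<omega> c (snd c p) (v c) (coord_vector A c p w c)"
        by (rule form_tangent[OF assms True coord_vector_tangent[OF assms]])
      then show "form_rep A \<omega> c (snd c p) (v c) w = 0"
        using k coord_vector_tangent[OF assms, of w] by (simp add: coord_vector_self[OF assms])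
    qed
  next
    assume "\<forall>w. form_rep A \<omega> c (snd c p) (v c) w = 0"
    then show "\<forall>w\<in>tangent_space A p. \<omega> p v w = 0" using form_tangent[OF assms True] by simp
  qed
  then show ?thesis using True by (simp add: form_kernel_def)
qed (simp add: form_kernel_def)

lemma dim_kernel:
  assumes c: "c \<in> A" "p \<in> fst c"
    and dim: "vector_space.dim tvec_scale (form_kernel A \<omega> p) = 4"
  shows "dim {u. \<forall>w. form_rep A \<omega> c (snd c p) u w = 0} = 4"
proof -
  interpret T: vector_space "tvec_scale :: real \<Rightarrow> ('a, 'k) tvec \<Rightarrow> ('a, 'k) tvec"
    by (rule vector_space_tvec_scale)
  obtain B where B: "B \<subseteq> form_kernel A \<omega> p" "T.independent B" "form_kernel A \<omega> p \<subseteq> T.span B"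
    "card B = T.dim (form_kernel A \<omega> p)" using T.basis_exists by blast
  have card: "card B = 4" using B(4) dim by simp
  have fin: "finite B" using card card.infinite by fastforce
  have BT: "B \<subseteq> tangent_space A p" using B(1) by (auto simp: form_kernel_def)
  have inj: "inj_on (\<lambda>v. v c) B"
    by (rule inj_onI) (metis BT subsetD tangent_coord[OF _ c])
  let ?B = "(\<lambda>v. v c) ` B"
  have "independent ?B"
  proof
    assume "dependent ?B"
    then obtain f where f: "\<exists>y\<in>?B. f y \<noteq> 0" "(\<Sum>y\<in>?B. f y *\<^sub>R y) = 0"
      using dependent_finite[of ?B] fin by auto
    have "(\<Sum>b\<in>B. f (b c) *\<^sub>R b c) = 0" using f(2) by (simp add: sum.reindex[OF inj])
    then have "(\<Sum>b\<in>B. tvec_scale (f (b c)) b) = coord_vector A c p 0"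
      using tangent_sum[OF c fin BT, of "\<lambda>b. f (b c)"] by simp
    also have "\<dots> = 0" using tangent_sum[OF c finite.emptyI empty_subsetI] by simp
    finally have "T.dependent B" using f(1) T.dependent_finite[OF fin] by auto
    with B(2) show False by blast
  qed
  moreover have "?B \<subseteq> {u. \<forall>w. form_rep A \<omega> c (snd c p) u w = 0}"
    using B(1) kernel_iff[OF c] by auto
  moreover have "{u. \<forall>w. form_rep A \<omega> c (snd c p) u w = 0} \<subseteq> span ?B"
  proof
    fix u assume "u \<in> {u. \<forall>w. form_rep A \<omega> c (snd c p) u w = 0}"
    then have "coord_vector A c p u \<in> form_kernel A \<omega> p"
      using kernel_iff[OF c] coord_vector_tangent[OF c] coord_vector_self[OF c] by simp
    then have "coord_vector A c p u \<in> T.span B" using B(3) by blast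
    then obtain f where "coord_vector A c p u = (\<Sum>b\<in>B. tvec_scale (f b) b)"
      unfolding T.span_finite[OF fin] by blast
    then have "coord_vector A c p u c = coord_vector A c p (\<Sum>b\<in>B. f b *\<^sub>R b c) c"
      using tangent_sum[OF c fin BT] by simp
    then have "u = (\<Sum>b\<in>B. f b *\<^sub>R b c)" by (simp only: coord_vector_self[OF c])
    also have "\<dots> \<in> span ?B" by (intro span_sum span_scale span_base) simp
    finally show "u \<in> span ?B" .
  qed
  moreover have "card ?B = 4" using card card_image[OF inj] by simp
  ultimately show ?thesis using dim_unique by blast
qed

text \<open>Kernel vectors whose gradients form a basis of the image.\<close>

lemma gradient_rank:
  assumes c: "c \<in> A" "p \<in> fst c"
    and dim: "vector_space.dim bifun_scale (kernel_gradient A \<omega> p c ` form_kernel A \<omega> p) = 3"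
  shows "\<exists>b :: 3 \<Rightarrow> real ^ 'k. (\<forall>a w. form_rep A \<omega> c (snd c p) (b a) w = 0) \<and>
    (\<forall>f. (\<forall>u w. (\<forall>x'. form_rep A \<omega> c (snd c p) u x' = 0) \<longrightarrow> (\<forall>x'. form_rep A \<omega> c (snd c p) w x' = 0)
        \<longrightarrow> dform (form_rep A \<omega> c) (snd c p) (\<Sum>a\<in>UNIV. f a *\<^sub>R b a) u w = 0)
      \<longrightarrow> (\<forall>a. f a = 0))"
proof -
  interpret T: vector_space "bifun_scale :: real \<Rightarrow> (('a, 'k) tvec \<Rightarrow> ('a, 'k) tvec \<Rightarrow> real) \<Rightarrow> _"
    by (rule vector_space_bifun_scale)
  interpret F: form_family "snd c ` fst c" "form_rep A \<omega> c" by (rule form_family_chart[OF c(1)])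
  have x: "snd c p \<in> snd c ` fst c" using c by blast
  let ?G = "kernel_gradient A \<omega> p c ` form_kernel A \<omega> p"
  obtain B where B: "B \<subseteq> ?G" "T.independent B" and cardB: "card B = T.dim ?G"
    by (rule T.basis_exists[of ?G])
  have card: "card B = 3" by (rule trans[OF cardB dim])
  have fin: "finite B" by (rule card_ge_0_finite) (simp only: card zero_less_numeral)
  have "card (UNIV :: 3 set) = card B" unfolding card by simp
  then obtain e where e: "bij_betw e (UNIV :: 3 set) B"
    using finite_same_card_bij[OF finite_class.finite_UNIV fin] by blast
  have "\<forall>a. \<exists>v. v \<in> form_kernel A \<omega> p \<and> kernel_gradient A \<omega> p c v = e a"
  proof
    fix a
    have "e a \<in> kernel_gradient A \<omega> p c ` form_kernel A \<omega> p" using bij_betwE[OF e] B(1) by blast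
    then obtain v where "e a = kernel_gradient A \<omega> p c v" "v \<in> form_kernel A \<omega> p" by (rule imageE)
    then show "\<exists>v. v \<in> form_kernel A \<omega> p \<and> kernel_gradient A \<omega> p c v = e a"
      by (intro exI[of _ v] conjI) (simp_all only:)
  qed
  from choice[OF this] obtain v where
    "\<forall>a. v a \<in> form_kernel A \<omega> p \<and> kernel_gradient A \<omega> p c (v a) = e a" ..
  then have v: "v a \<in> form_kernel A \<omega> p" "kernel_gradient A \<omega> p c (v a) = e a" for a by simp_all
  show ?thesis
  proof (intro exI[of _ "\<lambda>a. v a c"] conjI allI impI)
    show "form_rep A \<omega> c (snd c p) (v a c) w = 0" for a w using v(1)[of a] kernel_iff[OF c, of "v a"] by blast
    fix f :: "3 \<Rightarrow> real" and a
    assume 0: "\<forall>u w. (\<forall>x'. form_rep A \<omega> c (snd c p) u x' = 0) \<longrightarrow> (\<forall>x'. form_rep A \<omega> c (snd c p) w x' = 0)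
        \<longrightarrow> dform (form_rep A \<omega> c) (snd c p) (\<Sum>a\<in>UNIV. f a *\<^sub>R v a c) u w = 0"
    let ?f = "\<lambda>y. f (inv_into UNIV e y)"
    have inv: "inv_into UNIV e (e a) = a" for a using bij_betw_inv_into_left[OF e] by simp
    have zero: "(\<Sum>y\<in>B. bifun_scale (?f y) y) = 0"
    proof (intro ext)
      fix t t'
      have "(\<Sum>y\<in>B. bifun_scale (?f y) y) t t' = (\<Sum>y\<in>B. ?f y * y t t')" by (simp add: sum_fun_nth)
      also have "\<dots> = (\<Sum>a\<in>UNIV. ?f (e a) * e a t t')" by (rule sum.reindex_bij_betw[OF e, symmetric])
      also have "\<dots> = (\<Sum>a\<in>UNIV. f a * kernel_gradient A \<omega> p c (v a) t t')" by (simp only: inv v(2))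
      also have "\<dots> = 0"
      proof (cases "t \<in> form_kernel A \<omega> p \<and> t' \<in> form_kernel A \<omega> p")
        case True
        have "(\<Sum>a\<in>UNIV. f a * kernel_gradient A \<omega> p c (v a) t t')
            = (\<Sum>a\<in>UNIV. f a * dform (form_rep A \<omega> c) (snd c p) (v a c) (t c) (t' c))"
          using True by (simp add: kernel_gradient_def dform_def)
        also have "\<dots> = dform (form_rep A \<omega> c) (snd c p) (\<Sum>a\<in>UNIV. f a *\<^sub>R v a c) (t c) (t' c)"
          by (simp add: linear_sum[OF F.linear_dform[OF x]] linear_scale[OF F.linear_dform[OF x]])
        also have "\<dots> = 0"
        proof (rule 0[rule_format])
          show "form_rep A \<omega> c (snd c p) (t c) x' = 0" for x' using True kernel_iff[OF c, of t] by blast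
          show "form_rep A \<omega> c (snd c p) (t' c) x' = 0" for x' using True kernel_iff[OF c, of t'] by blast
        qed
        finally show ?thesis .
      next
        case False
        then have "kernel_gradient A \<omega> p c (v a) t t' = 0" for a by (simp only: kernel_gradient_def if_False)
        then show ?thesis by simp
      qed
      finally show "(\<Sum>y\<in>B. bifun_scale (?f y) y) t t' = 0 t t'" by simp
    qed
    have "\<not> (\<exists>u. (\<exists>y\<in>B. u y \<noteq> 0) \<and> (\<Sum>y\<in>B. bifun_scale (u y) y) = 0)"
      using B(2) unfolding T.dependent_finite[OF fin] .
    then have "\<not> ((\<exists>y\<in>B. ?f y \<noteq> 0) \<and> (\<Sum>y\<in>B. bifun_scale (?f y) y) = 0)" unfolding not_ex by (rule spec)
    then have "\<forall>y\<in>B. ?f y = 0" unfolding zero by blast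
    moreover have "e a \<in> B" using bij_betwE[OF e] by blast
    ultimately have "?f (e a) = 0" by blast
    then show "f a = 0" unfolding inv .
  qed
qed

end

locale near_symplectic_manifold =
  fixes M :: "'a topology" and A :: "('a, 'k::{finite,linorder}) chart set" and \<omega> :: "('a, 'k) form2" and n :: nat
  assumes oriented: "oriented_manifold M A" and cardk: "CARD('k) = 2 * n" and n2: "2 \<le> n"
    and ns: "near_symplectic M A n \<omega>"
begin

sublocale form_on_manifold M A \<omega>
proof
  show "smooth_manifold M A" using oriented unfolding oriented_manifold_def by blast
  show "smooth_form2 M A \<omega>" using ns unfolding near_symplectic_def closed_form2_def by blast
qed

lemma det_Dtr_pos:
  "c \<in> A \<Longrightarrow> d \<in> A \<Longrightarrow> p \<in> fst c \<Longrightarrow> p \<in> fst d \<Longrightarrow> det (matrix (Dtr c d p)) > 0"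
  using oriented unfolding oriented_manifold_def by blast

text \<open>So the conditions at degenerate points apply on the singular locus.\<close>

lemma power_n_vanishes:
  assumes "power_vanishes_at A \<omega> (n - 1) p"
  shows "power_vanishes_at A \<omega> n p"
proof -
  have "wedge_power (\<omega> p) (Suc (n - 1)) v = 0" if "\<And>i. v i \<in> tangent_space A p" for v
    by (rule wedge_power_Suc_eq_0[where T = "tangent_space A p"]) (use assms that in \<open>simp_all add: power_vanishes_at_def\<close>)
  then show ?thesis using n2 by (simp add: power_vanishes_at_def)
qed

lemma family_chart:
  assumes c: "c \<in> A"
  shows "near_symplectic_family (snd c ` fst c) (form_rep A \<omega> c) n"
proof (intro near_symplectic_family.intro form_family_chart[OF c] near_symplectic_family_axioms.intro cardk n2)
  fix x assume x: "x \<in> snd c ` fst c"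
  then obtain p where p: "p \<in> fst c" "x = snd c p" by blast
  have pM: "p \<in> topspace M" using p chart_subset[OF c] by blast
  show "0 \<le> wedge_power (form_rep A \<omega> c x) n v" if pos: "0 < det (frame_mat v)" for v
  proof -
    let ?t = "\<lambda>i. coord_vector A c p (v i)"
    have "oriented_frame A p ?t"
      unfolding oriented_frame_def
    proof (intro conjI allI ballI)
      fix d assume "d \<in> charts_at A p"
      then have d: "d \<in> A" "p \<in> fst d" by (auto simp: charts_at_def)
      have "(\<chi> i j. ?t (card {k. k < j}) d $ i) = frame_mat (\<lambda>j. Dtr c d p (v j))"
        by (simp add: frame_mat_def idx_def coord_vector_nth d)
      also have "\<dots> = matrix (Dtr c d p) ** frame_mat v"
        by (rule frame_mat_linear[OF linear_Dtr[OF c d(1) p(1) d(2)]])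
      finally show "0 < det (\<chi> i j. ?t (card {k. k < j}) d $ i)"
        using det_Dtr_pos[OF c d(1) p(1) d(2)] pos by (simp add: det_mul)
    qed (rule coord_vector_tangent[OF c p(1)])
    then have "0 \<le> wedge_power (\<omega> p) n ?t" using ns pM unfolding near_symplectic_def by blast
    also have "\<dots> = wedge_power (form_rep A \<omega> c x) n v"
      using p c by (intro wedge_power_cong) (simp add: form_rep_def chart_inv_chart)
    finally show ?thesis .
  qed
  assume v: "\<And>v. wedge_power (form_rep A \<omega> c x) (n - 1) v = 0"
  then have "power_vanishes_at A \<omega> (n - 1) p" using power_vanishes_iff[OF c p(1)] p(2) by simp
  then have "power_vanishes_at A \<omega> n p" by (rule power_n_vanishes)
  then have *: "vector_space.dim tvec_scale (form_kernel A \<omega> p) = 4"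
    "vector_space.dim bifun_scale (kernel_gradient A \<omega> p c ` form_kernel A \<omega> p) = 3"
  proof -
    have "c \<in> charts_at A p" using c p(1) by (simp add: charts_at_def)
    then show "vector_space.dim tvec_scale (form_kernel A \<omega> p) = 4"
      "vector_space.dim bifun_scale (kernel_gradient A \<omega> p c ` form_kernel A \<omega> p) = 3"
      using ns pM \<open>power_vanishes_at A \<omega> n p\<close> unfolding near_symplectic_def by blast+
  qed
  show "dim {u. \<forall>w. form_rep A \<omega> c x u w = 0} = 4"
    unfolding p(2) by (rule dim_kernel[OF c p(1) *(1)])
  show "\<exists>b :: 3 \<Rightarrow> (real, 'k) vec. (\<forall>a w. form_rep A \<omega> c x (b a) w = 0) \<and>
    (\<forall>f. (\<forall>u w. (\<forall>x'. form_rep A \<omega> c x u x' = 0) \<longrightarrow> (\<forall>x'. form_rep A \<omega> c x w x' = 0)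
        \<longrightarrow> dform (form_rep A \<omega> c) x (\<Sum>a\<in>UNIV. f a *\<^sub>R b a) u w = 0)
      \<longrightarrow> (\<forall>a. f a = 0))"
    unfolding p(2) by (rule gradient_rank[OF c p(1) *(2)])
qed

abbreviation Z :: "'a set" where "Z \<equiv> singular_locus M A n \<omega>"

abbreviation csing :: "('a, 'k) chart \<Rightarrow> (real, 'k) vec set" where
  "csing c \<equiv> near_symplectic_family.sing (snd c ` fst c) (form_rep A \<omega> c) n"

lemma csing_iff:
  assumes "c \<in> A" "p \<in> fst c"
  shows "snd c p \<in> csing c \<longleftrightarrow> p \<in> Z"
proof -
  have "p \<in> topspace M" using chart_subset[OF assms(1)] assms(2) by blast
  then show ?thesis
    unfolding near_symplectic_family.sing_def[OF family_chart[OF assms(1)]] singular_locus_def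
    using power_vanishes_iff[OF assms, of "n - 1"] assms(2) by blast
qed

end

section \<open>Charts of the singular locus\<close>

lemma linear_join:
  assumes "linear f" "linear g"
  shows "linear (\<lambda>v. join P Q (f v) (g v))"
  by (rule linearI) (simp_all add: linear_add[OF assms(1)] linear_add[OF assms(2)]
      linear_scale[OF assms(1)] linear_scale[OF assms(2)] join_add join_scale)

lemma split_index_card:
  fixes P :: "3 \<Rightarrow> 'k::finite" and Q :: "'l::finite \<Rightarrow> 'k"
  assumes "split_index P Q"
  shows "CARD('k) = CARD('l) + 3"
proof -
  have "CARD('k) = card (range P \<union> range Q)" using assms by (simp add: split_index_def)
  also have "\<dots> = card (range P) + card (range Q)"
    using assms by (intro card_Un_disjoint) (auto simp: split_index_def)
  also have "\<dots> = CARD(3) + CARD('l)"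
    using assms by (simp only: split_index_def card_image)
  finally show ?thesis by simp
qed

lemma matrix_linear_mult: "linear g \<Longrightarrow> matrix g *v v = g v" for g :: "real ^ 'm \<Rightarrow> real ^ 'n"
  using matrix_vector_mul(2)[of g] by (simp add: fun_eq_iff)

text \<open>A map onto \<open>\<real>\<^sup>3\<close> is completed to an orientation preserving isomorphism by a coordinate map on
  its kernel.\<close>

lemma complementary_map:
  fixes P :: "3 \<Rightarrow> 'k::finite" and Q :: "'l::finite \<Rightarrow> 'k" and D :: "real ^ 'k \<Rightarrow> real ^ 3"
  assumes PQ: "split_index P Q" and D: "linear D" "surj D"
  obtains L :: "real ^ 'k \<Rightarrow> real ^ 'l" where "linear L" "det (matrix (\<lambda>v. join P Q (D v) (L v))) > 0"
proof -
  let ?N = "{v \<in> UNIV. D v = 0}"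
  have sN: "subspace ?N"
    unfolding subspace_def by (simp add: linear_0[OF D(1)] linear_add[OF D(1)] linear_scale[OF D(1)])
  have "dim ?N + DIM(real ^ 3) = dim (UNIV :: (real ^ 'k) set)"
    by (rule rank_nullity_onto[OF D(1) subspace_UNIV D(2)])
  then have "dim ?N = dim (UNIV :: (real ^ 'l) set)"
    using split_index_card[OF PQ] by (simp add: dim_UNIV)
  then obtain L where L: "linear L" "\<And>v. v \<in> ?N \<Longrightarrow> norm (L v :: real ^ 'l) = norm v"
    by (rule isometries_subspaces[OF sN subspace_UNIV]) (rule that, assumption, assumption)
  let ?G = "\<lambda>v. join P Q (D v) (L v)"
  have nz: "det (matrix ?G) \<noteq> 0"
    unfolding det_nonzero_iff_ker matrix_linear_mult[OF linear_join[OF D(1) L(1)]]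
  proof (intro allI impI)
    fix v assume "?G v = 0"
    then have "?G v = join P Q 0 0" by (simp only: join_0)
    then have "D v = 0" "L v = 0" by (simp_all add: join_eq_iff[OF PQ])
    then show "v = 0" using L(2)[of v] by simp
  qed
  show thesis
  proof (cases "det (matrix ?G) > 0")
    case True then show ?thesis using that L(1) by blast
  next
    case False
    define b0 :: 'l where "b0 = undefined"
    define L' where "L' v = (\<chi> b. if b = b0 then - (L v $ b) else L v $ b)" for v
    have L': "linear L'"
      by (rule linearI) (simp_all add: L'_def vec_eq_iff linear_add[OF L(1)] linear_scale[OF L(1)])
    let ?G' = "\<lambda>v. join P Q (D v) (L' v)"
    have "matrix ?G' = (\<chi> i. if i = Q b0 then (- 1) *s (matrix ?G $ i) else matrix ?G $ i)"
    proof -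
      have "?G' v $ i = (if i = Q b0 then - (?G v $ i) else ?G v $ i)" for v i
      proof -
        have "i \<in> range P \<union> range Q" using PQ by (simp add: split_index_def)
        then consider a where "i = P a" | b where "i = Q b" by blast
        then show ?thesis
        proof cases
          case 1
          then have "i \<noteq> Q b0" using PQ unfolding split_index_def by blast
          then show ?thesis using 1 by (simp add: join_nth[OF PQ])
        next
          case 2
          have "Q b = Q b0 \<longleftrightarrow> b = b0" using PQ by (simp add: split_index_def inj_eq)
          then show ?thesis using 2 by (simp add: join_nth[OF PQ] L'_def)
        qed
      qed
      then show ?thesis by (simp add: matrix_def vec_eq_iff)
    qed
    then have "det (matrix ?G') = - 1 * det (\<chi> i. if i = Q b0 then matrix ?G $ i else matrix ?G $ i)"
      by (simp only: det_row_mul)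
    then have "det (matrix ?G') = - det (matrix ?G)" by simp
    then show ?thesis using that[OF L'] False nz by simp
  qed
qed

lemma linear_bounded: "linear g \<Longrightarrow> bounded_linear g" for g :: "'v::euclidean_space \<Rightarrow> 'w::real_normed_vector"
  by (rule linear_conv_bounded_linear[THEN iffD1])

lemma frechet_derivative_linear: "linear g \<Longrightarrow> frechet_derivative g (at x) = g" for g :: "'v::euclidean_space \<Rightarrow> 'w::real_normed_vector"
  by (rule frechet_derivative_at[symmetric]) (rule bounded_linear_imp_has_derivative[OF linear_bounded])

lemma smooth_on_linear: "linear g \<Longrightarrow> open S \<Longrightarrow> smooth_on S g" for g :: "'v::euclidean_space \<Rightarrow> 'w::real_normed_vector"
  by (rule smooth_on_bounded_linear[OF linear_bounded])

lemma join_derivative: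
  fixes f :: "real ^ 'k::finite \<Rightarrow> real ^ 3" and L :: "real ^ 'k \<Rightarrow> real ^ 'l::finite"
  assumes "open V" "smooth_on V f" "linear L"
  shows "smooth_on V (\<lambda>x. join P Q (f x) (L x))"
    and "x \<in> V \<Longrightarrow> frechet_derivative (\<lambda>x. join P Q (f x) (L x)) (at x) v = join P Q (frechet_derivative f (at x) v) (L v)"
proof -
  have l1: "linear (\<lambda>s. join P Q s 0)" and l2: "linear (\<lambda>z. join P Q 0 z)"
    using linear_join[OF linear_ident module_hom_zero, of P Q] linear_join[OF module_hom_zero linear_ident, of P Q] by blast+
  have split: "join P Q s z = join P Q s 0 + join P Q 0 z" for s z by (simp flip: join_add)
  have l2L: "linear (\<lambda>x. join P Q 0 (L x))" using linear_compose[OF assms(3) l2] by (simp add: o_def)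
  show "smooth_on V (\<lambda>x. join P Q (f x) (L x))"
    by (subst split) (intro smooth_on_add assms(1) smooth_on_compose_linear[OF linear_bounded[OF l1]] assms(2) smooth_on_linear[OF l2L])
  assume x: "x \<in> V"
  have "((\<lambda>x. join P Q (f x) 0 + join P Q 0 (L x)) has_derivative
      (\<lambda>v. join P Q (frechet_derivative f (at x) v) 0 + join P Q 0 (L v))) (at x)"
    by (intro has_derivative_add bounded_linear.has_derivative[OF linear_bounded[OF l1]] smooth_on_has_derivative[OF assms(2) x]
        bounded_linear_imp_has_derivative[OF linear_bounded[OF l2L]])
  then have "((\<lambda>x. join P Q (f x) (L x)) has_derivative (\<lambda>v. join P Q (frechet_derivative f (at x) v) (L v))) (at x)"
    by (simp only: split[symmetric])
  from frechet_derivative_at[OF this] show "frechet_derivative (\<lambda>x. join P Q (f x) (L x)) (at x) v = join P Q (frechet_derivative f (at x) v) (L v)"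
    by (simp only: fun_eq_iff)
qed

text \<open>Three of the coordinates of \<open>M\<close> are set apart as normal coordinates; the others index the coordinates of
  the singular locus.  The choice fixes the orientation convention.\<close>

locale split_near_symplectic_manifold = near_symplectic_manifold M A \<omega> n
  for M :: "'a topology" and A :: "('a, 'k::{finite,linorder}) chart set" and \<omega> :: "('a, 'k) form2" and n :: nat +
  fixes P :: "3 \<Rightarrow> 'k" and Q :: "'l::finite \<Rightarrow> 'k"
  assumes split: "split_index P Q"
begin

abbreviation rep where "rep c \<equiv> form_rep A \<omega> c"

text \<open>The data of a submanifold chart: in the chart \<open>c\<close> of \<open>M\<close>, the singular locus is on \<open>V\<close> the zero set
  of \<open>f\<close>; the linear map \<open>L\<close> completes \<open>f\<close> to an oriented coordinate system at the singular points, so its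
  restriction is a chart of the singular locus, and \<open>h\<close> is the parametrisation inverse to it.\<close>

definition adapted :: "('a, 'k) chart \<Rightarrow> (real, 'k) vec set \<Rightarrow> ((real, 'k) vec \<Rightarrow> real ^ 3)
    \<Rightarrow> ((real, 'k) vec \<Rightarrow> real ^ 'l) \<Rightarrow> (real ^ 'l \<Rightarrow> (real, 'k) vec) \<Rightarrow> bool" where
  "adapted c V f L h \<longleftrightarrow> c \<in> A \<and> open V \<and> V \<subseteq> snd c ` fst c \<and> smooth_on V f \<and> linear L \<and>
     open (L ` (V \<inter> csing c)) \<and> smooth_on (L ` (V \<inter> csing c)) h \<and>
     (\<forall>x\<in>V. f x = 0 \<longleftrightarrow> x \<in> csing c) \<and>
     (\<forall>x\<in>V \<inter> csing c. near_symplectic_family.adapted_at (rep c) n f x \<and>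
        det (matrix (\<lambda>v. join P Q (frechet_derivative f (at x) v) (L v))) > 0 \<and> h (L x) = x)"

definition zdom :: "('a, 'k) chart \<Rightarrow> (real, 'k) vec set \<Rightarrow> 'a set" where
  "zdom c V = {p \<in> fst c. snd c p \<in> V} \<inter> Z"

definition zchart :: "('a, 'k) chart \<Rightarrow> (real, 'k) vec set \<Rightarrow> ((real, 'k) vec \<Rightarrow> real ^ 'l) \<Rightarrow> ('a, 'l) chart" where
  "zchart c V L = (zdom c V, \<lambda>p. L (snd c p))"

definition zatlas :: "('a, 'l) chart set" where
  "zatlas = {zchart c V L |c V f L h. adapted c V f L h}"

text \<open>The inverse function theorem for \<open>x \<mapsto> (f x, L x)\<close>, restricted to the slice where the first three
  coordinates vanish.\<close>

lemma adapted_exists: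
  assumes "p \<in> Z"
  shows "\<exists>c V f L h. adapted c V f L h \<and> p \<in> zdom c V"
proof -
  have "p \<in> topspace M" using assms by (simp add: singular_locus_def)
  then obtain c where c: "c \<in> A" "p \<in> fst c" using chart_exists by blast
  interpret F: near_symplectic_family "snd c ` fst c" "rep c" n by (rule family_chart[OF c(1)])
  have x: "snd c p \<in> csing c" using csing_iff[OF c] assms by simp
  obtain V0 f where V0: "open V0" "snd c p \<in> V0" "V0 \<subseteq> snd c ` fst c" "smooth_on V0 f"
    "\<And>x. x \<in> V0 \<Longrightarrow> f x = 0 \<longleftrightarrow> x \<in> csing c" "\<And>q. q \<in> V0 \<Longrightarrow> q \<in> csing c \<Longrightarrow> F.adapted_at f q"
    by (rule F.local_equation[OF x]) (rule that; assumption)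
  let ?D = "frechet_derivative f (at (snd c p))"
  have "surj ?D"
    unfolding surj_def
  proof
    fix s
    have "\<exists>v. (\<forall>w. rep c (snd c p) v w = 0) \<and> ?D v = s"
      using V0(6)[OF V0(2) x, unfolded F.adapted_at_def, THEN conjunct2] by (rule spec)
    then show "\<exists>v. s = ?D v" by auto
  qed
  then obtain L :: "(real, 'k) vec \<Rightarrow> real ^ 'l" where L: "linear L" "det (matrix (\<lambda>v. join P Q (?D v) (L v))) > 0"
    by (rule complementary_map[OF split linear_frechet_derivative_smooth[OF V0(4,2)]])
  let ?G = "\<lambda>x. join P Q (f x) (L x)"
  have dG: "frechet_derivative ?G (at x) = (\<lambda>v. join P Q (frechet_derivative f (at x) v) (L v))" if "x \<in> V0" for x
    by (rule ext) (rule join_derivative(2)[OF V0(1,4) L(1) that])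
  have det0: "0 < det (matrix (frechet_derivative ?G (at (snd c p))))" unfolding dG[OF V0(2)] by (rule L(2))
  obtain V g where V: "open V" "V \<subseteq> V0" "snd c p \<in> V" "open (?G ` V)" "\<And>x. x \<in> V \<Longrightarrow> g (?G x) = x"
    "smooth_on (?G ` V) g" "\<And>x. x \<in> V \<Longrightarrow> det (matrix (frechet_derivative ?G (at x))) > 0"
    by (rule smooth_inverse_function_theorem[OF V0(1) join_derivative(1)[OF V0(1,4) L(1)] V0(2) det0]) (rule that; assumption)
  let ?Y = "L ` (V \<inter> csing c)"
  have Gs: "?G x = join P Q 0 (L x)" if "x \<in> V" "x \<in> csing c" for x
  proof -
    have "x \<in> V0" using that V(2) by blast
    then have "f x = 0" using V0(5) that by blast
    then show ?thesis by simp
  qed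
  have Y: "?Y = (\<lambda>y. join P Q 0 y) -` (?G ` V)"
  proof (intro equalityI subsetI)
    fix y assume "y \<in> ?Y"
    then obtain x where x: "x \<in> V" "x \<in> csing c" "y = L x" by blast
    have "join P Q 0 y = ?G x" unfolding x(3) by (rule Gs[OF x(1,2), symmetric])
    then have "join P Q 0 y \<in> ?G ` V" by (rule image_eqI) (rule x(1))
    then show "y \<in> (\<lambda>y. join P Q 0 y) -` (?G ` V)" by simp
  next
    fix y assume "y \<in> (\<lambda>y. join P Q 0 y) -` (?G ` V)"
    then have "join P Q 0 y \<in> ?G ` V" by simp
    then obtain x where x: "join P Q 0 y = ?G x" "x \<in> V" by (rule imageE)
    then have "0 = f x" "y = L x" unfolding join_eq_iff[OF split] by simp_all
    moreover have "x \<in> csing c" using V0(5)[of x] V(2) x(2) \<open>0 = f x\<close> by (simp add: subset_iff)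
    ultimately show "y \<in> ?Y" using x(2) by blast
  qed
  have lin: "linear (\<lambda>y. join P Q 0 y)" using linear_join[OF module_hom_zero linear_ident, of P Q] .
  have openY: "open ?Y"
    unfolding Y by (rule open_vimage[OF V(4)]) (rule linear_continuous_on[OF linear_bounded[OF lin]])
  have im: "(\<lambda>y. join P Q 0 y) ` ?Y \<subseteq> ?G ` V" unfolding Y by blast
  have smh: "smooth_on ?Y (\<lambda>y. g (join P Q 0 y))"
    by (rule smooth_on_compose[OF openY V(4) smooth_on_linear[OF lin openY] V(6) im])
  have "adapted c V f L (\<lambda>y. g (join P Q 0 y))"
    unfolding adapted_def
  proof (intro conjI ballI)
    show "c \<in> A" "open V" "linear L" "open ?Y" "smooth_on ?Y (\<lambda>y. g (join P Q 0 y))" by fact+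
    show "V \<subseteq> snd c ` fst c" by (rule order_trans[OF V(2) V0(3)])
    show "smooth_on V f" by (rule smooth_on_subset[OF V0(4) V(2)])
    show "f x = 0 \<longleftrightarrow> x \<in> csing c" if "x \<in> V" for x by (rule V0(5)) (rule subsetD[OF V(2) that])
    fix x assume x: "x \<in> V \<inter> csing c"
    show "near_symplectic_family.adapted_at (rep c) n f x" by (rule V0(6)) (use V(2) x in auto)
    show "0 < det (matrix (\<lambda>v. join P Q (frechet_derivative f (at x) v) (L v)))"
    proof -
      have "x \<in> V" "x \<in> V0" using x V(2) by blast+
      then show ?thesis using V(7)[of x] by (simp only: dG)
    qed
    show "g (join P Q 0 (L x)) = x"
    proof -
      have xx: "x \<in> V" "x \<in> csing c" using x by blast+
      from V(5)[OF xx(1)] show ?thesis unfolding Gs[OF xx] .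
    qed
  qed
  moreover have "p \<in> zdom c V" using c(2) V(3) assms by (simp add: zdom_def)
  ultimately show ?thesis by blast
qed

context
  fixes c V f L h
  assumes ad: "adapted c V f L h"
begin

lemma ad_facts:
  shows ad_c: "c \<in> A" and ad_open: "open V" and ad_sub: "V \<subseteq> snd c ` fst c" and ad_f: "smooth_on V f" and ad_L: "linear L"
    and ad_Yopen: "open (L ` (V \<inter> csing c))" and ad_h: "smooth_on (L ` (V \<inter> csing c)) h"
    and ad_zero: "x \<in> V \<Longrightarrow> f x = 0 \<longleftrightarrow> x \<in> csing c"
    and ad_at: "x \<in> V \<Longrightarrow> x \<in> csing c \<Longrightarrow> near_symplectic_family.adapted_at (rep c) n f x"
    and ad_det: "x \<in> V \<Longrightarrow> x \<in> csing c \<Longrightarrow> det (matrix (\<lambda>v. join P Q (frechet_derivative f (at x) v) (L v))) > 0"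
    and ad_hL: "x \<in> V \<Longrightarrow> x \<in> csing c \<Longrightarrow> h (L x) = x"
  using ad unfolding adapted_def by blast+

lemma zdom_iff: "p \<in> zdom c V \<longleftrightarrow> p \<in> fst c \<and> snd c p \<in> V \<and> snd c p \<in> csing c"
  using csing_iff[OF ad_c] by (auto simp: zdom_def)

lemma h_at: "p \<in> zdom c V \<Longrightarrow> h (L (snd c p)) = snd c p"
  using ad_hL zdom_iff by simp

lemma h_in: "y \<in> L ` (V \<inter> csing c) \<Longrightarrow> h y \<in> V \<and> h y \<in> csing c \<and> L (h y) = y"
  using ad_hL by auto

lemma zimg: "(\<lambda>p. L (snd c p)) ` zdom c V = L ` (V \<inter> csing c)"
proof (intro equalityI subsetI)
  fix y assume "y \<in> (\<lambda>p. L (snd c p)) ` zdom c V"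
  then show "y \<in> L ` (V \<inter> csing c)" using zdom_iff by blast
next
  fix y assume "y \<in> L ` (V \<inter> csing c)"
  then obtain x where x: "x \<in> V" "x \<in> csing c" "y = L x" by blast
  then obtain p where "p \<in> fst c" "x = snd c p" using ad_sub by blast
  then show "y \<in> (\<lambda>p. L (snd c p)) ` zdom c V" using x zdom_iff[of p] by blast
qed

lemma zimg': "snd (zchart c V L) ` fst (zchart c V L) = L ` (V \<inter> csing c)"
  by (simp add: zchart_def zimg)

lemma chart_inv_h:
  assumes "y \<in> L ` (V \<inter> csing c)"
  shows "chart_inv c (h y) \<in> zdom c V" "snd c (chart_inv c (h y)) = h y" "chart_inv (zchart c V L) y = chart_inv c (h y)"
proof -
  have hy: "h y \<in> snd c ` fst c" using h_in[OF assms] ad_sub by blast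
  show e: "snd c (chart_inv c (h y)) = h y" by (rule chart_chart_inv[OF hy])
  show i: "chart_inv c (h y) \<in> zdom c V"
    unfolding zdom_iff e using chart_inv_in[OF hy] h_in[OF assms] by blast
  have inj: "inj_on (\<lambda>p. L (snd c p)) (zdom c V)"
  proof (rule inj_onI)
    fix p q assume pq: "p \<in> zdom c V" "q \<in> zdom c V" "L (snd c p) = L (snd c q)"
    have "snd c p = h (L (snd c p))" by (rule h_at[OF pq(1), symmetric])
    also have "\<dots> = snd c q" unfolding pq(3) by (rule h_at[OF pq(2)])
    finally have "snd c p = snd c q" .
    moreover have "p \<in> fst c" "q \<in> fst c" using pq zdom_iff by blast+
    ultimately show "p = q" by (rule inj_onD[OF chart_inj[OF ad_c]])
  qed
  have "L (snd c (chart_inv c (h y))) = y" unfolding e using h_in[OF assms] by blast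
  from inv_into_f_eq[OF inj i this] show "chart_inv (zchart c V L) y = chart_inv c (h y)"
    unfolding chart_inv_def[of "zchart c V L"] unfolding zchart_def fst_conv snd_conv .
qed

lemma linear_Dh: "y \<in> L ` (V \<inter> csing c) \<Longrightarrow> linear (frechet_derivative h (at y))"
  by (rule linear_frechet_derivative_smooth[OF ad_h])

lemma L_Dh:
  assumes "y \<in> L ` (V \<inter> csing c)"
  shows "L (frechet_derivative h (at y) u) = u"
proof -
  have 1: "frechet_derivative (\<lambda>y. L (h y)) (at y) = frechet_derivative (\<lambda>y. y) (at y)"
    by (rule frechet_derivative_cong_open[OF ad_Yopen assms]) (use h_in in blast)
  have 2: "frechet_derivative (\<lambda>y. L (h y)) (at y) u = L (frechet_derivative h (at y) u)"
    using frechet_derivative_compose_smooth[OF ad_h smooth_on_linear[OF ad_L open_UNIV] assms UNIV_I, of u]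
    by (simp only: frechet_derivative_linear[OF ad_L])
  have 3: "frechet_derivative (\<lambda>y. y) (at y) = (\<lambda>u. u)"
    by (rule frechet_derivative_at[symmetric]) (rule has_derivative_ident)
  show ?thesis unfolding 2[symmetric] 1 3 ..
qed

lemma Df_Dh:
  assumes "y \<in> L ` (V \<inter> csing c)"
  shows "frechet_derivative f (at (h y)) (frechet_derivative h (at y) u) = 0"
proof -
  have 1: "frechet_derivative (\<lambda>y. f (h y)) (at y) = frechet_derivative (\<lambda>y. 0) (at y)"
    by (rule frechet_derivative_cong_open[OF ad_Yopen assms]) (use h_in ad_zero in blast)
  have 2: "frechet_derivative (\<lambda>y. f (h y)) (at y) u = frechet_derivative f (at (h y)) (frechet_derivative h (at y) u)"
    by (rule frechet_derivative_compose_smooth[OF ad_h ad_f assms]) (use h_in[OF assms] in blast)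
  have 3: "frechet_derivative (\<lambda>y. 0 :: real ^ 3) (at y) = (\<lambda>u. 0)"
    by (rule frechet_derivative_at[symmetric]) (rule has_derivative_const)
  show ?thesis unfolding 2[symmetric] 1 3 ..
qed

text \<open>The parametrisation has the full kernel of \<open>Df\<close> as its tangent space.\<close>

lemma ker_Df:
  assumes "y \<in> L ` (V \<inter> csing c)" "frechet_derivative f (at (h y)) v = 0"
  shows "frechet_derivative h (at y) (L v) = v"
proof -
  let ?D = "frechet_derivative f (at (h y))" and ?H = "frechet_derivative h (at y)"
  note x = h_in[OF assms(1)]
  have D: "linear ?D" by (rule linear_frechet_derivative_smooth[OF ad_f]) (use x in blast)
  have lin: "linear (\<lambda>v. join P Q (?D v) (L v))" by (rule linear_join[OF D ad_L])
  have "0 < det (matrix (\<lambda>v. join P Q (?D v) (L v)))"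
    by (rule ad_det[OF x[THEN conjunct1] x[THEN conjunct2, THEN conjunct1]])
  then have "det (matrix (\<lambda>v. join P Q (?D v) (L v))) \<noteq> 0" by (rule less_imp_neq[THEN not_sym])
  then have ker: "\<forall>u. matrix (\<lambda>v. join P Q (?D v) (L v)) *v u = 0 \<longrightarrow> u = 0"
    by (simp only: det_nonzero_iff_ker)
  let ?u = "?H (L v) - v"
  have "?D ?u = ?D (?H (L v)) - ?D v" "L ?u = L (?H (L v)) - L v"
    by (rule linear_diff[OF D], rule linear_diff[OF ad_L])
  then have "?D ?u = 0" "L ?u = 0"
    unfolding Df_Dh[OF assms(1)] L_Dh[OF assms(1)] assms(2) by simp_all
  then have "matrix (\<lambda>v. join P Q (?D v) (L v)) *v ?u = 0"
    unfolding matrix_linear_mult[OF lin] by (simp only: join_0)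
  from ker[THEN spec, THEN mp, OF this] have "?u = 0" .
  then show ?thesis by simp
qed

lemma zdom_openin: "openin (subtopology M Z) (zdom c V)"
  unfolding zdom_def by (rule openin_subtopology_Int[OF chart_preimage_open[OF ad_c ad_open]])

lemma zchart_chart_on: "chart_on (subtopology M Z) (zchart c V L)"
proof -
  let ?Y = "L ` (V \<inter> csing c)" and ?W = "zdom c V"
  have WZ: "Z \<inter> ?W = ?W" by (auto simp: zdom_def)
  have top: "topspace (subtopology M ?W) = ?W"
    using chart_subset[OF ad_c] by (auto simp: zdom_def)
  have "homeomorphic_maps (subtopology M ?W) (top_of_set ?Y) (\<lambda>p. L (snd c p)) (\<lambda>y. chart_inv c (h y))"
    unfolding homeomorphic_maps_def
  proof (intro conjI ballI)
    have "fst c \<inter> ?W = ?W" by (auto simp: zdom_def)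
    then have "continuous_map (subtopology M ?W) euclidean (snd c)"
      using continuous_map_from_subtopology[OF chart_continuous[OF ad_c], of ?W]
      by (simp only: subtopology_subtopology)
    then have "continuous_map (subtopology M ?W) euclidean (L \<circ> snd c)"
      by (rule continuous_map_compose) (simp add: linear_continuous_on[OF linear_bounded[OF ad_L]])
    then show "continuous_map (subtopology M ?W) (top_of_set ?Y) (\<lambda>p. L (snd c p))"
      using zimg by (auto simp: continuous_map_in_subtopology o_def top)
    have "continuous_map (top_of_set ?Y) (top_of_set (snd c ` fst c)) h"
      using smooth_on_imp_continuous_on[OF ad_h] h_in ad_sub by auto
    then have "continuous_map (top_of_set ?Y) M (chart_inv c \<circ> h)"
      by (rule continuous_map_compose[OF _ chart_inv_continuous[OF ad_c]])
    then show "continuous_map (top_of_set ?Y) (subtopology M ?W) (\<lambda>y. chart_inv c (h y))"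
      using chart_inv_h(1) by (auto simp: continuous_map_in_subtopology o_def)
    show "chart_inv c (h (L (snd c p))) = p" if "p \<in> topspace (subtopology M ?W)" for p
      using that h_at[of p] chart_inv_chart[OF ad_c, of p] zdom_iff[of p] unfolding top by simp
    show "L (snd c (chart_inv c (h y))) = y" if "y \<in> topspace (top_of_set ?Y)" for y
      using that chart_inv_h(2) h_in by simp
  qed
  then have "homeomorphic_map (subtopology (subtopology M Z) ?W) (top_of_set ?Y) (\<lambda>p. L (snd c p))"
    unfolding subtopology_subtopology WZ homeomorphic_map_maps by blast
  then show ?thesis
    unfolding chart_on_def zimg' using zdom_openin ad_Yopen by (simp add: zchart_def)
qed

lemma inclusion_rep:
  assumes "d \<in> A" "T = L ` (snd c ` (zdom c V \<inter> fst d))"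
  shows "open T" "smooth_on T (local_rep (zchart c V L) d (\<lambda>p. p))" "T \<subseteq> L ` (V \<inter> csing c)"
    "h ` T \<subseteq> snd c ` (fst c \<inter> fst d)"
    "\<And>y. y \<in> T \<Longrightarrow> local_rep (zchart c V L) d (\<lambda>p. p) y = transition c d (h y)"
proof -
  show TY: "T \<subseteq> L ` (V \<inter> csing c)" using zimg unfolding assms(2) by blast
  show hT: "h ` T \<subseteq> snd c ` (fst c \<inter> fst d)"
  proof
    fix x assume "x \<in> h ` T"
    then obtain p where "p \<in> zdom c V" "p \<in> fst d" "x = h (L (snd c p))" unfolding assms(2) by blast
    then show "x \<in> snd c ` (fst c \<inter> fst d)" using h_at zdom_iff by auto
  qed
  have "T = L ` (V \<inter> csing c) \<inter> h -` (snd c ` (fst c \<inter> fst d))"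
  proof (intro equalityI subsetI IntI vimageI2)
    fix y assume "y \<in> T" then show "y \<in> L ` (V \<inter> csing c)" "h y \<in> snd c ` (fst c \<inter> fst d)" using TY hT by blast+
  next
    fix y assume y: "y \<in> L ` (V \<inter> csing c) \<inter> h -` (snd c ` (fst c \<inter> fst d))"
    then obtain p where p: "p \<in> fst c" "p \<in> fst d" "h y = snd c p" by blast
    then have "p \<in> zdom c V" "y = L (snd c p)" using h_in[of y] y zdom_iff[of p] by auto
    then show "y \<in> T" using p(2) unfolding assms(2) by blast
  qed
  then show "open T"
    using continuous_open_preimage[OF smooth_on_imp_continuous_on[OF ad_h] ad_Yopen overlap_open[OF ad_c assms(1)]] by simp
  show eq: "local_rep (zchart c V L) d (\<lambda>p. p) y = transition c d (h y)" if "y \<in> T" for y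
    using chart_inv_h(3)[of y] TY that by (simp add: local_rep_def subset_iff)
  have "smooth_on T (\<lambda>y. transition c d (h y))"
    by (rule smooth_on_compose[OF \<open>open T\<close> overlap_open[OF ad_c assms(1)] smooth_on_subset[OF ad_h TY] transition_smooth[OF ad_c assms(1)] hT])
  then show "smooth_on T (local_rep (zchart c V L) d (\<lambda>p. p))"
    using smooth_on_cong[OF \<open>open T\<close> eq] by simp
qed

lemma inclusion_derivative:
  assumes "d \<in> A" "p \<in> zdom c V" "p \<in> fst d"
  shows "frechet_derivative (local_rep (zchart c V L) d (\<lambda>p. p)) (at (L (snd c p))) u
    = Dtr c d p (frechet_derivative h (at (L (snd c p))) u)"
proof -
  let ?T = "L ` (snd c ` (zdom c V \<inter> fst d))"
  note i = inclusion_rep[OF assms(1) refl]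
  have y: "L (snd c p) \<in> ?T" using assms by blast
  have "frechet_derivative (local_rep (zchart c V L) d (\<lambda>p. p)) (at (L (snd c p)))
      = frechet_derivative (\<lambda>y. transition c d (h y)) (at (L (snd c p)))"
    by (rule frechet_derivative_cong_open[OF i(1) y i(5)])
  moreover have "frechet_derivative (\<lambda>y. transition c d (h y)) (at (L (snd c p))) u
      = frechet_derivative (transition c d) (at (h (L (snd c p)))) (frechet_derivative h (at (L (snd c p))) u)"
    by (rule frechet_derivative_compose_smooth[OF smooth_on_subset[OF ad_h i(3)] transition_smooth[OF ad_c assms(1)] y])
      (use i(4) y in blast)
  ultimately show ?thesis by (simp only: h_at[OF assms(2)])
qed

end

lemma zatlasI: "adapted c V f L h \<Longrightarrow> zchart c V L \<in> zatlas"
  unfolding zatlas_def by blast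

lemma zatlasE:
  assumes "b \<in> zatlas"
  obtains c V f L h where "adapted c V f L h" "b = zchart c V L"
  using assms unfolding zatlas_def by blast

lemma ztransition:
  assumes ad: "adapted c V f L h" and ad': "adapted c' V' f' L' h'"
    and T: "T = L ` (snd c ` (zdom c V \<inter> zdom c' V'))"
  shows "open T" "smooth_on T (transition (zchart c V L) (zchart c' V' L'))"
    "\<And>y. y \<in> T \<Longrightarrow> transition (zchart c V L) (zchart c' V' L') y = L' (transition c c' (h y))"
proof -
  note i = inclusion_rep[OF ad ad_c[OF ad'] refl]
  let ?T = "L ` (snd c ` (zdom c V \<inter> fst c'))"
  let ?\<tau> = "local_rep (zchart c V L) c' (\<lambda>p. p)"
  have eq: "transition (zchart c V L) (zchart c' V' L') y = L' (?\<tau> y)" for y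
    by (simp add: local_rep_def zchart_def)
  have TT: "T \<subseteq> ?T" unfolding T by (auto simp: zdom_def)
  have "T = ?T \<inter> ?\<tau> -` V'"
  proof (intro equalityI subsetI IntI vimageI2)
    fix y assume y: "y \<in> T"
    then show "y \<in> ?T" using TT by blast
    obtain p where p: "p \<in> zdom c V" "p \<in> zdom c' V'" "y = L (snd c p)" using y unfolding T by blast
    have "?\<tau> y = transition c c' (h y)" by (rule i(5)) (use y TT in blast)
    also have "\<dots> = snd c' p"
      using h_at[OF ad p(1)] p transition_at[OF ad_c[OF ad], of p c'] zdom_iff[OF ad, of p] by simp
    finally show "?\<tau> y \<in> V'" using p(2) by (simp add: zdom_def)
  next
    fix y assume y: "y \<in> ?T \<inter> ?\<tau> -` V'"
    then obtain p where p: "p \<in> zdom c V" "p \<in> fst c'" "y = L (snd c p)" by blast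
    have "?\<tau> y = transition c c' (h y)" by (rule i(5)) (use y in blast)
    also have "\<dots> = snd c' p"
      using h_at[OF ad p(1)] p transition_at[OF ad_c[OF ad], of p c'] zdom_iff[OF ad, of p] by simp
    finally have "p \<in> zdom c' V'" using y p by (auto simp: zdom_def)
    then show "y \<in> T" using p unfolding T by blast
  qed
  then show op: "open T"
    using continuous_open_preimage[OF smooth_on_imp_continuous_on[OF i(2)] i(1) ad_open[OF ad']] by simp
  show "smooth_on T (transition (zchart c V L) (zchart c' V' L'))"
    unfolding eq by (rule smooth_on_compose_linear[OF linear_bounded[OF ad_L[OF ad']] op smooth_on_subset[OF i(2) TT]])
  show "transition (zchart c V L) (zchart c' V' L') y = L' (transition c c' (h y))" if "y \<in> T" for y
    unfolding eq using i(5)[of y] that TT by (simp add: subset_iff)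
qed

lemma topspace_Z: "topspace (subtopology M Z) = Z"
  by (auto simp: singular_locus_def)

lemma smooth_manifold_Z: "smooth_manifold (subtopology M Z) zatlas"
  unfolding smooth_manifold_def
proof (intro conjI ballI)
  show "Hausdorff_space (subtopology M Z)" "second_countable (subtopology M Z)"
    using smooth_manifold by (simp_all add: smooth_manifold_def Hausdorff_space_subtopology second_countable_subtopology)
  show "chart_on (subtopology M Z) b" if "b \<in> zatlas" for b
    using that by (elim zatlasE) (simp only: zchart_chart_on)
  show "(\<Union>b\<in>zatlas. fst b) = topspace (subtopology M Z)"
    unfolding topspace_Z
  proof (intro equalityI subsetI)
    fix p assume "p \<in> (\<Union>b\<in>zatlas. fst b)"
    then obtain b where b: "b \<in> zatlas" "p \<in> fst b" by blast
    obtain c V f L h where "adapted c V f L h" "b = zchart c V L"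
      using b(1) by (elim zatlasE) (rule that; assumption)
    then show "p \<in> Z" using b(2) by (simp add: zchart_def zdom_def)
  next
    fix p assume "p \<in> Z"
    then obtain c V f L h where "adapted c V f L h" "p \<in> zdom c V" using adapted_exists by blast
    then have "zchart c V L \<in> zatlas" "p \<in> fst (zchart c V L)"
      using zatlasI by (blast, simp add: zchart_def)
    then show "p \<in> (\<Union>b\<in>zatlas. fst b)" by blast
  qed
  fix b b' assume "b \<in> zatlas" "b' \<in> zatlas"
  then obtain c V f L h c' V' f' L' h' where b: "adapted c V f L h" "b = zchart c V L"
    "adapted c' V' f' L' h'" "b' = zchart c' V' L'" by (elim zatlasE) (rule that; assumption)
  have "snd b ` (fst b \<inter> fst b') = L ` (snd c ` (zdom c V \<inter> zdom c' V'))"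
    unfolding b(2,4) zchart_def fst_conv snd_conv by (simp only: image_image)
  then show "smooth_on (snd b ` (fst b \<inter> fst b')) (transition b b')"
    unfolding b(2,4) using ztransition(2)[OF b(1,3) refl] by simp
qed

sublocale Zm: atlas "subtopology M Z" zatlas
  by unfold_locales (rule smooth_manifold_Z)

text \<open>The differential is defined through an arbitrary chart around the point; the chain rule
  replaces it by the given one.\<close>

lemma differential_inclusion:
  assumes ad: "adapted c V f L h" and p: "p \<in> zdom c V" and v: "v \<in> tangent_space zatlas p"
  shows "differential zatlas A (\<lambda>p. p) p v
    = coord_vector A c p (frechet_derivative h (at (L (snd c p))) (v (zchart c V L)))"
proof
  fix d
  let ?b = "zchart c V L"
  let ?b1 = "SOME b. b \<in> charts_at zatlas p"
  have b: "?b \<in> zatlas" "p \<in> fst ?b" using zatlasI[OF ad] p by (simp_all add: zchart_def)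
  have "?b \<in> charts_at zatlas p" using b by (simp add: charts_at_def)
  then have "?b1 \<in> charts_at zatlas p" by (rule someI)
  then have b1: "?b1 \<in> zatlas" "p \<in> fst ?b1" by (simp_all add: charts_at_def)
  then obtain c1 V1 f1 L1 h1 where ad1: "adapted c1 V1 f1 L1 h1" and e1: "?b1 = zchart c1 V1 L1"
    by (elim zatlasE) (rule that; assumption)
  have p1: "p \<in> zdom c1 V1" using b1(2) unfolding e1 by (simp add: zchart_def)
  show "differential zatlas A (\<lambda>p. p) p v d = coord_vector A c p (frechet_derivative h (at (L (snd c p))) (v ?b)) d"
  proof (cases "d \<in> charts_at A p")
    case False
    then show ?thesis by (simp add: differential_def Let_def coord_vector_def)
  next
    case True
    then have d: "d \<in> A" "p \<in> fst d" by (simp_all add: charts_at_def)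
    let ?r = "local_rep (zchart c V L) d (\<lambda>p. p)" and ?r1 = "local_rep (zchart c1 V1 L1) d (\<lambda>p. p)"
    let ?t = "transition (zchart c V L) (zchart c1 V1 L1)"
    let ?y = "L (snd c p)"
    let ?T = "L ` (snd c ` (zdom c V \<inter> zdom c1 V1))" and ?S1 = "L1 ` (snd c1 ` (zdom c1 V1 \<inter> fst d))"
    have tp: "?t ?y = L1 (snd c1 p)"
      using Zm.transition_at[OF b, of "zchart c1 V1 L1"] by (simp add: zchart_def)
    have ty: "?y \<in> ?T" using p p1 by blast
    note t = ztransition[OF ad ad1 refl]
    note i1 = inclusion_rep[OF ad1 d(1) refl]
    have y1: "?t ?y \<in> ?S1" unfolding tp using p1 d(2) by blast
    define U where "U = ?T \<inter> ?t -` ?S1"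
    have U: "open U" "?y \<in> U"
      using continuous_open_preimage[OF smooth_on_imp_continuous_on[OF t(2)] t(1) i1(1)] ty y1 by (auto simp: U_def)
    have r: "?r y = ?r1 (?t y)" if yU: "y \<in> U" for y
    proof -
      have "y \<in> snd ?b ` fst ?b" using yU zimg'[OF ad] unfolding U_def zchart_def by auto
      moreover have "chart_inv ?b y \<in> fst (zchart c1 V1 L1)"
      proof -
        obtain q where q: "q \<in> zdom c V" "q \<in> zdom c1 V1" "y = L (snd c q)" using yU unfolding U_def by blast
        have "chart_inv ?b (snd ?b q) = q" by (rule Zm.chart_inv_chart[OF b(1)]) (use q in \<open>simp add: zchart_def\<close>)
        then show ?thesis using q by (simp add: zchart_def)
      qed
      ultimately show ?thesis
        unfolding local_rep_def using Zm.chart_inv_chart[of "zchart c1 V1 L1" "chart_inv ?b y"] b1(1) e1 by simp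
    qed
    have "frechet_derivative ?r (at ?y) = frechet_derivative (\<lambda>y. ?r1 (?t y)) (at ?y)"
      by (rule frechet_derivative_cong_open[OF U r])
    moreover have "frechet_derivative (\<lambda>y. ?r1 (?t y)) (at ?y) u = frechet_derivative ?r1 (at (?t ?y)) (frechet_derivative ?t (at ?y) u)" for u
      by (rule frechet_derivative_compose_smooth[OF t(2) i1(2) ty y1])
    moreover have "v (zchart c1 V1 L1) = frechet_derivative ?t (at ?y) (v ?b)"
    proof -
      have "coord_vector zatlas ?b p (v ?b) (zchart c1 V1 L1) = v (zchart c1 V1 L1)"
        using Zm.tangent_coord[OF v b] by simp
      moreover have "coord_vector zatlas ?b p (v ?b) (zchart c1 V1 L1) = Zm.Dtr ?b (zchart c1 V1 L1) p (v ?b)"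
        by (rule Zm.coord_vector_nth) (use b1 e1 in simp_all)
      moreover have "snd ?b p = ?y" by (simp add: zchart_def)
      ultimately show ?thesis by simp
    qed
    ultimately have chain: "frechet_derivative ?r1 (at (L1 (snd c1 p))) (v (zchart c1 V1 L1)) = frechet_derivative ?r (at ?y) (v ?b)"
      by (simp only: tp)
    have "differential zatlas A (\<lambda>p. p) p v d = frechet_derivative (local_rep ?b1 d (\<lambda>p. p)) (at (snd ?b1 p)) (v ?b1)"
      using True by (simp add: differential_def Let_def)
    also have "\<dots> = frechet_derivative ?r1 (at (L1 (snd c1 p))) (v (zchart c1 V1 L1))"
      unfolding e1 by (simp add: zchart_def)
    also have "\<dots> = Dtr c d p (frechet_derivative h (at ?y) (v ?b))"
      unfolding chain by (rule inclusion_derivative[OF ad d(1) p d(2)])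
    finally show ?thesis using d by (simp add: coord_vector_nth)
  qed
qed

lemma embedded: "embedded_submanifold M A Z zatlas"
  unfolding embedded_submanifold_def
proof (intro conjI ballI smooth_manifold_Z)
  show "Z \<subseteq> topspace M" by (auto simp: singular_locus_def)
  show "smooth_map (subtopology M Z) zatlas M A (\<lambda>p. p)"
    unfolding smooth_map_def
  proof (intro conjI ballI)
    show "continuous_map (subtopology M Z) M (\<lambda>p. p)" by (rule continuous_map_from_subtopology) simp
    fix b d assume "b \<in> zatlas" and d: "d \<in> A"
    then obtain c V f L h where b: "adapted c V f L h" "b = zchart c V L" by (elim zatlasE) (rule that; assumption)
    have "snd b ` (fst b \<inter> (\<lambda>p. p) -` fst d) = L ` (snd c ` (zdom c V \<inter> fst d))"
      unfolding b(2) zchart_def fst_conv snd_conv by (simp only: image_image vimage_ident)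
    then show "smooth_on (snd b ` (fst b \<inter> (\<lambda>p. p) -` fst d)) (local_rep b d (\<lambda>p. p))"
      unfolding b(2) using inclusion_rep(2)[OF b(1) d refl] by simp
  qed
  fix p assume "p \<in> Z"
  then obtain c V f L h where ad: "adapted c V f L h" and p: "p \<in> zdom c V" using adapted_exists by blast
  have c: "c \<in> A" "p \<in> fst c" using ad_c[OF ad] p by (simp_all add: zdom_def)
  have b: "zchart c V L \<in> zatlas" "p \<in> fst (zchart c V L)" using zatlasI[OF ad] p by (simp_all add: zchart_def)
  have y: "L (snd c p) \<in> L ` (V \<inter> csing c)" using p zdom_iff[OF ad] by blast
  show "inj_on (differential zatlas A (\<lambda>p. p) p) (tangent_space zatlas p)"
  proof (rule inj_onI)
    fix v w assume v: "v \<in> tangent_space zatlas p" and w: "w \<in> tangent_space zatlas p"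
      and eq: "differential zatlas A (\<lambda>p. p) p v = differential zatlas A (\<lambda>p. p) p w"
    have "differential zatlas A (\<lambda>p. p) p v c = differential zatlas A (\<lambda>p. p) p w c" using eq by simp
    then have "frechet_derivative h (at (L (snd c p))) (v (zchart c V L)) = frechet_derivative h (at (L (snd c p))) (w (zchart c V L))"
      unfolding differential_inclusion[OF ad p v] differential_inclusion[OF ad p w] coord_vector_self[OF c] .
    then have "v (zchart c V L) = w (zchart c V L)" 
      using L_Dh[OF ad y, of "v (zchart c V L)"] L_Dh[OF ad y, of "w (zchart c V L)"] by argo
    then show "v = w" using Zm.tangent_coord[OF v b] Zm.tangent_coord[OF w b] by argo
  qed
qed

end

section \<open>Orientation of the singular locus\<close>

lemma (in form_family) kgrad_frame_change:
  assumes x: "x \<in> U" and k': "\<And>i. k' (enum4 i) = (\<Sum>j\<in>UNIV. g $ i $ j *\<^sub>R k (enum4 j))"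
  shows "kgrad \<rho> x k' v = congr g (kgrad \<rho> x k v)"
proof -
  interpret D: alternating_form "dform \<rho> x v" by (rule alternating_dform[OF x])
  have "kgrad \<rho> x k' v $ i $ j = congr g (kgrad \<rho> x k v) $ i $ j" for i j
  proof -
    have "kgrad \<rho> x k' v $ i $ j = (\<Sum>a\<in>UNIV. g $ i $ a * (\<Sum>b\<in>UNIV. g $ j $ b * dform \<rho> x v (k (enum4 a)) (k (enum4 b))))"
      unfolding kgrad_def vec_lambda_beta k' D.sum_left D.scale_left
      unfolding D.sum_right D.scale_right ..
    also have "\<dots> = congr g (kgrad \<rho> x k v) $ i $ j"
      unfolding congr_nth kgrad_def vec_lambda_beta sum_distrib_left
      by (intro sum.cong refl) (simp only: mult_ac)
    finally show ?thesis .
  qed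
  then show ?thesis by (simp add: vec_eq_iff)
qed

context near_symplectic_manifold
begin

lemma kernel_transition:
  assumes c: "c \<in> A" "d \<in> A" "p \<in> fst c" "p \<in> fst d" and u: "\<And>w. form_rep A \<omega> c (snd c p) u w = 0"
  shows "form_rep A \<omega> d (snd d p) (Dtr c d p u) w = 0"
proof -
  have w: "Dtr c d p (Dtr d c p w) = w" using Dtr_Dtr[OF c(2,1,2,4,3,4)] Dtr_id[OF c(2,4)] by simp
  have "form_rep A \<omega> c (snd c p) u (Dtr d c p w) = form_rep A \<omega> d (snd d p) (Dtr c d p u) (Dtr c d p (Dtr d c p w))"
    by (rule form_rep_transition[OF c])
  then show ?thesis unfolding w u by simp
qed

lemma pos_frame_transition:
  assumes c: "c \<in> A" "d \<in> A" "p \<in> fst c" "p \<in> fst d" and k: "pos_frame n (form_rep A \<omega> c (snd c p)) k"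
  shows "pos_frame n (form_rep A \<omega> d (snd d p)) (\<lambda>j. Dtr c d p (k j))"
  unfolding pos_frame_def
proof (intro conjI allI impI)
  have k1: "\<And>j w. j < 4 \<Longrightarrow> form_rep A \<omega> c (snd c p) (k j) w = 0"
    and k2: "hyperbolic_from (form_rep A \<omega> c (snd c p)) 2 n k" and k3: "det (frame_mat k) > 0"
    using k unfolding pos_frame_def by blast+
  show "form_rep A \<omega> d (snd d p) (Dtr c d p (k j)) w = 0" if "j < 4" for j w
    by (rule kernel_transition[OF c]) (rule k1[OF that])
  show "hyperbolic_from (form_rep A \<omega> d (snd d p)) 2 n (\<lambda>j. Dtr c d p (k j))"
    using k2 unfolding hyperbolic_from_def form_rep_transition[OF c] .
  show "det (frame_mat (\<lambda>j. Dtr c d p (k j))) > 0"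
    unfolding frame_mat_linear[OF linear_Dtr[OF c]] det_mul using det_Dtr_pos[OF c] k3 by (rule mult_pos_pos)
qed

text \<open>On the kernel the gradient does not depend on the chart: the second derivatives of the transition map
  occur only paired with kernel vectors.\<close>

lemma kgrad_transition:
  assumes c: "c \<in> A" "d \<in> A" "p \<in> fst c" "p \<in> fst d"
    and k: "\<And>j w. j < 4 \<Longrightarrow> form_rep A \<omega> c (snd c p) (k j) w = 0"
  shows "kgrad (form_rep A \<omega> d) (snd d p) (\<lambda>j. Dtr c d p (k j)) (Dtr c d p v) = kgrad (form_rep A \<omega> c) (snd c p) k v"
proof -
  let ?\<tau> = "transition c d" and ?S = "snd c ` (fst c \<inter> fst d)"
  let ?r = "form_rep A \<omega> c" and ?r' = "form_rep A \<omega> d"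
  interpret F: form_family "snd d ` fst d" "form_rep A \<omega> d" by (rule form_family_chart[OF c(2)])
  have op: "open ?S" by (rule overlap_open[OF c(1,2)])
  have sm: "smooth_on ?S ?\<tau>" by (rule transition_smooth[OF c(1,2)])
  have x: "snd c p \<in> ?S" using c by blast
  have im: "?\<tau> ` ?S \<subseteq> snd d ` fst d"
  proof
    fix z assume "z \<in> ?\<tau> ` ?S"
    then obtain q where q: "q \<in> fst c" "q \<in> fst d" "z = ?\<tau> (snd c q)" by blast
    have "z = snd d q" unfolding q(3) by (rule transition_at[OF c(1) q(1)])
    then show "z \<in> snd d ` fst d" using q(2) by blast
  qed
  have eq: "?r y u w = ?r' (?\<tau> y) (frechet_derivative ?\<tau> (at y) u) (frechet_derivative ?\<tau> (at y) w)" if y: "y \<in> ?S" for y u w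
  proof -
    obtain q where q: "q \<in> fst c" "q \<in> fst d" "y = snd c q" using y by blast
    show ?thesis unfolding q(3) transition_at[OF c(1) q(1)] by (rule form_rep_transition[OF c(1,2) q(1,2)])
  qed
  have "dform ?r (snd c p) v (k i) (k j) = dform ?r' (snd d p) (Dtr c d p v) (Dtr c d p (k i)) (Dtr c d p (k j))"
    if ij: "i < 4" "j < 4" for i j
  proof -
    have k0: "?r' (snd d p) (Dtr c d p (k m)) w = 0" if "m < 4" for m w
      by (rule kernel_transition[OF c]) (rule k[OF that])
    interpret R: alternating_form "?r' (snd d p)" by (rule alternating_form_rep[OF c(2)]) (use c in blast)
    have k0': "?r' (snd d p) w (Dtr c d p (k m)) = 0" if "m < 4" for m w
      using R.skew[of w] k0[OF that, of w] by simp
    have "dform ?r (snd c p) v (k i) (k j)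
        = frechet_derivative (\<lambda>y. ?r' (?\<tau> y) (frechet_derivative ?\<tau> (at y) (k i)) (frechet_derivative ?\<tau> (at y) (k j))) (at (snd c p)) v"
      unfolding dform_def by (rule fun_cong[OF frechet_derivative_cong_open[OF op x eq]])
    also have "\<dots> = dform ?r' (?\<tau> (snd c p)) (Dtr c d p v) (Dtr c d p (k i)) (Dtr c d p (k j))
        + ?r' (?\<tau> (snd c p)) (frechet_derivative (\<lambda>y. frechet_derivative ?\<tau> (at y) (k i)) (at (snd c p)) v) (Dtr c d p (k j))
        + ?r' (?\<tau> (snd c p)) (Dtr c d p (k i)) (frechet_derivative (\<lambda>y. frechet_derivative ?\<tau> (at y) (k j)) (at (snd c p)) v)"
      by (rule F.form_derivative[OF op sm smooth_on_derivative[OF sm] smooth_on_derivative[OF sm] im x])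
    also have "\<dots> = dform ?r' (snd d p) (Dtr c d p v) (Dtr c d p (k i)) (Dtr c d p (k j))"
      unfolding transition_at[OF c(1,3)] k0[OF ij(1)] k0'[OF ij(2)] by (simp only: add_0_right)
    finally show ?thesis .
  qed
  from this[OF enum4_less enum4_less] show ?thesis unfolding kgrad_def by (simp only:)
qed

text \<open>Both \<open>Df\<close> and \<open>Df'\<close> are self-dual parts of the same gradient, in two oriented frames of the kernel.  The map in
  question is the comparison of the two self-dual parts, expressed in the basis of the normal space that
  \<open>Df\<close> maps to the standard one.\<close>

lemma normal_orientation:
  assumes c: "c \<in> A" "d \<in> A" "p \<in> fst c" "p \<in> fst d"
    and f: "near_symplectic_family.adapted_at (form_rep A \<omega> c) n f (snd c p)"
    and f': "near_symplectic_family.adapted_at (form_rep A \<omega> d) n f' (snd d p)"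
    and R: "linear R" "\<And>s. frechet_derivative f (at (snd c p)) (R s) = s"
  shows "det (matrix (\<lambda>s. frechet_derivative f' (at (snd d p)) (Dtr c d p (R s)))) > 0"
proof -
  interpret F: near_symplectic_family "snd c ` fst c" "form_rep A \<omega> c" n by (rule family_chart[OF c(1)])
  interpret F': near_symplectic_family "snd d ` fst d" "form_rep A \<omega> d" n by (rule family_chart[OF c(2)])
  have x: "snd c p \<in> snd c ` fst c" and x': "snd d p \<in> snd d ` fst d" using c by blast+
  obtain k where k: "pos_frame n (form_rep A \<omega> c (snd c p)) k"
      "\<forall>v. frechet_derivative f (at (snd c p)) v = sd 1 (kgrad (form_rep A \<omega> c) (snd c p) k v)"
      "\<forall>v. 0 \<le> pf4 (kgrad (form_rep A \<omega> c) (snd c p) k v)"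
    using f unfolding F.adapted_at_def by blast
  obtain k' where k': "pos_frame n (form_rep A \<omega> d (snd d p)) k'"
      "\<forall>v. frechet_derivative f' (at (snd d p)) v = sd 1 (kgrad (form_rep A \<omega> d) (snd d p) k' v)"
    using f' unfolding F'.adapted_at_def by blast
  obtain g :: "real ^ 4 ^ 4" where g: "det g > 0"
    "\<And>i. k' (enum4 i) = (\<Sum>j\<in>UNIV. g $ i $ j *\<^sub>R Dtr c d p (k (enum4 j)))"
    by (rule pos_frame_change[OF alternating_form_rep[OF c(2) x'] cardk n2 pos_frame_transition[OF c k(1)] k'(1)])
      (rule that; assumption)
  let ?S = "\<lambda>v. kgrad (form_rep A \<omega> c) (snd c p) k v"
  have rad: "form_rep A \<omega> c (snd c p) (k j) w = 0" if "j < 4" for j w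
    using k(1) that unfolding pos_frame_def by blast
  have F'J: "frechet_derivative f' (at (snd d p)) (Dtr c d p v) = sd 1 (congr g (?S v))" for v
  proof -
    have "kgrad (form_rep A \<omega> d) (snd d p) k' (Dtr c d p v)
        = congr g (kgrad (form_rep A \<omega> d) (snd d p) (\<lambda>j. Dtr c d p (k j)) (Dtr c d p v))"
      by (rule F'.kgrad_frame_change[OF x']) (rule g(2))
    also have "\<dots> = congr g (?S v)" by (simp only: kgrad_transition[OF c rad])
    finally show ?thesis by (simp only: k'(2)[rule_format])
  qed
  let ?T = "\<lambda>a. ?S (R (axis a 1))"
  have one: "sd_mat 1 ?T = mat 1"
    unfolding sd_mat_def k(2)[rule_format, symmetric] R(2) by (simp add: vec_eq_iff mat_def axis_def)
  have comb: "comb3 ?T v = ?S (R v)" for v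
  proof -
    have lin: "linear (\<lambda>s. ?S (R s))" using linear_compose[OF R(1) F.linear_kgrad[OF x]] by (simp add: o_def)
    have "v = (\<Sum>a\<in>UNIV. v $ a *\<^sub>R axis a 1)" using basis_expansion[of v] by (simp add: scalar_mult_eq_scaleR)
    then have "?S (R v) = ?S (R (\<Sum>a\<in>UNIV. v $ a *\<^sub>R axis a 1))" by simp
    also have "\<dots> = (\<Sum>a\<in>UNIV. v $ a *\<^sub>R ?S (R (axis a 1)))"
      by (simp only: linear_sum[OF lin] linear_scale[OF lin])
    finally show ?thesis by (simp only: comb3_def)
  qed
  have "semidef 1 ?T"
    unfolding semidef_def one comb using F.skew_kgrad[OF x] k(3) by simp
  then have "det (sd_mat (1 * sgn (det g)) (\<lambda>a. congr g (?T a))) * det g * det (sd_mat 1 ?T) > 0"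
    using g(1) by (intro sd_mat_congr_sign) simp_all
  then have "det (sd_mat 1 (\<lambda>a. congr g (?T a))) > 0"
    unfolding one using g(1) by (simp add: zero_less_mult_iff)
  moreover have "sd_mat 1 (\<lambda>a. congr g (?T a)) = matrix (\<lambda>s. frechet_derivative f' (at (snd d p)) (Dtr c d p (R s)))"
    unfolding F'J sd_mat_def matrix_def ..
  ultimately show ?thesis by simp
qed

end

context split_near_symplectic_manifold
begin

text \<open>In terms of \<open>(f, L)\<close> and \<open>(f', L')\<close>, vectors tangent to the singular locus remain tangent.\<close>

lemma ztransition_derivative:
  assumes ad: "adapted c V f L h" and ad': "adapted c' V' f' L' h'" and p: "p \<in> zdom c V" "p \<in> zdom c' V'"
  shows "frechet_derivative (transition (zchart c V L) (zchart c' V' L')) (at (L (snd c p))) u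
      = L' (Dtr c c' p (frechet_derivative h (at (L (snd c p))) u))"
    and "frechet_derivative f' (at (snd c' p)) (Dtr c c' p (frechet_derivative h (at (L (snd c p))) u)) = 0"
proof -
  let ?T = "L ` (snd c ` (zdom c V \<inter> zdom c' V'))" and ?T1 = "L ` (snd c ` (zdom c V \<inter> fst c'))"
  let ?r = "local_rep (zchart c V L) c' (\<lambda>p. p)" and ?y = "L (snd c p)"
  note i = inclusion_rep[OF ad ad_c[OF ad'] refl]
  have opT: "open ?T" by (rule ztransition(1)[OF ad ad' refl])
  have TT: "?T \<subseteq> ?T1" by (auto simp: zdom_def)
  have r: "smooth_on ?T ?r" by (rule smooth_on_subset[OF i(2) TT])
  have y: "?y \<in> ?T" using p by blast
  have pc': "p \<in> fst c'" using p(2) by (simp add: zdom_def)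
  have at: "?r (L (snd c q)) = snd c' q" if q: "q \<in> zdom c V" "q \<in> zdom c' V'" for q
  proof -
    have "q \<in> fst c" "q \<in> fst c'" using q by (simp_all add: zdom_def)
    then have "?r (L (snd c q)) = transition c c' (h (L (snd c q)))" by (intro i(5)) (use q in blast)
    also have "\<dots> = snd c' q" unfolding h_at[OF ad q(1)] by (rule transition_at[OF ad_c[OF ad] \<open>q \<in> fst c\<close>])
    finally show ?thesis .
  qed
  have J: "frechet_derivative ?r (at ?y) u = Dtr c c' p (frechet_derivative h (at ?y) u)"
    by (rule inclusion_derivative[OF ad ad_c[OF ad'] p(1) pc'])
  have "transition (zchart c V L) (zchart c' V' L') = (\<lambda>y. L' (?r y))"
    by (simp add: local_rep_def zchart_def fun_eq_iff)
  then show "frechet_derivative (transition (zchart c V L) (zchart c' V' L')) (at ?y) u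
      = L' (Dtr c c' p (frechet_derivative h (at ?y) u))"
    using frechet_derivative_compose_smooth[OF r smooth_on_linear[OF ad_L[OF ad'] open_UNIV] y UNIV_I, of u]
    by (simp only: frechet_derivative_linear[OF ad_L[OF ad']] J)
  have rV: "?r y \<in> V'" and f0: "f' (?r y) = 0" if yT: "y \<in> ?T" for y
  proof -
    obtain q where q: "q \<in> zdom c V" "q \<in> zdom c' V'" "y = L (snd c q)" using yT by blast
    have z: "snd c' q \<in> V'" "snd c' q \<in> csing c'" using q(2) zdom_iff[OF ad'] by blast+
    show "?r y \<in> V'" unfolding q(3) at[OF q(1,2)] by (rule z(1))
    show "f' (?r y) = 0" unfolding q(3) at[OF q(1,2)] using ad_zero[OF ad' z(1)] z(2) by blast
  qed
  have "frechet_derivative (\<lambda>y. f' (?r y)) (at ?y) = frechet_derivative (\<lambda>y. 0) (at ?y)"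
    by (rule frechet_derivative_cong_open[OF opT y f0])
  also have "\<dots> = (\<lambda>u. 0)" by (rule frechet_derivative_at[symmetric]) (rule has_derivative_const)
  finally have "frechet_derivative (\<lambda>y. f' (?r y)) (at ?y) u = 0" by simp
  moreover have "frechet_derivative (\<lambda>y. f' (?r y)) (at ?y) u = frechet_derivative f' (at (?r ?y)) (frechet_derivative ?r (at ?y) u)"
    by (rule frechet_derivative_compose_smooth[OF r ad_f[OF ad'] y rV[OF y]])
  ultimately show "frechet_derivative f' (at (snd c' p)) (Dtr c c' p (frechet_derivative h (at ?y) u)) = 0"
    unfolding J at[OF p] by simp
qed

text \<open>The transition of \<open>M\<close> between the coordinates \<open>(f, L)\<close> and \<open>(f', L')\<close> is block triangular.  Its
  determinant and that of the normal block are positive, hence also that of the tangential block.\<close>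

lemma ztransition_det:
  assumes ad: "adapted c V f L h" and ad': "adapted c' V' f' L' h'" and p: "p \<in> zdom c V" "p \<in> zdom c' V'"
  shows "det (matrix (frechet_derivative (transition (zchart c V L) (zchart c' V' L')) (at (L (snd c p))))) > 0"
proof -
  let ?x = "snd c p" and ?x' = "snd c' p"
  let ?y = "L ?x"
  let ?F = "frechet_derivative f (at ?x)" and ?F' = "frechet_derivative f' (at ?x')" and ?J = "Dtr c c' p"
  let ?G = "\<lambda>v. join P Q (?F v) (L v)" and ?G' = "\<lambda>v. join P Q (?F' v) (L' v)"
  let ?H = "frechet_derivative h (at ?y)"
  have cc: "c \<in> A" "c' \<in> A" "p \<in> fst c" "p \<in> fst c'"
    using ad_c[OF ad] ad_c[OF ad'] p by (simp_all add: zdom_def)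
  have x: "?x \<in> V" "?x \<in> csing c" and x': "?x' \<in> V'" "?x' \<in> csing c'"
    using p zdom_iff[OF ad] zdom_iff[OF ad'] by blast+
  have y: "?y \<in> L ` (V \<inter> csing c)" using x by blast
  have hy: "h ?y = ?x" by (rule h_at[OF ad p(1)])
  have lF: "linear ?F" and lF': "linear ?F'" and lL: "linear L" and lL': "linear L'" and lJ: "linear ?J"
    using linear_frechet_derivative_smooth[OF ad_f[OF ad] x(1)] linear_frechet_derivative_smooth[OF ad_f[OF ad'] x'(1)]
      ad_L[OF ad] ad_L[OF ad'] linear_Dtr[OF cc] by blast+
  have lG: "linear ?G" and lG': "linear ?G'" by (rule linear_join[OF lF lL], rule linear_join[OF lF' lL'])
  have dG: "det (matrix ?G) > 0" by (rule ad_det[OF ad x])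
  have dG': "det (matrix ?G') > 0" by (rule ad_det[OF ad' x'])
  have "invertible (matrix ?G)" using dG by (simp add: invertible_det_nz)
  then obtain N where N: "matrix ?G ** N = mat 1" "N ** matrix ?G = mat 1" unfolding invertible_def by blast
  have "det (matrix ?G) * det N = 1" by (simp only: det_mul[symmetric] N det_I)
  then have dN: "det N > 0" using dG by (metis zero_less_mult_pos zero_less_one)
  have GN: "?G (N *v w) = w" for w
  proof -
    have "?G (N *v w) = matrix ?G *v (N *v w)" by (rule matrix_linear_mult[OF lG, symmetric])
    then show ?thesis by (simp only: matrix_vector_mul_assoc N matrix_vector_mul_lid)
  qed
  have NG: "N *v ?G v = v" for v
  proof -
    have "N *v ?G v = N *v (matrix ?G *v v)" by (rule arg_cong[OF matrix_linear_mult[OF lG, symmetric]])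
    then show ?thesis by (simp only: matrix_vector_mul_assoc N matrix_vector_mul_lid)
  qed
  define R where "R s = N *v join P Q s 0" for s
  have lR: "linear R"
  proof -
    have "linear (\<lambda>s. join P Q s 0)" by (rule linear_join[OF linear_ident module_hom_zero])
    from linear_compose[OF this matrix_vector_mul_linear] show ?thesis by (simp add: o_def R_def[abs_def])
  qed
  have FR: "?F (R s) = s" for s
  proof -
    have "join P Q (?F (R s)) (L (R s)) = join P Q s 0" unfolding R_def by (rule GN)
    then show ?thesis by (simp only: join_eq_iff[OF split])
  qed
  have NH: "N *v join P Q 0 z = ?H z" for z
  proof -
    have "?G (?H z) = join P Q 0 z" using Df_Dh[OF ad y, of z] L_Dh[OF ad y, of z] unfolding hy by simp
    then show ?thesis using NG[of "?H z"] by simp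
  qed
  have Nj: "N *v join P Q s z = R s + ?H z" for s z
  proof -
    have "join P Q s z = join P Q s 0 + join P Q 0 z" by (simp flip: join_add)
    then show ?thesis by (simp add: matrix_vector_right_distrib NH R_def)
  qed
  let ?t = "frechet_derivative (transition (zchart c V L) (zchart c' V' L')) (at ?y)"
  have t: "?t u = L' (?J (?H u))" and t0: "?F' (?J (?H u)) = 0" for u
    by (rule ztransition_derivative[OF ad ad' p])+
  have lt: "linear ?t"
    unfolding t[abs_def] by (rule linear_compose[OF linear_compose[OF linear_Dh[OF ad y] lJ] lL', unfolded o_def])
  have lA: "linear (\<lambda>s. ?F' (?J (R s)))"
    by (rule linear_compose[OF linear_compose[OF lR lJ] lF', unfolded o_def])
  let ?B = "matrix ?G' ** (matrix ?J ** N)"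
  have B: "?B *v join P Q s z = join P Q (matrix (\<lambda>s. ?F' (?J (R s))) *v s) (matrix ?t *v z + L' (?J (R s)))" for s z
  proof -
    have "?B *v join P Q s z = ?G' (?J (N *v join P Q s z))"
      by (simp only: matrix_vector_mul_assoc[symmetric] matrix_linear_mult[OF lG'] matrix_linear_mult[OF lJ])
    also have "\<dots> = join P Q (?F' (?J (R s)) + ?F' (?J (?H z))) (L' (?J (R s)) + L' (?J (?H z)))"
      unfolding Nj by (simp only: linear_add[OF lJ] linear_add[OF lF'] linear_add[OF lL'])
    also have "\<dots> = join P Q (matrix (\<lambda>s. ?F' (?J (R s))) *v s) (matrix ?t *v z + L' (?J (R s)))"
      unfolding matrix_linear_mult[OF lA] matrix_linear_mult[OF lt] t t0 by (simp only: add_0_left add_0_right add.commute)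
    finally show ?thesis .
  qed
  have "det ?B > 0"
    unfolding det_mul by (intro mult_pos_pos dG' dN det_Dtr_pos cc)
  moreover have "det (matrix (\<lambda>s. ?F' (?J (R s)))) > 0"
    by (rule normal_orientation[OF cc ad_at[OF ad x] ad_at[OF ad' x'] lR FR])
  ultimately show ?thesis by (rule det_block_pos[OF split B])
qed

lemma oriented_Z: "oriented_manifold (subtopology M Z) zatlas"
  unfolding oriented_manifold_def
proof (intro conjI ballI smooth_manifold_Z)
  fix b b' p assume b: "b \<in> zatlas" and b': "b' \<in> zatlas" and p: "p \<in> fst b \<inter> fst b'"
  obtain c V f L h where ad: "adapted c V f L h" "b = zchart c V L" using b by (elim zatlasE) (rule that; assumption)
  obtain c' V' f' L' h' where ad': "adapted c' V' f' L' h'" "b' = zchart c' V' L'"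
    using b' by (elim zatlasE) (rule that; assumption)
  have pz: "p \<in> zdom c V" "p \<in> zdom c' V'" using p unfolding ad(2) ad'(2) by (simp_all add: zchart_def)
  have s: "snd b p = L (snd c p)" unfolding ad(2) by (simp add: zchart_def)
  show "det (matrix (Zm.Dtr b b' p)) > 0"
    unfolding s unfolding ad(2) ad'(2) by (rule ztransition_det[OF ad(1) ad'(1) pz])
qed

end

section \<open>The restriction of the form to the singular locus\<close>

lemma (in atlas) tangent_add:
  assumes "u \<in> tangent_space A p" "v \<in> tangent_space A p"
  shows "(\<lambda>c. a *\<^sub>R u c + b *\<^sub>R v c) \<in> tangent_space A p"
  unfolding tangent_space_def
proof (intro CollectI conjI allI ballI impI)
  fix c assume c: "c \<notin> charts_at A p"
  then have "u c = 0" "v c = 0" using assms unfolding tangent_space_def by blast+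
  then show "a *\<^sub>R u c + b *\<^sub>R v c = 0" by simp
next
  fix c d assume cd: "c \<in> charts_at A p" "d \<in> charts_at A p"
  then have lin: "linear (Dtr c d p)" by (intro linear_Dtr) (simp_all add: charts_at_def)
  have "u d = Dtr c d p (u c)" "v d = Dtr c d p (v c)"
    using assms cd unfolding tangent_space_def by blast+
  then show "a *\<^sub>R u d + b *\<^sub>R v d = Dtr c d p (a *\<^sub>R u c + b *\<^sub>R v c)"
    by (simp only: linear_add[OF lin] linear_scale[OF lin])
qed

context split_near_symplectic_manifold
begin

abbreviation \<omega>Z :: "('a, 'l) form2" where "\<omega>Z \<equiv> pullback zatlas A (\<lambda>p. p) \<omega>"

lemma restriction_at:
  assumes ad: "adapted c V f L h" and p: "p \<in> zdom c V" and u: "u \<in> tangent_space zatlas p" and w: "w \<in> tangent_space zatlas p"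
  shows "\<omega>Z p u w = rep c (snd c p) (frechet_derivative h (at (L (snd c p))) (u (zchart c V L)))
      (frechet_derivative h (at (L (snd c p))) (w (zchart c V L)))"
proof -
  have "p \<in> fst c" using p by (simp add: zdom_def)
  then have "chart_inv c (snd c p) = p" by (rule chart_inv_chart[OF ad_c[OF ad]])
  then show ?thesis
    unfolding pullback_def differential_inclusion[OF ad p u] differential_inclusion[OF ad p w] form_rep_def by simp
qed

lemma restriction_rep:
  assumes ad: "adapted c V f L h" and y: "y \<in> L ` (V \<inter> csing c)"
  shows "form_rep zatlas \<omega>Z (zchart c V L) y u w
    = rep c (h y) (frechet_derivative h (at y) u) (frechet_derivative h (at y) w)"
proof -
  let ?b = "zchart c V L" and ?q = "chart_inv c (h y)"
  have b: "?b \<in> zatlas" by (rule zatlasI[OF ad])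
  have q: "?q \<in> zdom c V" and s: "snd c ?q = h y" and inv: "chart_inv ?b y = ?q" by (rule chart_inv_h[OF ad y])+
  have qb: "?q \<in> fst ?b" using q by (simp add: zchart_def)
  have Ly: "L (h y) = y" using h_in[OF ad y] by blast
  have "\<omega>Z ?q (coord_vector zatlas ?b ?q u) (coord_vector zatlas ?b ?q w)
      = rep c (h y) (frechet_derivative h (at y) u) (frechet_derivative h (at y) w)"
    using restriction_at[OF ad q Zm.coord_vector_tangent[OF b qb, of u] Zm.coord_vector_tangent[OF b qb, of w]]
    unfolding Zm.coord_vector_self[OF b qb] s Ly .
  then show ?thesis unfolding form_rep_def[of zatlas] inv .
qed

lemma chart_image_h:
  assumes ad: "adapted c V f L h"
  shows "h ` (L ` (V \<inter> csing c)) \<subseteq> snd c ` fst c"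
  using h_in[OF ad] ad_sub[OF ad] by blast

lemma smooth_restriction: "smooth_form2 (subtopology M Z) zatlas \<omega>Z"
  unfolding smooth_form2_def
proof (intro conjI ballI allI)
  fix p u v w and a b :: real assume pZ: "p \<in> topspace (subtopology M Z)"
    and u: "u \<in> tangent_space zatlas p" and v: "v \<in> tangent_space zatlas p" and w: "w \<in> tangent_space zatlas p"
  obtain c V f L h where ad: "adapted c V f L h" and p: "p \<in> zdom c V"
    using adapted_exists pZ unfolding topspace_Z by blast
  have "p \<in> fst c" using p by (simp add: zdom_def)
  then have x: "snd c p \<in> snd c ` fst c" by blast
  interpret R: alternating_form "rep c (snd c p)" by (rule alternating_form_rep[OF ad_c[OF ad] x])
  have "L (snd c p) \<in> L ` (V \<inter> csing c)" using p zdom_iff[OF ad] by blast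
  then have lin: "linear (frechet_derivative h (at (L (snd c p))))" by (rule linear_Dh[OF ad])
  show "\<omega>Z p (\<lambda>c. a *\<^sub>R u c + b *\<^sub>R v c) w = a * \<omega>Z p u w + b * \<omega>Z p v w"
    unfolding restriction_at[OF ad p Zm.tangent_add[OF u v] w] restriction_at[OF ad p u w] restriction_at[OF ad p v w]
    by (simp only: linear_add[OF lin] linear_scale[OF lin] R.add_left R.scale_left)
  show "\<omega>Z p u v = - \<omega>Z p v u"
    unfolding restriction_at[OF ad p u v] restriction_at[OF ad p v u] by (rule R.skew)
next
  fix b :: "('a, 'l) chart" and u w assume "b \<in> zatlas"
  then obtain c V f L h where ad: "adapted c V f L h" and b: "b = zchart c V L" by (elim zatlasE) (rule that; assumption)
  interpret F: form_family "snd c ` fst c" "rep c" by (rule form_family_chart[OF ad_c[OF ad]])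
  have "smooth_on (L ` (V \<inter> csing c)) (\<lambda>y. rep c (h y) (frechet_derivative h (at y) u) (frechet_derivative h (at y) w))"
    by (rule F.smooth_form[OF ad_Yopen[OF ad] ad_h[OF ad] smooth_on_derivative[OF ad_h[OF ad]]
          smooth_on_derivative[OF ad_h[OF ad]] chart_image_h[OF ad]])
  moreover have "smooth_on (L ` (V \<inter> csing c)) (\<lambda>y. form_rep zatlas \<omega>Z (zchart c V L) y u w)
      \<longleftrightarrow> smooth_on (L ` (V \<inter> csing c)) (\<lambda>y. rep c (h y) (frechet_derivative h (at y) u) (frechet_derivative h (at y) w))"
    by (rule smooth_on_cong[OF ad_Yopen[OF ad]]) (rule restriction_rep[OF ad])
  ultimately have "smooth_on (L ` (V \<inter> csing c)) (\<lambda>y. form_rep zatlas \<omega>Z (zchart c V L) y u w)" by blast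
  then show "smooth_on (snd b ` fst b) (\<lambda>y. form_rep zatlas \<omega>Z b y u w)"
    unfolding b zimg'[OF ad] .
qed

sublocale Zf: form_on_manifold "subtopology M Z" zatlas \<omega>Z
  by unfold_locales (rule smooth_restriction)

text \<open>The exterior derivative of the pullback by \<open>h\<close> is the pullback of the exterior derivative, as the second
  derivatives of \<open>h\<close> cancel by symmetry.\<close>

lemma closed_restriction: "closed_form2 (subtopology M Z) zatlas \<omega>Z"
  unfolding closed_form2_def
proof (intro conjI ballI allI smooth_restriction)
  fix b :: "('a, 'l) chart" and y u v w assume "b \<in> zatlas" and y0: "y \<in> snd b ` fst b"
  then obtain c V f L h where ad: "adapted c V f L h" and b: "b = zchart c V L" by (elim zatlasE) (rule that; assumption)
  let ?Y = "L ` (V \<inter> csing c)"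
  have y: "y \<in> ?Y" using y0 unfolding b zimg'[OF ad] .
  interpret F: form_family "snd c ` fst c" "rep c" by (rule form_family_chart[OF ad_c[OF ad]])
  have x: "h y \<in> snd c ` fst c" using chart_image_h[OF ad] y by blast
  interpret R: alternating_form "rep c (h y)" by (rule alternating_form_rep[OF ad_c[OF ad] x])
  let ?H = "frechet_derivative h (at y)"
  define H2 where "H2 u v = frechet_derivative (\<lambda>y. frechet_derivative h (at y) u) (at y) v" for u v
  have sym: "H2 u v = H2 v u" for u v
    unfolding H2_def by (rule mixed_derivatives_commute[OF ad_Yopen[OF ad] ad_h[OF ad] y])
  have D: "frechet_derivative (\<lambda>y. form_rep zatlas \<omega>Z b y u w) (at y) v
      = dform (rep c) (h y) (?H v) (?H u) (?H w) + rep c (h y) (H2 u v) (?H w) + rep c (h y) (?H u) (H2 w v)" for u v w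
  proof -
    have "frechet_derivative (\<lambda>y. form_rep zatlas \<omega>Z b y u w) (at y)
        = frechet_derivative (\<lambda>y. rep c (h y) (frechet_derivative h (at y) u) (frechet_derivative h (at y) w)) (at y)"
      unfolding b by (rule frechet_derivative_cong_open[OF ad_Yopen[OF ad] y restriction_rep[OF ad]])
    moreover have "frechet_derivative (\<lambda>y. rep c (h y) (frechet_derivative h (at y) u) (frechet_derivative h (at y) w)) (at y) v
        = dform (rep c) (h y) (?H v) (?H u) (?H w) + rep c (h y) (H2 u v) (?H w) + rep c (h y) (?H u) (H2 w v)"
      unfolding H2_def
      by (rule F.form_derivative[OF ad_Yopen[OF ad] ad_h[OF ad] smooth_on_derivative[OF ad_h[OF ad]]
            smooth_on_derivative[OF ad_h[OF ad]] chart_image_h[OF ad] y])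
    ultimately show ?thesis by (simp only:)
  qed
  have "ext_deriv A \<omega> c (h y) (?H u) (?H v) (?H w) = 0"
    using ns ad_c[OF ad] x unfolding near_symplectic_def closed_form2_def by blast
  then have closed: "dform (rep c) (h y) (?H u) (?H v) (?H w) - dform (rep c) (h y) (?H v) (?H u) (?H w)
      + dform (rep c) (h y) (?H w) (?H u) (?H v) = 0"
    unfolding ext_deriv_def dform_def .
  show "ext_deriv zatlas \<omega>Z b y u v w = 0"
    unfolding ext_deriv_def D
    using closed R.skew[of "?H v" "H2 w u"] sym[of u v] sym[of w u] sym[of w v] by simp
qed

text \<open>The radical of the restriction consists of kernel vectors of \<open>\<omega>\<close> that are tangent to the singular
  locus, because the tangent space and the kernel \<open>K\<close> together span everything.  These vectors form the
  kernel of \<open>Df\<close> on \<open>K\<close>, of dimension \<open>4 - 3\<close>.\<close>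

lemma restriction_nondegenerate:
  assumes card: "CARD('l) + 3 = 2 * n" and p: "p \<in> Z"
  shows "\<not> power_vanishes_at zatlas \<omega>Z (n - 2) p"
proof
  assume pv: "power_vanishes_at zatlas \<omega>Z (n - 2) p"
  obtain c V f L h where ad: "adapted c V f L h" and pz: "p \<in> zdom c V" using adapted_exists[OF p] by blast
  interpret F: near_symplectic_family "snd c ` fst c" "rep c" n by (rule family_chart[OF ad_c[OF ad]])
  let ?b = "zchart c V L" and ?x = "snd c p"
  let ?y = "L ?x"
  let ?D = "frechet_derivative f (at ?x)" and ?H = "frechet_derivative h (at ?y)"
  have x: "?x \<in> V" "?x \<in> csing c" using pz zdom_iff[OF ad] by blast+
  have xU: "?x \<in> snd c ` fst c" using ad_sub[OF ad] x(1) by blast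
  have y: "?y \<in> L ` (V \<inter> csing c)" using x by blast
  have hy: "h ?y = ?x" by (rule h_at[OF ad pz])
  have lH: "linear ?H" by (rule linear_Dh[OF ad y])
  have lD: "linear ?D" by (rule linear_frechet_derivative_smooth[OF ad_f[OF ad] x(1)])
  interpret R: alternating_form "rep c ?x" by (rule alternating_form_rep[OF ad_c[OF ad] xU])
  define \<eta> where "\<eta> u w = rep c ?x (?H u) (?H w)" for u w
  have alt: "alternating_form \<eta>"
  proof (rule alternating_form.intro)
    show "\<eta> (u + v) w = \<eta> u w + \<eta> v w" for u v w unfolding \<eta>_def linear_add[OF lH] by (rule R.add_left)
    show "\<eta> (a *\<^sub>R u) w = a * \<eta> u w" for a u w unfolding \<eta>_def linear_scale[OF lH] by (rule R.scale_left)
    show "\<eta> u w = - \<eta> w u" for u w unfolding \<eta>_def by (rule R.skew)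
  qed
  let ?K = "{u. \<forall>w. rep c ?x u w = 0}"
  let ?N = "{z \<in> UNIV. \<forall>w\<in>UNIV. \<eta> z w = 0}"
  have dimK: "dim ?K = 4"
  proof (rule F.ker_dim[OF xU])
    show "wedge_power (rep c ?x) (n - 1) v = 0" for v using x(2) unfolding F.sing_def by blast
  qed
  have sK: "subspace ?K"
    unfolding subspace_def by (simp add: R.add_left R.scale_left)
  have onto: "\<exists>v. (\<forall>w. rep c ?x v w = 0) \<and> ?D v = s" for s
    using ad_at[OF ad x, unfolded F.adapted_at_def, THEN conjunct2] by (rule spec)
  have "?D ` ?K = UNIV"
  proof (intro equalityI subsetI UNIV_I)
    fix s
    obtain v where "\<forall>w. rep c ?x v w = 0" "?D v = s" using onto by blast
    then show "s \<in> ?D ` ?K" by blast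
  qed
  then have "dim {v \<in> ?K. ?D v = 0} + DIM(real ^ 3) = 4"
    unfolding dimK[symmetric] by (rule rank_nullity_onto[OF lD sK])
  then have dim1: "dim {v \<in> ?K. ?D v = 0} = 1" by simp
  have "?N \<subseteq> L ` {v \<in> ?K. ?D v = 0}"
  proof
    fix z assume "z \<in> ?N"
    then have z: "rep c ?x (?H z) (?H w) = 0" for w by (simp add: \<eta>_def)
    have "rep c ?x (?H z) v = 0" for v
    proof -
      obtain k where k: "\<forall>w. rep c ?x k w = 0" "?D k = ?D v" using onto by blast
      have "?D (v - k) = 0" using k(2) by (simp add: linear_diff[OF lD])
      then have "?H (L (v - k)) = v - k" by (intro ker_Df[OF ad y]) (simp only: hy)
      then have "rep c ?x (?H z) (v - k) = 0" using z[of "L (v - k)"] by simp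
      moreover have "rep c ?x (?H z) k = 0" using R.skew[of "?H z" k] k(1) by simp
      ultimately show ?thesis by (simp add: R.diff_right)
    qed
    moreover have "?D (?H z) = 0" using Df_Dh[OF ad y, of z] unfolding hy .
    ultimately have "?H z \<in> {v \<in> ?K. ?D v = 0}" by simp
    moreover have "z = L (?H z)" by (rule L_Dh[OF ad y, symmetric])
    ultimately show "z \<in> L ` {v \<in> ?K. ?D v = 0}" by (rule rev_image_eqI)
  qed
  then have "dim ?N \<le> dim (L ` {v \<in> ?K. ?D v = 0})" by (rule dim_subset)
  also have "\<dots> \<le> 1" using dim_image_le[OF ad_L[OF ad], of "{v \<in> ?K. ?D v = 0}"] unfolding dim1 .
  finally have dimN: "dim ?N \<le> 1" .
  obtain r e where e: "hyperbolic_from \<eta> 0 r e" "dim (UNIV :: (real ^ 'l) set) \<le> 2 * r + dim ?N"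
    by (rule hyperbolic_basis_dim[OF alt subspace_UNIV]) (rule that; assumption)
  have "n - 2 \<le> r" using e(2) dimN card n2 by (simp add: dim_UNIV)
  then have "hyperbolic_from \<eta> 0 (n - 2) e" using e(1) unfolding hyperbolic_from_def by simp
  from wedge_power_hyperbolic[OF alternating_form.skew[OF alt] this le0]
  obtain C where C: "C > 0" "wedge_power \<eta> (n - 2) e = C * wedge_power \<eta> 0 e" by blast
  have "\<eta> = form_rep zatlas \<omega>Z ?b ?y"
    by (intro ext) (simp only: restriction_rep[OF ad y] \<eta>_def hy)
  moreover have "?b \<in> zatlas" "p \<in> fst ?b" "snd ?b p = ?y" using zatlasI[OF ad] pz by (simp_all add: zchart_def)
  ultimately have "wedge_power \<eta> (n - 2) e = 0" using Zf.power_vanishes_iff[of ?b p "n - 2"] pv by simp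
  then show False using C by simp
qed

end

theorem proposition4p2:
  fixes M :: "'a topology"
    and A :: "('a, 'k::{finite,linorder}) chart set"
    and \<omega> :: "('a, 'k) form2"
    and n :: nat
  assumes "oriented_manifold M A"
    and "CARD('k) = 2 * n"
    and "near_symplectic M A n \<omega>"
    and "CARD('l::finite) + 3 = 2 * n"
  shows "\<exists>B :: ('a, 'l) chart set.
           embedded_submanifold M A (singular_locus M A n \<omega>) B \<and>
           hamiltonian_structure (subtopology M (singular_locus M A n \<omega>)) B (n - 1)
             (pullback B A (\<lambda>p. p) \<omega>)"
proof -
  have n2: "2 \<le> n" using assms(4) zero_less_card_finite[where 'a = 'l] by linarith
  have "CARD('k) = CARD(3 + 'l)" using assms(2,4) by simp
  then obtain e :: "3 + 'l \<Rightarrow> 'k" where e: "bij e"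
    using finite_same_card_bij[of "UNIV :: (3 + 'l) set" "UNIV :: 'k set"] by auto
  define P Q where "P i = e (Inl i)" and "Q j = e (Inr j)" for i j
  have "split_index P Q"
    unfolding split_index_def
  proof (intro conjI)
    have inj: "inj e" using e by (rule bij_is_inj)
    show "inj P" "inj Q" "range P \<inter> range Q = {}"
      using injD[OF inj] by (auto simp: P_def Q_def inj_def)
    have "i \<in> range P \<union> range Q" for i
    proof -
      obtain s where "i = e s" using e by (metis bij_pointE)
      then show ?thesis by (cases s) (auto simp: P_def Q_def)
    qed
    then show "range P \<union> range Q = UNIV" by blast
  qed
  then interpret split_near_symplectic_manifold M A \<omega> n P Q
    by unfold_locales (use assms n2 in simp_all)
  have "CARD('l) = 2 * (n - 1) - 1" using assms(4) by simp
  moreover have "\<not> power_vanishes_at zatlas \<omega>Z (n - 1 - 1) q" if "q \<in> Z" for q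
    using restriction_nondegenerate[OF assms(4) that] by (simp add: numeral_2_eq_2)
  ultimately have "hamiltonian_structure (subtopology M Z) zatlas (n - 1) \<omega>Z"
    unfolding hamiltonian_structure_def topspace_Z using oriented_Z closed_restriction by blast
  then show ?thesis using embedded by blast
qed

end
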